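(* Let $A$ be a $\Bbbk[q^{\pm1}]$-algebra and let $(\tau,\delta)$ be a $q$-skew extension of $A$. (1) The Ore extension $A[t;\tau,\delta]$ is a $\Bbbk[q^{\pm1}]$-algebra and for $\epsilon\in\Bbbk^\times$, $(A[t;\tau,\delta])_\epsilon=A_\epsilon[t;\tau,\delta]$. (2) Suppose $C_\epsilon=B_\epsilon[t^m]$, where $B_\epsilon$ is a central subalgebra of $A_\epsilon$ and $m$ is the order of $\tau|_{B_\epsilon}$. Then the induced Poisson structure on $C_\epsilon$ is a Poisson Ore extension of the induced structure on $B_\epsilon$. In particular, with $z=\sigma(t^m)$, for $b,b'\in B_\epsilon$ we have $\{b,b'\}_{C_\epsilon}=\{b,b'\}_{B_\epsilon}$ and $\{z,b\}=\alpha(b)z+\beta(b)$, where $$\alpha(b)=\sigma\left(\frac{\tau^m(a)-a}{q-\epsilon}\right)\quad\text{and}\quad\beta(b)=\sigma\left(\frac{\delta^m(a)}{q-\epsilon}\right)\quad\text{for } a\in\sigma^{-1}(b).$$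
   Context: $\Bbbk$ is an algebraically closed field of characteristic zero; all algebras are $\Bbbk$-algebras. Ore extension: $A[t;\tau,\delta]$ has $ta=\tau(a)t+\delta(a)$ for $a\in A$, where $\tau\in\mathrm{Aut}(A)$ and $\delta$ is a $\tau$-derivation, $\delta(ab)=\delta(a)b+\tau(a)\delta(b)$. For a nonzero divisor $q\in A$, the pair $(\tau,\delta)$ is a $q$-skew extension of $A$ if $\tau(q)=q$, $\delta(q)=0$ and $\tau\delta=q\,\delta\tau$. Specialization: for a $\Bbbk[q^{\pm1}]$-algebra $R$ and $\epsilon\in\Bbbk^\times$, $R_\epsilon:=R/(q-\epsilon)$, and $\sigma:R\to R_\epsilon$ is the canonical projection. The maps induced by $\tau,\delta$ on $A_\epsilon$ are denoted by the same symbols. The projection $\sigma$ induces a Poisson structure on the center $\mathcal{Z}(R_\epsilon)$ via $\{\sigma(r),\sigma(s)\}=\sigma\left(\frac{rs-sr}{q-\epsilon}\right)$ for $r,s\in\sigma^{-1}(\mathcal{Z}(R_\epsilon))$; the induced Poisson structures on $B_\epsilon$ and $C_\epsilon$ are given by this formula. In (2), $\sigma$ is the canonical projection $A[t;\tau,\delta]\to A_\epsilon[t;\tau,\delta]$, which restricts to $A\to A_\epsilon$, and $a\in\sigma^{-1}(b)$ denotes a lift of $b$ to $A$. Poisson Ore extension: all Poisson algebras are commutative. Let $B$ be a Poisson algebra with bracket $\{\,,\}_B$. A derivation $\alpha$ of $B$ is a Poisson derivation if $\alpha(\{a,b\}_B)=\{\alpha(a),b\}_B+\{a,\alpha(b)\}_B$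 for all $a,b\in B$. A derivation $\beta$ of $B$ is an $\alpha$-derivation ($\alpha$ a Poisson derivation) if $\beta(\{a,b\}_B)-\{\beta(a),b\}_B-\{a,\beta(b)\}_B=\beta(a)\alpha(b)-\alpha(a)\beta(b)$ for all $a,b\in B$. Then the Poisson Ore extension $B[z;\alpha,\beta]_P$ is the polynomial ring $B[z]$ with Poisson bracket $\{a,b\}=\{a,b\}_B$, $\{z,a\}=\alpha(a)z+\beta(a)$ for $a,b\in B$.
   Formalization: The α-derivation condition has right side α(a)β(b)−β(a)α(b), the sign forced by {z,b}=α(b)z+β(b). In (2), q−ε is assumed a nonzero divisor and C_ε central and closed under the bracket; of m only m>0 and τ^m=id on B_ε are assumed. *)

theory Defs
  imports
    "HOL-Library.Poly_Mapping"
    "HOL-Algebra.UnivPoly"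
    "HOL-Algebra.QuotRing"
    "HOL-Algebra.Divisibility"
    "HOL-Algebra.Generated_Rings"
    "HOL-Algebra.Algebraic_Closure_Type"
begin

section \<open>Algebras over a commutative ring\<close>

text \<open>The group algebra of the integers, that is, the Laurent polynomial ring \<open>\<k>[q\<^sup>\<plusminus>\<^sup>1]\<close>.\<close>

type_synonym 'k laurent = "int \<Rightarrow>\<^sub>0 'k"

definition laurent_const :: "'k::comm_ring_1 \<Rightarrow> 'k laurent"
  where "laurent_const c = Poly_Mapping.single 0 c"

definition laurent_q :: "'k::comm_ring_1 laurent"
  where "laurent_q = Poly_Mapping.single 1 1"

definition ring_center :: "('a, 's) ring_scheme \<Rightarrow> 'a set"
  where "ring_center R = {z \<in> carrier R. \<forall>x\<in>carrier R. z \<otimes>\<^bsub>R\<^esub> x = x \<otimes>\<^bsub>R\<^esub> z}"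

text \<open>An algebra over \<open>'r\<close> is a ring together with its structure map
  \<open>\<eta>\<close>, a unital homomorphism from \<open>'r\<close> into the center.\<close>

definition algebra_over :: "('r::comm_ring_1 \<Rightarrow> 'a) \<Rightarrow> ('a, 's) ring_scheme \<Rightarrow> bool"
  where "algebra_over \<eta> R \<longleftrightarrow>
    ring R \<and> \<eta> \<in> ring_hom ring_of_type_algebra R \<and> range \<eta> \<subseteq> ring_center R"

abbreviation scalars :: "('k::comm_ring_1 laurent \<Rightarrow> 'a) \<Rightarrow> 'k \<Rightarrow> 'a"
  where "scalars \<eta> \<equiv> \<lambda>c. \<eta> (laurent_const c)"

definition central_subalgebra :: "('k::comm_ring_1 \<Rightarrow> 'a) \<Rightarrow> ('a, 's) ring_scheme \<Rightarrow> 'a set \<Rightarrow> bool"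
  where "central_subalgebra \<kappa> R B \<longleftrightarrow> subring B R \<and> range \<kappa> \<subseteq> B \<and> B \<subseteq> ring_center R"

definition non_zero_divisor :: "('a, 's) ring_scheme \<Rightarrow> 'a \<Rightarrow> bool"
  where "non_zero_divisor R a \<longleftrightarrow> a \<in> carrier R \<and>
    (\<forall>x\<in>carrier R. (a \<otimes>\<^bsub>R\<^esub> x = \<zero>\<^bsub>R\<^esub> \<longrightarrow> x = \<zero>\<^bsub>R\<^esub>) \<and> (x \<otimes>\<^bsub>R\<^esub> a = \<zero>\<^bsub>R\<^esub> \<longrightarrow> x = \<zero>\<^bsub>R\<^esub>))"

text \<open>The fraction \<open>x / h\<close>; meaningful if \<open>h\<close> is a nonzero divisor dividing \<open>x\<close>.\<close>

definition fraction :: "('a, 's) ring_scheme \<Rightarrow> 'a \<Rightarrow> 'a \<Rightarrow> 'a"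
  where "fraction R h x = (THE y. y \<in> carrier R \<and> x = h \<otimes>\<^bsub>R\<^esub> y)"


section \<open>Ore extensions\<close>

definition algebra_aut :: "('k::comm_ring_1 \<Rightarrow> 'a) \<Rightarrow> ('a, 's) ring_scheme \<Rightarrow> ('a \<Rightarrow> 'a) set"
  where "algebra_aut \<kappa> A = {f \<in> ring_iso A A. \<forall>c. f (\<kappa> c) = \<kappa> c}"

definition skew_derivation ::
    "('k::comm_ring_1 \<Rightarrow> 'a) \<Rightarrow> ('a, 's) ring_scheme \<Rightarrow> ('a \<Rightarrow> 'a) \<Rightarrow> ('a \<Rightarrow> 'a) \<Rightarrow> bool"
  where "skew_derivation \<kappa> A \<tau> \<delta> \<longleftrightarrow>
    \<delta> \<in> carrier A \<rightarrow> carrier A \<and>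
    (\<forall>a\<in>carrier A. \<forall>b\<in>carrier A. \<delta> (a \<oplus>\<^bsub>A\<^esub> b) = \<delta> a \<oplus>\<^bsub>A\<^esub> \<delta> b) \<and>
    (\<forall>c. \<forall>a\<in>carrier A. \<delta> (\<kappa> c \<otimes>\<^bsub>A\<^esub> a) = \<kappa> c \<otimes>\<^bsub>A\<^esub> \<delta> a) \<and>
    (\<forall>a\<in>carrier A. \<forall>b\<in>carrier A. \<delta> (a \<otimes>\<^bsub>A\<^esub> b) = \<delta> a \<otimes>\<^bsub>A\<^esub> b \<oplus>\<^bsub>A\<^esub> \<tau> a \<otimes>\<^bsub>A\<^esub> \<delta> b)"

definition q_skew_extension ::
    "('k::comm_ring_1 \<Rightarrow> 'a) \<Rightarrow> ('a, 's) ring_scheme \<Rightarrow> 'a \<Rightarrow> ('a \<Rightarrow> 'a) \<Rightarrow> ('a \<Rightarrow> 'a) \<Rightarrow> bool"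
  where "q_skew_extension \<kappa> A q \<tau> \<delta> \<longleftrightarrow>
    non_zero_divisor A q \<and> \<tau> \<in> algebra_aut \<kappa> A \<and> skew_derivation \<kappa> A \<tau> \<delta> \<and>
    \<tau> q = q \<and> \<delta> q = \<zero>\<^bsub>A\<^esub> \<and> (\<forall>a\<in>carrier A. \<tau> (\<delta> a) = q \<otimes>\<^bsub>A\<^esub> \<delta> (\<tau> a))"

text \<open>Elements of \<open>A[t;\<tau>,\<delta>]\<close> are the left polynomials \<open>\<Sum>\<^sub>n r\<^sub>n t\<^sup>n\<close>, represented
  by the coefficient sequences of \<^const>\<open>UP\<close>. Only the multiplication of
  \<^term>\<open>UP A\<close> is replaced. It is the one forced by \<open>t a = \<tau>(a) t + \<delta>(a)\<close>: left
  multiplication by \<open>t\<close> sends \<open>\<Sum> r\<^sub>n t\<^sup>n\<close> to \<open>\<Sum> (\<tau>(r\<^sub>n) t\<^sup>n\<^sup>+\<^sup>1 + \<delta>(r\<^sub>n) t\<^sup>n)\<close>, and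
  \<open>(\<Sum> p\<^sub>i t\<^sup>i) r = \<Sum> p\<^sub>i (t\<^sup>i r)\<close>.\<close>

definition ore_shift :: "('a, 's) ring_scheme \<Rightarrow> ('a \<Rightarrow> 'a) \<Rightarrow> ('a \<Rightarrow> 'a) \<Rightarrow> (nat \<Rightarrow> 'a) \<Rightarrow> nat \<Rightarrow> 'a"
  where "ore_shift A \<tau> \<delta> r =
    (\<lambda>n. (case n of 0 \<Rightarrow> \<zero>\<^bsub>A\<^esub> | Suc j \<Rightarrow> \<tau> (r j)) \<oplus>\<^bsub>A\<^esub> \<delta> (r n))"

definition ore_ext :: "('a, 's) ring_scheme \<Rightarrow> ('a \<Rightarrow> 'a) \<Rightarrow> ('a \<Rightarrow> 'a) \<Rightarrow> ('a, nat \<Rightarrow> 'a) up_ring"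
  where "ore_ext A \<tau> \<delta> = (UP A)\<lparr>mult :=
    (\<lambda>p r n. \<Oplus>\<^bsub>A\<^esub>i\<in>{..deg A p}. p i \<otimes>\<^bsub>A\<^esub> ((ore_shift A \<tau> \<delta> ^^ i) r) n)\<rparr>"

text \<open>Constant polynomials and the variable; these serve \<open>A[t;\<tau>,\<delta>]\<close> as well as the
  commutative polynomial ring \<^term>\<open>UP A\<close>.\<close>

abbreviation pconst :: "('a, 's) ring_scheme \<Rightarrow> 'a \<Rightarrow> nat \<Rightarrow> 'a"
  where "pconst A a \<equiv> up_ring.monom (UP A) a 0"

abbreviation pvar :: "('a, 's) ring_scheme \<Rightarrow> nat \<Rightarrow> 'a"
  where "pvar A \<equiv> up_ring.monom (UP A) \<one>\<^bsub>A\<^esub> 1"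

lemma ore_ext_relation:
  assumes "ring A" "\<tau> \<in> carrier A \<rightarrow> carrier A" "\<delta> \<in> carrier A \<rightarrow> carrier A"
    and "\<tau> \<zero>\<^bsub>A\<^esub> = \<zero>\<^bsub>A\<^esub>" "\<delta> \<zero>\<^bsub>A\<^esub> = \<zero>\<^bsub>A\<^esub>" "a \<in> carrier A" "\<one>\<^bsub>A\<^esub> \<noteq> \<zero>\<^bsub>A\<^esub>"
  shows "pvar A \<otimes>\<^bsub>ore_ext A \<tau> \<delta>\<^esub> pconst A a =
    pconst A (\<tau> a) \<otimes>\<^bsub>ore_ext A \<tau> \<delta>\<^esub> pvar A \<oplus>\<^bsub>ore_ext A \<tau> \<delta>\<^esub> pconst A (\<delta> a)"
proof -
  interpret UP_ring A "UP A" using assms(1) by (simp add: UP_ring_def)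
  have [simp]: "\<tau> a \<in> carrier A" "\<delta> a \<in> carrier A"
    using assms by auto
  have m: "up_ring.monom (UP A) b n = (\<lambda>i. if i = n then b else \<zero>\<^bsub>A\<^esub>)" if "b \<in> carrier A" for b n
    using that by (simp add: UP_def)
  have sh: "ore_shift A \<tau> \<delta> (\<lambda>i. if i = 0 then a else \<zero>\<^bsub>A\<^esub>) =
      (\<lambda>n. if n = 0 then \<delta> a else if n = 1 then \<tau> a else \<zero>\<^bsub>A\<^esub>)"
    using assms by (auto simp: ore_shift_def fun_eq_iff split: nat.split)
  have "{..deg A (pvar A)} = {..Suc 0}" using assms(7) by simp
  moreover have "(\<Oplus>\<^bsub>A\<^esub>i\<in>{..Suc 0}. pvar A i \<otimes>\<^bsub>A\<^esub> ((ore_shift A \<tau> \<delta> ^^ i) (pconst A a)) n) =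
      (if n = 0 then \<delta> a else if n = 1 then \<tau> a else \<zero>\<^bsub>A\<^esub>)" for n
  proof -
    let ?G = "\<lambda>i. pvar A i \<otimes>\<^bsub>A\<^esub> ((ore_shift A \<tau> \<delta> ^^ i) (pconst A a)) n"
    have 0: "?G 0 = \<zero>\<^bsub>A\<^esub>" and 1: "?G (Suc 0) = (if n = 0 then \<delta> a else if n = 1 then \<tau> a else \<zero>\<^bsub>A\<^esub>)"
      using assms(6) by (auto simp: m sh)
    then have "?G \<in> {..Suc 0} \<rightarrow> carrier A" by (auto simp: le_Suc_eq)
    then have "finsum A ?G {..Suc 0} = ?G (Suc 0) \<oplus>\<^bsub>A\<^esub> finsum A ?G {..0}"
      by (rule R.finsum_Suc)
    also have "finsum A ?G {..0} = ?G 0"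
      by (rule R.finsum_0) (simp add: m assms(6))
    finally have "finsum A ?G {..Suc 0} = ?G (Suc 0) \<oplus>\<^bsub>A\<^esub> ?G 0" .
    then show ?thesis by (simp only: 0 1) auto
  qed
  ultimately have l: "pvar A \<otimes>\<^bsub>ore_ext A \<tau> \<delta>\<^esub> pconst A a =
      (\<lambda>n. if n = 0 then \<delta> a else if n = 1 then \<tau> a else \<zero>\<^bsub>A\<^esub>)"
    by (simp add: ore_ext_def fun_eq_iff)
  have "{..deg A (pconst A (\<tau> a))} = {..0}" by simp
  moreover have "(\<Oplus>\<^bsub>A\<^esub>i\<in>{..0}. pconst A (\<tau> a) i \<otimes>\<^bsub>A\<^esub> ((ore_shift A \<tau> \<delta> ^^ i) (pvar A)) n) =
      (if n = 1 then \<tau> a else \<zero>\<^bsub>A\<^esub>)" for n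
    by (subst R.finsum_0) (simp_all add: m)
  ultimately have p: "pconst A (\<tau> a) \<otimes>\<^bsub>ore_ext A \<tau> \<delta>\<^esub> pvar A = up_ring.monom (UP A) (\<tau> a) 1"
    by (simp add: ore_ext_def m fun_eq_iff del: atMost_0)
  have "up_ring.monom (UP A) (\<tau> a) 1 \<oplus>\<^bsub>ore_ext A \<tau> \<delta>\<^esub> pconst A (\<delta> a) =
      up_ring.monom (UP A) (\<tau> a) 1 \<oplus>\<^bsub>UP A\<^esub> pconst A (\<delta> a)"
    by (simp add: ore_ext_def)
  also have "\<dots> = (\<lambda>i. up_ring.monom (UP A) (\<tau> a) 1 i \<oplus>\<^bsub>A\<^esub> pconst A (\<delta> a) i)"
  proof -
    have "x \<oplus>\<^bsub>UP A\<^esub> y = (\<lambda>i. x i \<oplus>\<^bsub>A\<^esub> y i)" if "x \<in> up A" "y \<in> up A" for x y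
      using that by (simp only: UP_def ring.simps restrict_apply if_True)
    moreover have "up_ring.monom (UP A) b n \<in> up A" if "b \<in> carrier A" for b n
      using monom_closed[OF that, of n] by (simp only: UP_def partial_object.simps)
    ultimately show ?thesis by (metis \<open>\<tau> a \<in> carrier A\<close> \<open>\<delta> a \<in> carrier A\<close>)
  qed
  also have "\<dots> = (\<lambda>n. if n = 0 then \<delta> a else if n = 1 then \<tau> a else \<zero>\<^bsub>A\<^esub>)"
    by (simp add: m fun_eq_iff)
  finally show ?thesis by (simp only: l p)
qed


section \<open>Specialization\<close>

text \<open>\<open>q - \<epsilon>\<close> as an element of the algebra with structure map \<open>\<eta>\<close>.\<close>

definition q_minus :: "('k::comm_ring_1 laurent \<Rightarrow> 'a) \<Rightarrow> 'k \<Rightarrow> 'a"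
  where "q_minus \<eta> \<epsilon> = \<eta> (laurent_q - laurent_const \<epsilon>)"

definition spec_ring :: "('k::comm_ring_1 laurent \<Rightarrow> 'a) \<Rightarrow> ('a, 's) ring_scheme \<Rightarrow> 'k \<Rightarrow> 'a set ring"
  where "spec_ring \<eta> R \<epsilon> = R Quot (Idl\<^bsub>R\<^esub> {q_minus \<eta> \<epsilon>})"

definition spec_proj :: "('k::comm_ring_1 laurent \<Rightarrow> 'a) \<Rightarrow> ('a, 's) ring_scheme \<Rightarrow> 'k \<Rightarrow> 'a \<Rightarrow> 'a set"
  where "spec_proj \<eta> R \<epsilon> a = (Idl\<^bsub>R\<^esub> {q_minus \<eta> \<epsilon>}) +>\<^bsub>R\<^esub> a"

text \<open>The map induced on \<open>R\<^sub>\<epsilon>\<close> by a map \<open>f\<close> that preserves the ideal \<open>(q - \<epsilon>)\<close>.\<close>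

definition spec_map ::
    "('k::comm_ring_1 laurent \<Rightarrow> 'a) \<Rightarrow> ('a, 's) ring_scheme \<Rightarrow> 'k \<Rightarrow> ('a \<Rightarrow> 'a) \<Rightarrow> 'a set \<Rightarrow> 'a set"
  where "spec_map \<eta> R \<epsilon> f x = the_elem ((\<lambda>a. spec_proj \<eta> R \<epsilon> (f a)) ` x)"

text \<open>\<open>A\<^sub>\<epsilon>[t;\<tau>,\<delta>]\<close>, and the projection onto it from \<open>A[t;\<tau>,\<delta>]\<close>.\<close>

definition spec_ore ::
    "('k::comm_ring_1 laurent \<Rightarrow> 'a) \<Rightarrow> ('a, 's) ring_scheme \<Rightarrow> ('a \<Rightarrow> 'a) \<Rightarrow> ('a \<Rightarrow> 'a) \<Rightarrow> 'k
      \<Rightarrow> ('a set, nat \<Rightarrow> 'a set) up_ring"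
  where "spec_ore \<eta> A \<tau> \<delta> \<epsilon> =
    ore_ext (spec_ring \<eta> A \<epsilon>) (spec_map \<eta> A \<epsilon> \<tau>) (spec_map \<eta> A \<epsilon> \<delta>)"

definition ore_proj ::
    "('k::comm_ring_1 laurent \<Rightarrow> 'a) \<Rightarrow> ('a, 's) ring_scheme \<Rightarrow> 'k \<Rightarrow> (nat \<Rightarrow> 'a) \<Rightarrow> nat \<Rightarrow> 'a set"
  where "ore_proj \<eta> A \<epsilon> p = (\<lambda>n. spec_proj \<eta> A \<epsilon> (p n))"


section \<open>Poisson algebras\<close>

definition poisson_algebra ::
    "('k::comm_ring_1 \<Rightarrow> 'a) \<Rightarrow> ('a, 's) ring_scheme \<Rightarrow> ('a \<Rightarrow> 'a \<Rightarrow> 'a) \<Rightarrow> bool"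
  where "poisson_algebra \<kappa> B br \<longleftrightarrow>
    algebra_over \<kappa> B \<and> cring B \<and>
    (\<forall>x\<in>carrier B. \<forall>y\<in>carrier B. br x y \<in> carrier B) \<and>
    (\<forall>x\<in>carrier B. \<forall>y\<in>carrier B. \<forall>z\<in>carrier B.
      br (x \<oplus>\<^bsub>B\<^esub> y) z = br x z \<oplus>\<^bsub>B\<^esub> br y z \<and> br x (y \<oplus>\<^bsub>B\<^esub> z) = br x y \<oplus>\<^bsub>B\<^esub> br x z) \<and>
    (\<forall>c. \<forall>x\<in>carrier B. \<forall>y\<in>carrier B.
      br (\<kappa> c \<otimes>\<^bsub>B\<^esub> x) y = \<kappa> c \<otimes>\<^bsub>B\<^esub> br x y \<and> br x (\<kappa> c \<otimes>\<^bsub>B\<^esub> y) = \<kappa> c \<otimes>\<^bsub>B\<^esub> br x y) \<and>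
    (\<forall>x\<in>carrier B. br x x = \<zero>\<^bsub>B\<^esub>) \<and>
    (\<forall>x\<in>carrier B. \<forall>y\<in>carrier B. \<forall>z\<in>carrier B.
      br x (br y z) \<oplus>\<^bsub>B\<^esub> br y (br z x) \<oplus>\<^bsub>B\<^esub> br z (br x y) = \<zero>\<^bsub>B\<^esub>) \<and>
    (\<forall>x\<in>carrier B. \<forall>y\<in>carrier B. \<forall>z\<in>carrier B.
      br x (y \<otimes>\<^bsub>B\<^esub> z) = br x y \<otimes>\<^bsub>B\<^esub> z \<oplus>\<^bsub>B\<^esub> y \<otimes>\<^bsub>B\<^esub> br x z)"

definition poisson_derivation ::
    "('k::comm_ring_1 \<Rightarrow> 'a) \<Rightarrow> ('a, 's) ring_scheme \<Rightarrow> ('a \<Rightarrow> 'a \<Rightarrow> 'a) \<Rightarrow> ('a \<Rightarrow> 'a) \<Rightarrow> bool"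
  where "poisson_derivation \<kappa> B br \<alpha> \<longleftrightarrow>
    skew_derivation \<kappa> B (\<lambda>x. x) \<alpha> \<and>
    (\<forall>a\<in>carrier B. \<forall>b\<in>carrier B. \<alpha> (br a b) = br (\<alpha> a) b \<oplus>\<^bsub>B\<^esub> br a (\<alpha> b))"

text \<open>The sign is the one that the Jacobi identity for \<open>z, a, b\<close> forces when
  \<open>{z,a} = \<alpha>(a) z + \<beta>(a)\<close>. The opposite sign, also found in the literature, belongs to
  the convention \<open>{a,z} = \<alpha>(a) z + \<beta>(a)\<close>.\<close>

definition alpha_derivation ::
    "('k::comm_ring_1 \<Rightarrow> 'a) \<Rightarrow> ('a, 's) ring_scheme \<Rightarrow> ('a \<Rightarrow> 'a \<Rightarrow> 'a) \<Rightarrow> ('a \<Rightarrow> 'a) \<Rightarrow> ('a \<Rightarrow> 'a) \<Rightarrow> bool"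
  where "alpha_derivation \<kappa> B br \<alpha> \<beta> \<longleftrightarrow>
    skew_derivation \<kappa> B (\<lambda>x. x) \<beta> \<and>
    (\<forall>a\<in>carrier B. \<forall>b\<in>carrier B.
      \<beta> (br a b) \<ominus>\<^bsub>B\<^esub> br (\<beta> a) b \<ominus>\<^bsub>B\<^esub> br a (\<beta> b) = \<alpha> a \<otimes>\<^bsub>B\<^esub> \<beta> b \<ominus>\<^bsub>B\<^esub> \<beta> a \<otimes>\<^bsub>B\<^esub> \<alpha> b)"

text \<open>\<open>P\<close> is the bracket of \<open>B[z;\<alpha>,\<beta>]\<^sub>P\<close> on the polynomial ring \<^term>\<open>UP B\<close>.\<close>

definition poisson_ore_extension ::
    "('k::comm_ring_1 \<Rightarrow> 'a) \<Rightarrow> ('a, 's) ring_scheme \<Rightarrow> ('a \<Rightarrow> 'a \<Rightarrow> 'a) \<Rightarrow> ('a \<Rightarrow> 'a) \<Rightarrow> ('a \<Rightarrow> 'a)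
      \<Rightarrow> ((nat \<Rightarrow> 'a) \<Rightarrow> (nat \<Rightarrow> 'a) \<Rightarrow> nat \<Rightarrow> 'a) \<Rightarrow> bool"
  where "poisson_ore_extension \<kappa> B br \<alpha> \<beta> P \<longleftrightarrow>
    poisson_algebra \<kappa> B br \<and> poisson_derivation \<kappa> B br \<alpha> \<and> alpha_derivation \<kappa> B br \<alpha> \<beta> \<and>
    poisson_algebra (\<lambda>c. pconst B (\<kappa> c)) (UP B) P \<and>
    (\<forall>a\<in>carrier B. \<forall>b\<in>carrier B. P (pconst B a) (pconst B b) = pconst B (br a b)) \<and>
    (\<forall>a\<in>carrier B. P (pvar B) (pconst B a) =
      pconst B (\<alpha> a) \<otimes>\<^bsub>UP B\<^esub> pvar B \<oplus>\<^bsub>UP B\<^esub> pconst B (\<beta> a))"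

text \<open>The bracket \<open>{\<sigma>(r),\<sigma>(s)} = \<sigma>((r s - s r) / h)\<close>, for \<open>\<sigma>\<close> defined on \<open>R\<close>. The value
  does not depend on the lifts \<open>r\<close>, \<open>s\<close> if \<open>\<sigma>\<close> is a surjective homomorphism with kernel
  generated by the central nonzero divisor \<open>h\<close> and the arguments are central in the image.\<close>

definition induced_bracket ::
    "('a, 's) ring_scheme \<Rightarrow> 'a \<Rightarrow> ('a \<Rightarrow> 'b) \<Rightarrow> 'b \<Rightarrow> 'b \<Rightarrow> 'b"
  where "induced_bracket R h \<sigma> x y =
    (THE c. \<forall>r\<in>carrier R. \<forall>s\<in>carrier R. \<sigma> r = x \<and> \<sigma> s = y \<longrightarrow>
      c = \<sigma> (fraction R h (r \<otimes>\<^bsub>R\<^esub> s \<ominus>\<^bsub>R\<^esub> s \<otimes>\<^bsub>R\<^esub> r)))"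

definition central_poisson_subalgebra ::
    "('k::comm_ring_1 \<Rightarrow> 'a) \<Rightarrow> ('a, 's) ring_scheme \<Rightarrow> ('a \<Rightarrow> 'a \<Rightarrow> 'a) \<Rightarrow> 'a set \<Rightarrow> bool"
  where "central_poisson_subalgebra \<kappa> R br C \<longleftrightarrow>
    central_subalgebra \<kappa> R C \<and> (\<forall>x\<in>C. \<forall>y\<in>C. br x y \<in> C)"

text \<open>The order of \<open>f\<close> restricted to \<open>B\<close> is the least \<open>m\<close> with this property. Leastness is not
  part of the definition: if \<open>B\<close> lies in a central subalgebra of \<open>A\<^sub>\<epsilon>[t;\<tau>,\<delta>]\<close>, then
  \<open>t b = b t\<close> already shows that \<open>\<tau>\<close> fixes \<open>B\<close> pointwise, so that leastness would force
  \<open>m = 1\<close> and exclude algebras such as \<open>B[t\<^sup>m]\<close> with \<open>m\<close> the order of \<open>\<tau>\<close> on \<open>A\<^sub>\<epsilon>\<close>.\<close>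

definition period_on :: "('a \<Rightarrow> 'a) \<Rightarrow> 'a set \<Rightarrow> nat \<Rightarrow> bool"
  where "period_on f B m \<longleftrightarrow> 0 < m \<and> (\<forall>b\<in>B. (f ^^ m) b = b)"

end

theory Submission
  imports Defs
begin

text \<open>Let \<open>T\<close> be left multiplication by \<open>t\<close> on left polynomials. Then \<open>T (a r) = \<tau>(a) T r + \<delta>(a) r\<close>,
so left multiplication by \<open>p\<close> is \<open>\<Sum> p\<^sub>i T\<^sup>i\<close> and \<open>A[t;\<tau>,\<delta>]\<close> acts on itself by composition of
operators; this is associativity. The ideal \<open>(q - \<epsilon>)\<close> is stable under \<open>\<tau>\<close> and \<open>\<delta>\<close>, and reduction
modulo \<open>(q - \<epsilon>)\<close> is coefficientwise.

For (2), write \<open>h = q - \<epsilon>\<close>. The commutator of \<open>t\<^sup>m\<close> with a lift \<open>a\<close> of \<open>b\<close> has coefficient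
\<open>\<tau>\<^sup>m(a) - a\<close> at \<open>t\<^sup>m\<close> and \<open>\<delta>\<^sup>m(a)\<close> at \<open>1\<close>. No \<open>q\<close>-binomial formula is needed for the
coefficients in between: after division by \<open>h\<close> and reduction the commutator is \<open>{z, b}\<close>, which lies in
\<open>C = B[t\<^sup>m]\<close>, so they vanish. That \<open>\<alpha>\<close> is a Poisson derivation and \<open>\<beta>\<close> an \<open>\<alpha>\<close>-derivation is then
read off from the Leibniz rule and the Jacobi identity in \<open>C\<close>.\<close>

section \<open>Ore extensions\<close>

text \<open>Centrality of \<open>C\<close> shapes part (2). The elements of \<open>B\<close> then
  commute with \<open>t\<close>, so over \<open>A_\<epsilon>\<close> the map \<tau> fixes
  \<open>B\<close> and \<delta> kills it. Hence \<open>C\<close> is an ordinary polynomial ring in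
  \<open>t^m\<close> over \<open>B\<close>, whatever the twist of the surrounding ring, and
  membership in \<open>C\<close> becomes a condition on coefficients: they lie in \<open>B\<close>
  and vanish at exponents not divisible by \<open>m\<close>. The twist survives only in the lifts:
  \<tau>^m(a) - a and \<delta>^m(a) are multiples of \<open>h\<close> that need not be 0, and their
  quotients by \<open>h\<close> carry \<alpha> and \<beta>.

  A second obstacle is that \<open>A_\<epsilon>[t]\<close> is not literally a quotient of
  \<open>A[t]\<close>. Reduction is therefore axiomatized as a surjection whose kernel consists of
  the multiples of a central element. Both \<open>A \<rightarrow> A_\<epsilon>\<close> and the
  coefficientwise map on Ore extensions are instances, so the theory of the induced bracket is
  developed once and applied twice, to \<open>B\<close> and to \<open>C\<close>.\<close>

lemma (in abelian_monoid) additive_finsum: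
  assumes "f \<in> carrier G \<rightarrow> carrier G"
    and "\<And>x y. \<lbrakk>x \<in> carrier G; y \<in> carrier G\<rbrakk> \<Longrightarrow> f (x \<oplus> y) = f x \<oplus> f y"
    and "g \<in> UNIV \<rightarrow> carrier G"
  shows "f (\<Oplus>i\<in>{..N::nat}. g i) = (\<Oplus>i\<in>{..N}. f (g i))"
proof (induction N)
  case 0
  \<comment> \<open>The range starts with one summand, so \<open>f \<zero>\<close> never has to be
    evaluated; in a monoid additivity does not determine it.\<close>
  have "g 0 \<in> carrier G" "f (g 0) \<in> carrier G" using assms by auto
  then show ?case by simp
next
  case (Suc N)
  have 1: "(\<lambda>i. f (g i)) \<in> {..Suc N} \<rightarrow> carrier G" and 2: "g \<in> {..Suc N} \<rightarrow> carrier G"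
    and 3: "g \<in> {..N} \<rightarrow> carrier G" and 4: "g (Suc N) \<in> carrier G"
    using assms by auto
  show ?case
    using Suc by (simp only: finsum_Suc[OF 1] finsum_Suc[OF 2] assms(2)[OF 4 finsum_closed[OF 3]])
qed

lemma (in abelian_monoid) finsum_atMost_extend:
  assumes "N \<le> M" "g \<in> UNIV \<rightarrow> carrier G" "\<And>i. N < i \<Longrightarrow> g i = \<zero>"
  shows "(\<Oplus>i\<in>{..M::nat}. g i) = (\<Oplus>i\<in>{..N}. g i)"
  by (rule add.finprod_mono_neutral_cong) (use assms in auto)

lemma (in abelian_monoid) finsum_atMost_single:
  assumes "g \<in> UNIV \<rightarrow> carrier G" "k \<le> N" "\<And>i. i \<noteq> k \<Longrightarrow> g i = \<zero>"
  shows "(\<Oplus>i\<in>{..N::nat}. g i) = g k"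
proof -
  have gk: "g k \<in> carrier G" using assms(1) by auto
  have "(\<Oplus>i\<in>{..N}. g i) = (\<Oplus>i\<in>{k}. g i)"
    by (rule add.finprod_mono_neutral_cong) (use assms in auto)
  then show ?thesis using gk by simp
qed

lemma (in abelian_monoid) finsum_atMost_swap:
  assumes "\<And>i j. g i j \<in> carrier G"
  shows "(\<Oplus>i\<in>{..N::nat}. \<Oplus>j\<in>{..M::nat}. g i j) = (\<Oplus>j\<in>{..M}. \<Oplus>i\<in>{..N}. g i j)"
proof (induction N)
  case 0
  show ?case using assms by (simp add: Pi_def)
next
  case (Suc N)
  have "(\<Oplus>i\<in>{..Suc N}. \<Oplus>j\<in>{..M}. g i j)
      = (\<Oplus>j\<in>{..M}. g (Suc N) j) \<oplus> (\<Oplus>j\<in>{..M}. \<Oplus>i\<in>{..N}. g i j)"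
    using Suc assms by (simp add: Pi_def)
  also have "\<dots> = (\<Oplus>j\<in>{..M}. g (Suc N) j \<oplus> (\<Oplus>i\<in>{..N}. g i j))"
    by (subst finsum_addf) (use assms in \<open>auto simp: Pi_def\<close>)
  also have "\<dots> = (\<Oplus>j\<in>{..M}. \<Oplus>i\<in>{..Suc N}. g i j)"
    using assms by (simp add: Pi_def)
  finally show ?case .
qed

section \<open>Polynomials as coefficient sequences\<close>

lemma carrier_UP [simp]: "carrier (UP R) = up R"
  by (simp add: UP_def)

context ring
begin

lemma UP_monom_eq: "c \<in> carrier R \<Longrightarrow> up_ring.monom (UP R) c k = (\<lambda>i. if i = k then c else \<zero>)"
  by (simp add: UP_def)

lemma UP_monom_closed: "c \<in> carrier R \<Longrightarrow> up_ring.monom (UP R) c k \<in> up R"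
  by (auto simp: UP_monom_eq intro!: exI[of _ k])

lemma up_zero_closed: "(\<lambda>i. \<zero>) \<in> up R"
  by (auto intro!: exI[of _ 0])

lemma UP_add_eq: "\<lbrakk>p \<in> up R; r \<in> up R\<rbrakk> \<Longrightarrow> p \<oplus>\<^bsub>UP R\<^esub> r = (\<lambda>i. p i \<oplus> r i)"
  by (simp add: UP_def)

lemma UP_is_ring: "ring (UP R)"
  by (rule UP_ring.UP_ring[OF UP_ring.intro]) (rule ring_axioms)

lemma UP_minus_eq:
  assumes "p \<in> up R" "r \<in> up R"
  shows "p \<ominus>\<^bsub>UP R\<^esub> r = (\<lambda>i. p i \<ominus> r i)"
proof -
  interpret P: ring "UP R" by (rule UP_is_ring)
  have u: "(\<lambda>i. \<ominus> r i) \<in> up R" using up_a_inv_closed[OF assms(2)] .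
  have z: "\<zero>\<^bsub>UP R\<^esub> = (\<lambda>i. \<zero>)" by (simp add: UP_def)
  have "\<ominus>\<^bsub>UP R\<^esub> r = (\<lambda>i. \<ominus> r i)"
    by (rule P.minus_equality) (use assms u in \<open>auto simp: UP_add_eq z l_neg mem_upD\<close>)
  then show ?thesis
    using assms u by (simp add: a_minus_def UP_add_eq)
qed

lemma up_induct [consumes 1, case_names monom add]:
  assumes "p \<in> up R"
    and monom: "\<And>c k. c \<in> carrier R \<Longrightarrow> Q (up_ring.monom (UP R) c k)"
    and add: "\<And>r s. \<lbrakk>r \<in> up R; s \<in> up R; Q r; Q s\<rbrakk> \<Longrightarrow> Q (\<lambda>i. r i \<oplus> s i)"
  shows "Q p"
proof -
  obtain n where "bound \<zero> n p" using assms(1) by auto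
  with assms(1) show ?thesis
  proof (induction n arbitrary: p)
    case 0
    then have "p = up_ring.monom (UP R) (p 0) 0"
      by (auto simp: UP_monom_eq mem_upD fun_eq_iff)
    then show ?case using monom[of "p 0" 0] 0(1) by (simp add: mem_upD)
  next
    case (Suc n)
    let ?r = "\<lambda>i. if i = Suc n then \<zero> else p i"
    have b: "bound \<zero> n ?r" using Suc.prems(2) by (auto simp: bound_def)
    have r: "?r \<in> up R" using b Suc.prems(1) by (intro mem_upI exI[of _ n]) auto
    let ?s = "up_ring.monom (UP R) (p (Suc n)) (Suc n)"
    have s: "?s \<in> up R" using Suc.prems(1) by (simp add: UP_monom_closed mem_upD)
    have "p = (\<lambda>i. ?r i \<oplus> ?s i)"
      using Suc.prems(1) by (auto simp: UP_monom_eq mem_upD)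
    then show ?case
      using add[OF r s Suc.IH[OF r b] monom] Suc.prems(1) by (simp add: mem_upD)
  qed
qed

end

text \<open>The assumptions are those that pass to the reduction by lifting elements: an
  endomorphism \<tau> and an additive twisted derivation \<delta>. Thus one operator calculus serves
  both \<open>A\<close> and \<open>A_\<epsilon>\<close>; bijectivity of \<tau> and linearity over
  the scalars are treated separately.\<close>

locale skew_ring = ring A for A (structure) +
  fixes \<tau> \<delta> :: "'a \<Rightarrow> 'a"
  assumes tau_hom: "\<tau> \<in> ring_hom A A"
    and delta_closed [simp, intro]: "a \<in> carrier A \<Longrightarrow> \<delta> a \<in> carrier A"
    and delta_add: "\<lbrakk>a \<in> carrier A; b \<in> carrier A\<rbrakk> \<Longrightarrow> \<delta> (a \<oplus> b) = \<delta> a \<oplus> \<delta> b"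
    and delta_mult: "\<lbrakk>a \<in> carrier A; b \<in> carrier A\<rbrakk> \<Longrightarrow> \<delta> (a \<otimes> b) = \<delta> a \<otimes> b \<oplus> \<tau> a \<otimes> \<delta> b"
begin

abbreviation T :: "(nat \<Rightarrow> 'a) \<Rightarrow> nat \<Rightarrow> 'a" where "T \<equiv> ore_shift A \<tau> \<delta>"

abbreviation E :: "('a, nat \<Rightarrow> 'a) up_ring" where "E \<equiv> ore_ext A \<tau> \<delta>"

lemma tau_closed [simp, intro]: "a \<in> carrier A \<Longrightarrow> \<tau> a \<in> carrier A"
  using tau_hom by (rule ring_hom_closed)

lemma tau_add: "\<lbrakk>a \<in> carrier A; b \<in> carrier A\<rbrakk> \<Longrightarrow> \<tau> (a \<oplus> b) = \<tau> a \<oplus> \<tau> b"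
  using tau_hom by (rule ring_hom_add)

lemma tau_mult: "\<lbrakk>a \<in> carrier A; b \<in> carrier A\<rbrakk> \<Longrightarrow> \<tau> (a \<otimes> b) = \<tau> a \<otimes> \<tau> b"
  using tau_hom by (rule ring_hom_mult)

lemma tau_one [simp]: "\<tau> \<one> = \<one>"
  using tau_hom by (rule ring_hom_one)

lemma tau_zero [simp]: "\<tau> \<zero> = \<zero>"
  using ring_hom_zero[OF tau_hom] ring_axioms by simp

lemma delta_zero [simp]: "\<delta> \<zero> = \<zero>"
proof -
  have "\<delta> \<zero> \<oplus> \<delta> \<zero> = \<delta> \<zero>" using delta_add[of \<zero> \<zero>] by simp
  then show ?thesis by (metis add.r_cancel_one' delta_closed zero_closed)
qed

lemma delta_one [simp]: "\<delta> \<one> = \<zero>"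
proof -
  have "\<delta> \<one> \<oplus> \<delta> \<one> = \<delta> \<one>" using delta_mult[of \<one> \<one>] by simp
  then show ?thesis by (metis add.r_cancel_one' delta_closed one_closed)
qed

lemma T_0: "r 0 \<in> carrier A \<Longrightarrow> T r 0 = \<delta> (r 0)"
  by (simp add: ore_shift_def)

lemma T_Suc: "T r (Suc j) = \<tau> (r j) \<oplus> \<delta> (r (Suc j))"
  by (simp add: ore_shift_def)

lemma T_closed: "r \<in> UNIV \<rightarrow> carrier A \<Longrightarrow> T r \<in> UNIV \<rightarrow> carrier A"
  by (auto simp: ore_shift_def Pi_iff split: nat.split)

lemma T_pow_closed: "r \<in> UNIV \<rightarrow> carrier A \<Longrightarrow> (T ^^ i) r \<in> UNIV \<rightarrow> carrier A"
  by (induction i) (simp_all add: T_closed)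

lemma T_pow_coeff_closed: "r \<in> UNIV \<rightarrow> carrier A \<Longrightarrow> (T ^^ i) r n \<in> carrier A"
  using T_pow_closed by blast

lemma T_bound: "bound \<zero> n r \<Longrightarrow> bound \<zero> (Suc n) (T r)"
  by (auto simp: bound_def ore_shift_def split: nat.split)

lemma T_pow_bound: "bound \<zero> n r \<Longrightarrow> bound \<zero> (n + i) ((T ^^ i) r)"
  by (induction i) (simp_all add: T_bound)

lemma up_funcset: "r \<in> up A \<Longrightarrow> r \<in> UNIV \<rightarrow> carrier A"
  by (simp add: up_def)

lemma T_pow_up: "r \<in> up A \<Longrightarrow> (T ^^ i) r \<in> up A"
  using T_pow_closed[of r i] T_pow_bound[of _ r i] by (auto simp: up_def)

lemma T_add:
  assumes "r \<in> UNIV \<rightarrow> carrier A" "s \<in> UNIV \<rightarrow> carrier A"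
  shows "T (\<lambda>n. r n \<oplus> s n) = (\<lambda>n. T r n \<oplus> T s n)"
proof
  fix n
  have [simp]: "r i \<in> carrier A" "s i \<in> carrier A" for i using assms by auto
  show "T (\<lambda>n. r n \<oplus> s n) n = T r n \<oplus> T s n"
    by (cases n) (simp_all add: T_0 T_Suc delta_add tau_add a_ac)
qed

lemma T_pow_add:
  assumes "r \<in> UNIV \<rightarrow> carrier A" "s \<in> UNIV \<rightarrow> carrier A"
  shows "(T ^^ i) (\<lambda>n. r n \<oplus> s n) = (\<lambda>n. (T ^^ i) r n \<oplus> (T ^^ i) s n)"
  by (induction i) (simp_all add: T_add T_pow_closed assms)

text \<open>A constant fixed by \<tau> and killed by \<delta> commutes with \<open>t\<close>, so
  \<open>T\<close> only shifts its exponent. The constants of interest are 1, the scalars and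
  \<open>h\<close>.\<close>

lemma T_pow_const_seq:
  assumes "c \<in> carrier A" "\<tau> c = c" "\<delta> c = \<zero>"
  shows "(T ^^ i) (up_ring.monom (UP A) c k) = up_ring.monom (UP A) c (k + i)"
proof (induction i)
  case (Suc i)
  have "T (up_ring.monom (UP A) c n) = up_ring.monom (UP A) c (Suc n)" for n
    using assms by (auto simp: ore_shift_def UP_monom_eq fun_eq_iff split: nat.split)
  with Suc show ?case by simp
qed simp

text \<open>The product \<open>p r\<close> with the sum cut at an arbitrary \<open>N\<close> in
  place of the degree of \<open>p\<close>. The free cut-off lets several factors share one range and
  avoids computing the degree of a product.\<close>

definition L :: "nat \<Rightarrow> (nat \<Rightarrow> 'a) \<Rightarrow> (nat \<Rightarrow> 'a) \<Rightarrow> nat \<Rightarrow> 'a"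
  where "L N p r n = (\<Oplus>i\<in>{..N}. p i \<otimes> (T ^^ i) r n)"

lemma L_closed: "\<lbrakk>p \<in> UNIV \<rightarrow> carrier A; r \<in> UNIV \<rightarrow> carrier A\<rbrakk> \<Longrightarrow> L N p r n \<in> carrier A"
  unfolding L_def using T_pow_coeff_closed[of r]
  by (intro finsum_closed Pi_I m_closed) (auto simp: Pi_iff)

lemma L_extend:
  assumes "p \<in> UNIV \<rightarrow> carrier A" "r \<in> UNIV \<rightarrow> carrier A" "bound \<zero> N p" "N \<le> M"
  shows "L M p r = L N p r"
  unfolding L_def using assms
  by (intro ext finsum_atMost_extend) (auto simp: T_pow_coeff_closed bound.bound Pi_iff)

text \<open>Collecting terms by the index of \<open>s\<close> recovers the coefficients
  \<tau>(p_(i-1)) + \<delta>(p_i) of \<open>T p\<close>. The boundary term makes the identity exact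
  for every \<open>N\<close>; it vanishes as soon as \<open>N\<close> bounds
  \<open>p\<close>.\<close>

lemma L_T_aux:
  assumes "p \<in> UNIV \<rightarrow> carrier A" "\<And>i. s i \<in> carrier A"
  shows "(\<Oplus>i\<in>{..N}. \<delta> (p i) \<otimes> s i \<oplus> \<tau> (p i) \<otimes> s (Suc i)) \<oplus> \<delta> (p (Suc N)) \<otimes> s (Suc N)
    = (\<Oplus>i\<in>{..Suc N}. T p i \<otimes> s i)"
proof -
  have [simp]: "p i \<in> carrier A" "s i \<in> carrier A" "T p i \<in> carrier A" for i
    using assms T_closed[OF assms(1)] by (auto simp del: T_closed)
  show ?thesis
  proof (induction N)
    case 0
    show ?case by (simp add: Pi_def T_0 T_Suc l_distr a_ac)
  next
    case (Suc N)
    have "(\<Oplus>i\<in>{..Suc (Suc N)}. T p i \<otimes> s i)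
      = T p (Suc (Suc N)) \<otimes> s (Suc (Suc N)) \<oplus> (\<Oplus>i\<in>{..Suc N}. T p i \<otimes> s i)"
      by (rule finsum_Suc) auto
    then show ?case
      unfolding Suc[symmetric] by (simp add: Pi_def T_Suc l_distr a_ac)
  qed
qed

text \<open>This is \<open>t (p r) = (t p) r\<close>, the instance of associativity from which the
  general one follows by iteration. Coefficientwise it is the twisted Leibniz rule applied to
  \<open>p i\<close> times a coefficient of \<open>T^i r\<close>.\<close>

lemma T_L:
  assumes p: "p \<in> UNIV \<rightarrow> carrier A" and r: "r \<in> UNIV \<rightarrow> carrier A" and b: "bound \<zero> N p"
  shows "T (L N p r) = L (Suc N) (T p) r"
proof
  fix n
  have [simp]: "p i \<in> carrier A" "(T ^^ i) r n \<in> carrier A" for i n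
    using p r by (auto simp: T_pow_coeff_closed)
  have [simp]: "T ((T ^^ i) r) n \<in> carrier A" for i n
    using T_pow_coeff_closed[OF r, of "Suc i"] by simp
  have p0: "p (Suc N) = \<zero>" using b by auto
  have d: "\<delta> (L N p r n) = (\<Oplus>i\<in>{..N}. \<delta> (p i \<otimes> (T ^^ i) r n))" for n
    unfolding L_def by (rule additive_finsum) (auto simp: delta_add)
  have t: "\<tau> (L N p r n) = (\<Oplus>i\<in>{..N}. \<tau> (p i \<otimes> (T ^^ i) r n))" for n
    unfolding L_def by (rule additive_finsum) (auto simp: tau_add)
  have "T (L N p r) n = (\<Oplus>i\<in>{..N}. \<delta> (p i) \<otimes> (T ^^ i) r n \<oplus> \<tau> (p i) \<otimes> (T ^^ Suc i) r n)"
  proof (cases n)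
    case 0
    have "T (L N p r) 0 = \<delta> (L N p r 0)" using p r by (simp add: T_0 L_closed)
    then show ?thesis
      unfolding 0 d by (simp add: delta_mult T_0 cong: finsum_cong)
  next
    case (Suc j)
    have "T (L N p r) n = (\<Oplus>i\<in>{..N}. \<tau> (p i \<otimes> (T ^^ i) r j) \<oplus> \<delta> (p i \<otimes> (T ^^ i) r n))"
      unfolding Suc T_Suc d t by (subst finsum_addf) auto
    also have "\<dots> = (\<Oplus>i\<in>{..N}. \<delta> (p i) \<otimes> (T ^^ i) r n \<oplus> \<tau> (p i) \<otimes> (T ^^ Suc i) r n)"
      by (intro finsum_cong') (auto simp: Suc T_Suc delta_mult tau_mult r_distr a_ac)
    finally show ?thesis .
  qed
  also have "\<dots> = L (Suc N) (T p) r n"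
    unfolding L_def by (subst L_T_aux[OF p, symmetric]) (simp_all add: p0 Pi_def)
  finally show "T (L N p r) n = L (Suc N) (T p) r n" .
qed

lemma T_pow_L:
  assumes p: "p \<in> UNIV \<rightarrow> carrier A" and r: "r \<in> UNIV \<rightarrow> carrier A" and b: "bound \<zero> N p"
  shows "(T ^^ i) (L N p r) = L (N + i) ((T ^^ i) p) r"
  by (induction i) (simp_all add: T_L T_pow_closed T_pow_bound p r b)

text \<open>By \<open>T_pow_L\<close>, applying \<open>T^i\<close> to the product of
  \<open>r\<close> and \<open>s\<close> gives the product of \<open>T^i r\<close> and
  \<open>s\<close>. For \<open>i \<le> N\<close> the sequence \<open>T^i r\<close> is bounded by
  \<open>M + N\<close>; with this common range the double sum is rectangular and can be
  interchanged.\<close>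

lemma L_assoc:
  assumes p: "p \<in> UNIV \<rightarrow> carrier A" and r: "r \<in> UNIV \<rightarrow> carrier A" and s: "s \<in> UNIV \<rightarrow> carrier A"
    and b: "bound \<zero> M r"
  shows "L N p (L M r s) = L (M + N) (L N p r) s"
proof
  fix n
  have [simp]: "p i \<in> carrier A" "(T ^^ i) r j \<in> carrier A" "(T ^^ i) s j \<in> carrier A" for i j
    using p r s by (auto simp: T_pow_coeff_closed)
  have "L N p (L M r s) n = (\<Oplus>i\<in>{..N}. p i \<otimes> L (M + N) ((T ^^ i) r) s n)"
    unfolding L_def[of N]
    by (intro finsum_cong')
      (use r s b in \<open>auto simp: T_pow_L L_closed T_pow_closed intro!: arg_cong[where f = "\<lambda>x. _ \<otimes> x"]
        L_extend[THEN fun_cong, symmetric] T_pow_bound\<close>)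
  also have "\<dots> = (\<Oplus>i\<in>{..N}. \<Oplus>j\<in>{..M+N}. p i \<otimes> (T ^^ i) r j \<otimes> (T ^^ j) s n)"
    unfolding L_def by (intro finsum_cong') (auto simp: finsum_rdistr m_assoc)
  also have "\<dots> = (\<Oplus>j\<in>{..M+N}. \<Oplus>i\<in>{..N}. p i \<otimes> (T ^^ i) r j \<otimes> (T ^^ j) s n)"
    by (rule finsum_atMost_swap) simp
  also have "\<dots> = L (M + N) (L N p r) s n"
    unfolding L_def by (intro finsum_cong') (auto simp: finsum_ldistr)
  finally show "L N p (L M r s) n = L (M + N) (L N p r) s n" .
qed

lemma L_bound:
  assumes p: "p \<in> UNIV \<rightarrow> carrier A" and b: "bound \<zero> M r"
  shows "bound \<zero> (M + N) (L N p r)"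
proof
  fix n assume n: "M + N < n"
  have "p i \<otimes> (T ^^ i) r n = \<zero>" if "i \<le> N" for i
  proof -
    have "(T ^^ i) r n = \<zero>" using that n by (intro bound.bound[OF T_pow_bound[OF b]]) simp
    moreover have "p i \<in> carrier A" using p by auto
    ultimately show ?thesis by simp
  qed
  then show "L N p r n = \<zero>" unfolding L_def by (simp cong: finsum_cong)
qed

lemma L_up: "\<lbrakk>p \<in> up A; r \<in> up A\<rbrakk> \<Longrightarrow> L N p r \<in> up A"
  using L_bound[of p _ r N] L_closed[of p r N] by (auto simp: up_def)

section \<open>The ring structure of the Ore extension\<close>

lemma ore_carrier [simp]: "carrier E = up A"
  by (simp add: ore_ext_def)

lemma ore_add_eq: "add E = add (UP A)" by (simp add: ore_ext_def)

lemma ore_add: "\<lbrakk>p \<in> up A; r \<in> up A\<rbrakk> \<Longrightarrow> p \<oplus>\<^bsub>E\<^esub> r = (\<lambda>i. p i \<oplus> r i)"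
  by (simp add: ore_add_eq UP_add_eq)

lemma ore_minus: "\<lbrakk>p \<in> up A; r \<in> up A\<rbrakk> \<Longrightarrow> p \<ominus>\<^bsub>E\<^esub> r = (\<lambda>i. p i \<ominus> r i)"
proof -
  have "a_minus E = a_minus (UP A)"
    by (intro ext) (simp add: a_minus_def a_inv_def m_inv_def ore_ext_def)
  then show "\<lbrakk>p \<in> up A; r \<in> up A\<rbrakk> \<Longrightarrow> ?thesis" by (simp add: UP_minus_eq)
qed

lemma ore_zero: "\<zero>\<^bsub>E\<^esub> = (\<lambda>i. \<zero>)"
  by (simp add: ore_ext_def UP_def)

lemma ore_one: "\<one>\<^bsub>E\<^esub> = up_ring.monom (UP A) \<one> 0"
  by (simp add: ore_ext_def UP_def)

text \<open>\<open>ore_ext\<close> sums up to the degree of \<open>p\<close>. Any bound for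
  \<open>p\<close> is at least the degree, and the additional terms vanish, so the degree disappears
  from all later computations.\<close>

lemma ore_mult:
  assumes "p \<in> up A" "r \<in> up A" "bound \<zero> N p"
  shows "p \<otimes>\<^bsub>E\<^esub> r = L N p r"
proof -
  have c: "up_ring.coeff (UP A) p n = p n" for n using assms(1) by (simp add: UP_def)
  interpret P: UP_ring A "UP A" by (simp add: UP_ring_def ring_axioms)
  have d: "bound \<zero> (deg A p) p"
  proof
    fix n assume "deg A p < n"
    with assms(1) have "up_ring.coeff (UP A) p n = \<zero>" by (intro P.deg_aboveD) simp_all
    then show "p n = \<zero>" by (simp only: c)
  qed
  have "deg A p \<le> N"
    using assms bound.bound[OF assms(3)] by (intro P.deg_aboveI) (simp_all only: c carrier_UP)
  then have "L N p r = L (deg A p) p r"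
    using assms d by (intro L_extend) (auto simp: up_funcset)
  then show ?thesis by (simp add: ore_ext_def L_def fun_eq_iff)
qed

lemma ore_mult_closed: "\<lbrakk>p \<in> up A; r \<in> up A\<rbrakk> \<Longrightarrow> p \<otimes>\<^bsub>E\<^esub> r \<in> up A"
  using bound_upD[of p] by (auto simp: ore_mult intro!: L_up)

lemma ore_monom_mult:
  assumes "c \<in> carrier A" "r \<in> up A"
  shows "up_ring.monom (UP A) c k \<otimes>\<^bsub>E\<^esub> r = (\<lambda>n. c \<otimes> (T ^^ k) r n)"
proof
  fix n
  have [simp]: "(T ^^ i) r n \<in> carrier A" for i
    using assms(2) by (auto simp: up_funcset T_pow_coeff_closed)
  have "up_ring.monom (UP A) c k \<otimes>\<^bsub>E\<^esub> r = L k (up_ring.monom (UP A) c k) r"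
    using assms by (intro ore_mult UP_monom_closed) (auto simp: UP_monom_eq)
  moreover have "L k (up_ring.monom (UP A) c k) r n = c \<otimes> (T ^^ k) r n"
    unfolding L_def using assms
    by (subst finsum_atMost_single[where k = k]) (auto simp: UP_monom_eq)
  ultimately show "(up_ring.monom (UP A) c k \<otimes>\<^bsub>E\<^esub> r) n = c \<otimes> (T ^^ k) r n" by simp
qed

lemma ore_pow_var_mult:
  assumes "r \<in> up A"
  shows "up_ring.monom (UP A) \<one> k \<otimes>\<^bsub>E\<^esub> r = (T ^^ k) r"
  using T_pow_up[OF assms, of k] by (simp add: ore_monom_mult assms mem_upD)

text \<open>Since \<open>t\<close> commutes with \<open>c\<close>, the factor \<open>c t^k\<close>
  can be moved past the powers of \<open>t\<close>: it multiplies each coefficient from the right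
  and shifts the exponents.\<close>

lemma ore_mult_monom:
  assumes "p \<in> up A" "c \<in> carrier A" "\<tau> c = c" "\<delta> c = \<zero>"
  shows "p \<otimes>\<^bsub>E\<^esub> up_ring.monom (UP A) c k = (\<lambda>n. if k \<le> n then p (n - k) \<otimes> c else \<zero>)"
proof
  fix n
  have [simp]: "p i \<in> carrier A" for i using assms(1) by auto
  obtain M where "bound \<zero> M p" using assms(1) by auto
  \<comment> \<open>The range has to contain the index \<open>n - k\<close>, which may exceed the
    bound for \<open>p\<close>.\<close>
  then have b: "bound \<zero> (max M n) p" by (auto simp: bound_def)
  have e: "(p \<otimes>\<^bsub>E\<^esub> up_ring.monom (UP A) c k) n
      = (\<Oplus>i\<in>{..max M n}. p i \<otimes> (if n = k + i then c else \<zero>))"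
    using assms(2)
    by (simp add: ore_mult[OF assms(1) UP_monom_closed b] L_def T_pow_const_seq assms(3,4))
      (simp add: UP_monom_eq)
  show "(p \<otimes>\<^bsub>E\<^esub> up_ring.monom (UP A) c k) n = (if k \<le> n then p (n - k) \<otimes> c else \<zero>)"
  proof (cases "k \<le> n")
    case True
    then show ?thesis unfolding e using assms(2)
      by (subst finsum_atMost_single[where k = "n - k"]) auto
  next
    case False
    then show ?thesis unfolding e using assms(2) by simp
  qed
qed

lemma ore_l_distr:
  assumes "p \<in> up A" "r \<in> up A" "s \<in> up A"
  shows "(p \<oplus>\<^bsub>E\<^esub> r) \<otimes>\<^bsub>E\<^esub> s = p \<otimes>\<^bsub>E\<^esub> s \<oplus>\<^bsub>E\<^esub> r \<otimes>\<^bsub>E\<^esub> s"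
proof -
  have [simp]: "p i \<in> carrier A" "r i \<in> carrier A" "(T ^^ i) s n \<in> carrier A" for i n
    using assms by (auto simp: up_funcset T_pow_coeff_closed)
  obtain N M where "bound \<zero> N p" "bound \<zero> M r" using assms by blast
  then have b: "bound \<zero> (max N M) p" "bound \<zero> (max N M) r" by (auto simp: bound_def)
  then have "bound \<zero> (max N M) (\<lambda>i. p i \<oplus> r i)" by (auto simp: bound_def)
  then have "(p \<oplus>\<^bsub>E\<^esub> r) \<otimes>\<^bsub>E\<^esub> s = L (max N M) (\<lambda>i. p i \<oplus> r i) s"
    using assms by (simp add: ore_add ore_mult up_add_closed)
  also have "\<dots> = (\<lambda>n. L (max N M) p s n \<oplus> L (max N M) r s n)"
    unfolding L_def by (auto simp: l_distr Pi_def finsum_addf intro!: ext)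
  also have "\<dots> = p \<otimes>\<^bsub>E\<^esub> s \<oplus>\<^bsub>E\<^esub> r \<otimes>\<^bsub>E\<^esub> s"
    using assms b by (simp add: ore_mult[where N = "max N M"] ore_add L_up)
  finally show ?thesis .
qed

lemma ore_r_distr:
  assumes "p \<in> up A" "r \<in> up A" "s \<in> up A"
  shows "p \<otimes>\<^bsub>E\<^esub> (r \<oplus>\<^bsub>E\<^esub> s) = p \<otimes>\<^bsub>E\<^esub> r \<oplus>\<^bsub>E\<^esub> p \<otimes>\<^bsub>E\<^esub> s"
proof -
  have [simp]: "p i \<in> carrier A" "(T ^^ i) r n \<in> carrier A" "(T ^^ i) s n \<in> carrier A" for i n
    using assms by (auto simp: up_funcset T_pow_coeff_closed)
  obtain N where b: "bound \<zero> N p" using assms by blast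
  have "p \<otimes>\<^bsub>E\<^esub> (r \<oplus>\<^bsub>E\<^esub> s) = L N p (\<lambda>i. r i \<oplus> s i)"
    using assms b by (simp add: ore_add ore_mult up_add_closed)
  also have "\<dots> = (\<lambda>n. L N p r n \<oplus> L N p s n)"
    unfolding L_def T_pow_add[OF up_funcset[OF assms(2)] up_funcset[OF assms(3)]]
    by (auto simp: r_distr Pi_def finsum_addf intro!: ext)
  also have "\<dots> = p \<otimes>\<^bsub>E\<^esub> r \<oplus>\<^bsub>E\<^esub> p \<otimes>\<^bsub>E\<^esub> s"
    using assms b by (simp add: ore_mult[where N = N] ore_add L_up)
  finally show ?thesis .
qed

lemma ore_assoc:
  assumes "p \<in> up A" "r \<in> up A" "s \<in> up A"
  shows "(p \<otimes>\<^bsub>E\<^esub> r) \<otimes>\<^bsub>E\<^esub> s = p \<otimes>\<^bsub>E\<^esub> (r \<otimes>\<^bsub>E\<^esub> s)"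
proof -
  obtain N M where b: "bound \<zero> N p" "bound \<zero> M r" using assms by blast
  show ?thesis
    using assms b L_bound[of p M r N]
    by (simp add: ore_mult[where N = N] ore_mult[where N = M] ore_mult[where N = "M + N"]
        L_up L_assoc up_funcset)
qed

theorem ore_ring: "ring E"
proof (rule ringI)
  show "abelian_group E"
  proof (rule abelian_groupI)
    fix x assume "x \<in> carrier E"
    then show "\<exists>y\<in>carrier E. y \<oplus>\<^bsub>E\<^esub> x = \<zero>\<^bsub>E\<^esub>"
      by (intro bexI[of _ "\<lambda>i. \<ominus> x i"])
        (auto simp: ore_add up_a_inv_closed ore_zero l_neg mem_upD)
  qed (auto simp: ore_add up_add_closed ore_zero up_zero_closed a_ac mem_upD intro!: ext)
  show "Group.monoid E"
  proof (rule monoidI)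
    fix x assume "x \<in> carrier E"
    then show "\<one>\<^bsub>E\<^esub> \<otimes>\<^bsub>E\<^esub> x = x" "x \<otimes>\<^bsub>E\<^esub> \<one>\<^bsub>E\<^esub> = x"
      by (auto simp: ore_one ore_pow_var_mult ore_mult_monom mem_upD)
  qed (auto simp: ore_mult_closed ore_assoc ore_one UP_monom_closed)
qed (auto simp: ore_l_distr ore_r_distr)

lemma ore_var_pow: "pvar A [^]\<^bsub>E\<^esub> (m::nat) = up_ring.monom (UP A) \<one> m"
proof -
  interpret E: ring E by (rule ore_ring)
  show ?thesis
    by (induction m)
      (simp_all add: ore_one ore_pow_var_mult UP_monom_closed T_pow_const_seq)
qed

end

section \<open>Quotients by a central element\<close>

lemma ring_center_closed: "c \<in> ring_center R \<Longrightarrow> c \<in> carrier R"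
  by (simp add: ring_center_def)

lemma ring_center_commute: "\<lbrakk>c \<in> ring_center R; x \<in> carrier R\<rbrakk> \<Longrightarrow> c \<otimes>\<^bsub>R\<^esub> x = x \<otimes>\<^bsub>R\<^esub> c"
  by (simp add: ring_center_def)

text \<open>For central \<open>h\<close> the multiples of \<open>h\<close> absorb factors from both
  sides, so the generated ideal contains nothing else. Membership becomes divisibility, which in an
  Ore extension can be tested coefficient by coefficient.\<close>

lemma (in ring) Idl_center:
  assumes h: "h \<in> ring_center R"
  shows "Idl {h} = {x \<in> carrier R. h divides x}"
proof
  have hc [simp]: "h \<in> carrier R" using h by (rule ring_center_closed)
  have hx: "h \<otimes> x = x \<otimes> h" if "x \<in> carrier R" for x using ring_center_commute[OF h that] .
  have "ideal {x \<in> carrier R. h divides x} R"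
  proof (rule idealI)
    show "subgroup {x \<in> carrier R. h divides x} (add_monoid R)"
    proof (rule add.subgroupI)
      show "{x \<in> carrier R. h divides x} \<noteq> {}"
        by (auto simp: factor_def intro!: exI[of _ \<zero>] bexI[of _ \<zero>])
      show "\<ominus> a \<in> {x \<in> carrier R. h divides x}" if "a \<in> {x \<in> carrier R. h divides x}" for a
        using that by (auto simp: factor_def r_minus[symmetric])
      show "a \<oplus> b \<in> {x \<in> carrier R. h divides x}"
        if "a \<in> {x \<in> carrier R. h divides x}" "b \<in> {x \<in> carrier R. h divides x}" for a b
        using that by (auto simp: factor_def r_distr[symmetric])
    qed auto
  next
    fix a x assume "a \<in> {x \<in> carrier R. h divides x}" and x: "x \<in> carrier R"
    then obtain y where y: "y \<in> carrier R" "a = h \<otimes> y" by (auto simp: factor_def)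
    have "x \<otimes> a = h \<otimes> (x \<otimes> y)" using x y(1) by (metis hc hx m_assoc y(2))
    then show "x \<otimes> a \<in> {x \<in> carrier R. h divides x}"
      using x y unfolding factor_def by (auto intro!: bexI[of _ "x \<otimes> y"])
    have "a \<otimes> x = h \<otimes> (y \<otimes> x)" using x y by (simp add: m_assoc)
    then show "a \<otimes> x \<in> {x \<in> carrier R. h divides x}"
      using x y unfolding factor_def by (auto intro!: bexI[of _ "y \<otimes> x"])
  qed (rule ring_axioms)
  moreover have "h \<in> {x \<in> carrier R. h divides x}"
    by (auto simp: factor_def intro!: bexI[of _ \<one>])
  ultimately show "Idl {h} \<subseteq> {x \<in> carrier R. h divides x}"
    by (intro genideal_minimal) auto
  interpret I: ideal "Idl {h}" R by (rule genideal_ideal) simp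
  show "{x \<in> carrier R. h divides x} \<subseteq> Idl {h}"
    using genideal_self'[of h] I.I_r_closed by (auto simp: factor_def)
qed

text \<open>Reduction is described by surjectivity and kernel, not as a map to cosets. The
  coefficientwise map onto \<open>A_\<epsilon>[t]\<close> fits this description although its target
  is not built from cosets in \<open>A[t]\<close>.\<close>

locale quotient_map = R: ring R + S: ring S for R (structure) and S (structure) +
  fixes h :: 'a and \<sigma> :: "'a \<Rightarrow> 'c"
  assumes hom: "\<sigma> \<in> ring_hom R S"
    and surj: "\<sigma> ` carrier R = carrier S"
    and h_center: "h \<in> ring_center R"
    and ker: "x \<in> carrier R \<Longrightarrow> \<sigma> x = \<zero>\<^bsub>S\<^esub> \<longleftrightarrow> h divides\<^bsub>R\<^esub> x"
begin

sublocale H: ring_hom_ring R S \<sigma>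
  by (rule ring_hom_ringI2) (use R.ring_axioms S.ring_axioms hom in auto)

lemma h_closed [simp]: "h \<in> carrier R"
  using h_center by (rule ring_center_closed)

lemma h_commute: "x \<in> carrier R \<Longrightarrow> h \<otimes> x = x \<otimes> h"
  using h_center by (rule ring_center_commute)

lemma sigma_minus: "\<lbrakk>x \<in> carrier R; y \<in> carrier R\<rbrakk> \<Longrightarrow> \<sigma> (x \<ominus> y) = \<sigma> x \<ominus>\<^bsub>S\<^esub> \<sigma> y"
  by (simp add: a_minus_def)

lemma sigma_eq_iff:
  assumes "x \<in> carrier R" "y \<in> carrier R"
  shows "\<sigma> x = \<sigma> y \<longleftrightarrow> h divides\<^bsub>R\<^esub> (x \<ominus> y)"
  using assms ker[of "x \<ominus> y"] by (simp add: sigma_minus)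

lemma sigma_h [simp]: "\<sigma> h = \<zero>\<^bsub>S\<^esub>"
proof -
  have "h divides\<^bsub>R\<^esub> h" unfolding factor_def by (rule bexI[of _ \<one>]) simp_all
  then show ?thesis by (simp add: ker)
qed

lemma lift:
  assumes "y \<in> carrier S"
  obtains x where "x \<in> carrier R" "\<sigma> x = y"
  using assms surj by (metis imageE)

lemma a_kernel_eq: "a_kernel R S \<sigma> = Idl\<^bsub>R\<^esub> {h}"
  unfolding a_kernel_def' R.Idl_center[OF h_center] using ker by blast

lemma coset_eq: "Idl\<^bsub>R\<^esub> {h} +>\<^bsub>R\<^esub> x = {y \<in> carrier R. \<sigma> y = \<sigma> x}" if x: "x \<in> carrier R"
proof (rule Set.set_eqI)
  fix y
  have "y \<in> Idl {h} +> x \<longleftrightarrow> (\<exists>i\<in>carrier R. h divides\<^bsub>R\<^esub> i \<and> y = i \<oplus> x)"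
    unfolding a_r_coset_def' R.Idl_center[OF h_center] by blast
  also have "\<dots> \<longleftrightarrow> y \<in> carrier R \<and> \<sigma> y = \<sigma> x"
  proof
    assume "\<exists>i\<in>carrier R. h divides\<^bsub>R\<^esub> i \<and> y = i \<oplus> x"
    then show "y \<in> carrier R \<and> \<sigma> y = \<sigma> x" using x ker by auto
  next
    assume y: "y \<in> carrier R \<and> \<sigma> y = \<sigma> x"
    then show "\<exists>i\<in>carrier R. h divides\<^bsub>R\<^esub> i \<and> y = i \<oplus> x"
      using x sigma_eq_iff[of y x]
      by (intro bexI[of _ "y \<ominus> x"]) (auto simp: R.minus_eq R.a_assoc R.l_neg)
  qed
  finally show "y \<in> Idl {h} +> x \<longleftrightarrow> y \<in> {y \<in> carrier R. \<sigma> y = \<sigma> x}" by simp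
qed

text \<open>The first isomorphism theorem with explicit values: a coset is a fibre of \<sigma>, so
  its image is a single point.\<close>

lemma quotient_iso:
  "\<exists>\<phi>. \<phi> \<in> ring_iso (R Quot (Idl\<^bsub>R\<^esub> {h})) S \<and>
    (\<forall>x\<in>carrier R. \<phi> (Idl\<^bsub>R\<^esub> {h} +>\<^bsub>R\<^esub> x) = \<sigma> x)"
proof (intro exI conjI ballI)
  show "(\<lambda>Y. the_elem (\<sigma> ` Y)) \<in> ring_iso (R Quot (Idl {h})) S"
    using H.FactRing_iso_set[OF surj] by (simp only: a_kernel_eq)
  fix x assume "x \<in> carrier R"
  then have "\<sigma> ` (Idl {h} +> x) = {\<sigma> x}" by (auto simp: coset_eq)
  then show "the_elem (\<sigma> ` (Idl {h} +> x)) = \<sigma> x" by simp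
qed

end

lemma (in ring) quotient_map_proj:
  assumes "h \<in> ring_center R"
  shows "quotient_map R (R Quot (Idl {h})) h ((+>) (Idl {h}))"
proof -
  have [simp]: "h \<in> carrier R" using assms by (rule ring_center_closed)
  interpret I: ideal "Idl {h}" R by (rule genideal_ideal) simp
  interpret Q: ring "R Quot (Idl {h})" by (rule I.quotient_is_ring)
  show ?thesis
  proof
    show "(+>) (Idl {h}) \<in> ring_hom R (R Quot Idl {h})" by (rule I.rcos_ring_hom)
    show "(+>) (Idl {h}) ` carrier R = carrier (R Quot Idl {h})"
      by (auto simp: FactRing_def A_RCOSETS_def')
    fix x assume x: "x \<in> carrier R"
    have "Idl {h} +> x = Idl {h} \<longleftrightarrow> x \<in> Idl {h}"
      using I.a_rcos_const[of x] I.a_rcos_self[OF x] by auto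
    also have "\<dots> \<longleftrightarrow> h divides x" unfolding Idl_center[OF assms] using x by blast
    finally show "Idl {h} +> x = \<zero>\<^bsub>R Quot Idl {h}\<^esub> \<longleftrightarrow> h divides x"
      by (simp add: FactRing_def)
  qed (rule assms)
qed

section \<open>Reduction of an Ore extension modulo a central constant\<close>

locale skew_quotient = quotient_map R S h \<sigma> + R: skew_ring R \<tau> \<delta> + S: skew_ring S \<tau>' \<delta>'
  for R (structure) and S (structure) and h \<sigma> \<tau> \<delta> \<tau>' \<delta>' +
  assumes sigma_tau: "x \<in> carrier R \<Longrightarrow> \<sigma> (\<tau> x) = \<tau>' (\<sigma> x)"
    and sigma_delta: "x \<in> carrier R \<Longrightarrow> \<sigma> (\<delta> x) = \<delta>' (\<sigma> x)"
    and tau_h: "\<tau> h = h"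
    and delta_h: "\<delta> h = \<zero>"

text \<open>Centrality in \<open>A\<close> gives commutation with the coefficients;
  \<open>\<tau> c = c\<close> and \<open>\<delta> c = \<zero>\<close> give commutation with
  \<open>t\<close>.\<close>

lemma (in skew_ring) pconst_center:
  assumes c: "c \<in> ring_center A" and "\<tau> c = c" "\<delta> c = \<zero>"
  shows "pconst A c \<in> ring_center E"
proof -
  have cc: "c \<in> carrier A" using c by (rule ring_center_closed)
  have "pconst A c \<otimes>\<^bsub>E\<^esub> p = p \<otimes>\<^bsub>E\<^esub> pconst A c" if "p \<in> up A" for p
    using that assms(2,3) cc ring_center_commute[OF c] by (simp add: ore_monom_mult ore_mult_monom mem_upD)
  then show ?thesis by (simp add: ring_center_def UP_monom_closed cc)
qed

lemma (in skew_ring) pconst_hom: "pconst A \<in> ring_hom A E"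
proof (rule ring_hom_memI)
  fix a b assume [simp]: "a \<in> carrier A" "b \<in> carrier A"
  show "pconst A a \<in> carrier E" by (simp add: UP_monom_closed)
  show "pconst A (a \<otimes> b) = pconst A a \<otimes>\<^bsub>E\<^esub> pconst A b"
    by (simp add: ore_monom_mult UP_monom_closed) (auto simp: UP_monom_eq)
  show "pconst A (a \<oplus> b) = pconst A a \<oplus>\<^bsub>E\<^esub> pconst A b"
    by (simp add: ore_add UP_monom_closed) (auto simp: UP_monom_eq)
qed (simp add: ore_one)

lemma (in skew_ring) pconst_divides_iff:
  assumes c: "c \<in> carrier A" and p: "p \<in> up A"
  shows "pconst A c divides\<^bsub>E\<^esub> p \<longleftrightarrow> (\<forall>n. c divides p n)"
proof
  assume "pconst A c divides\<^bsub>E\<^esub> p"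
  then show "\<forall>n. c divides p n"
    using c by (auto simp: factor_def ore_monom_mult)
next
  assume "\<forall>n. c divides p n"
  then have "\<forall>n. \<exists>y. y \<in> carrier A \<and> p n = c \<otimes> y" by (auto simp: factor_def)
  then obtain y where y: "\<And>n. y n \<in> carrier A" "\<And>n. p n = c \<otimes> y n" by metis
  obtain N where N: "bound \<zero> N p" using p by auto
  \<comment> \<open>A chosen quotient of 0 by \<open>c\<close> may be nonzero, so the values beyond
    the bound are reset to 0 to obtain a polynomial.\<close>
  let ?y = "\<lambda>n. if N < n then \<zero> else y n"
  have u: "?y \<in> up A" by (intro mem_upI exI[of _ N]) (auto simp: y(1))
  have "p = pconst A c \<otimes>\<^bsub>E\<^esub> ?y"
    unfolding ore_monom_mult[OF c u] using c N by (auto simp: y fun_eq_iff dest: bound.bound)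
  then show "pconst A c divides\<^bsub>E\<^esub> p" using u unfolding factor_def by auto
qed

context skew_quotient
begin

lemma sigma_T: "r \<in> UNIV \<rightarrow> carrier R \<Longrightarrow> (\<lambda>n. \<sigma> (R.T r n)) = S.T (\<lambda>n. \<sigma> (r n))"
  by (auto simp: ore_shift_def fun_eq_iff sigma_tau sigma_delta Pi_iff split: nat.split)

lemma sigma_T_pow:
  assumes "r \<in> UNIV \<rightarrow> carrier R"
  shows "\<sigma> ((R.T ^^ i) r n) = (S.T ^^ i) (\<lambda>n. \<sigma> (r n)) n"
proof -
  have "(\<lambda>n. \<sigma> ((R.T ^^ i) r n)) = (S.T ^^ i) (\<lambda>n. \<sigma> (r n))"
    by (induction i) (simp_all add: sigma_T R.T_pow_closed assms)
  then show ?thesis by (simp add: fun_eq_iff)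
qed

lemma sigma_up: "p \<in> up R \<Longrightarrow> (\<lambda>n. \<sigma> (p n)) \<in> up S"
proof -
  assume p: "p \<in> up R"
  then obtain N where "bound \<zero> N p" by auto
  with p show "(\<lambda>n. \<sigma> (p n)) \<in> up S"
    by (intro mem_upI exI[of _ N]) (auto simp: bound_def mem_upD)
qed

text \<open>Reduction commutes with \<open>T\<close>, hence with multiplication, and the kernel is
  found coefficientwise by \<open>pconst_divides_iff\<close>. Combined with the isomorphism theorem
  this yields the specialization statement in part (1).\<close>

lemma ore_quotient: "quotient_map R.E S.E (pconst R h) (\<lambda>p n. \<sigma> (p n))"
proof -
  interpret RE: ring R.E by (rule R.ore_ring)
  interpret SE: ring S.E by (rule S.ore_ring)
  show ?thesis
  proof
    show "(\<lambda>p n. \<sigma> (p n)) \<in> ring_hom R.E S.E"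
    proof (rule ring_hom_memI)
      fix p r assume p: "p \<in> carrier R.E" and r: "r \<in> carrier R.E"
      then have pr: "p n \<in> carrier R" "(R.T ^^ i) r n \<in> carrier R" "r n \<in> carrier R" for i n
        by (auto simp: R.up_funcset R.T_pow_coeff_closed)
      show "(\<lambda>n. \<sigma> (p n)) \<in> carrier S.E" using p by (simp add: sigma_up)
      show "(\<lambda>n. \<sigma> ((p \<oplus>\<^bsub>R.E\<^esub> r) n)) = (\<lambda>n. \<sigma> (p n)) \<oplus>\<^bsub>S.E\<^esub> (\<lambda>n. \<sigma> (r n))"
        using p r by (simp add: R.ore_add S.ore_add sigma_up pr)
      obtain N where N: "bound \<zero> N p" using p by auto
      then have N': "bound \<zero>\<^bsub>S\<^esub> N (\<lambda>n. \<sigma> (p n))" by (auto simp: bound_def)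
      have "\<sigma> (R.L N p r n) = S.L N (\<lambda>n. \<sigma> (p n)) (\<lambda>n. \<sigma> (r n)) n" for n
        unfolding R.L_def S.L_def using r S.T_pow_coeff_closed[OF S.up_funcset[OF sigma_up]]
        by (subst H.hom_finsum) (auto simp: pr sigma_T_pow R.up_funcset Pi_iff intro!: S.finsum_cong')
      then show "(\<lambda>n. \<sigma> ((p \<otimes>\<^bsub>R.E\<^esub> r) n)) = (\<lambda>n. \<sigma> (p n)) \<otimes>\<^bsub>S.E\<^esub> (\<lambda>n. \<sigma> (r n))"
        using p r by (simp add: R.ore_mult[OF _ _ N] S.ore_mult[OF _ _ N'] sigma_up)
    qed (auto simp: R.ore_one S.ore_one R.UP_monom_eq S.UP_monom_eq)
    show "(\<lambda>p n. \<sigma> (p n)) ` carrier R.E = carrier S.E"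
    proof
      show "(\<lambda>p n. \<sigma> (p n)) ` carrier R.E \<subseteq> carrier S.E" by (auto simp: sigma_up)
      show "carrier S.E \<subseteq> (\<lambda>p n. \<sigma> (p n)) ` carrier R.E"
      proof
        fix r assume r: "r \<in> carrier S.E"
        then have "\<forall>n. \<exists>x. x \<in> carrier R \<and> \<sigma> x = r n" using lift by (metis S.ore_carrier mem_upD)
        then obtain x where x: "\<And>n. x n \<in> carrier R" "\<And>n. \<sigma> (x n) = r n" by metis
        obtain N where N: "bound \<zero>\<^bsub>S\<^esub> N r" using r by auto
        \<comment> \<open>The chosen lift of 0 may be nonzero, so the lifts beyond the bound are
          replaced by 0.\<close>
        let ?x = "\<lambda>n. if N < n then \<zero> else x n"
        have "?x \<in> up R" by (intro mem_upI exI[of _ N]) (auto simp: x(1))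
        moreover have "r = (\<lambda>n. \<sigma> (?x n))" using N by (auto simp: x fun_eq_iff dest: bound.bound)
        ultimately show "r \<in> (\<lambda>p n. \<sigma> (p n)) ` carrier R.E" by auto
      qed
    qed
    show "pconst R h \<in> ring_center R.E"
      using h_center tau_h delta_h by (rule R.pconst_center)
    fix p assume "p \<in> carrier R.E"
    then show "(\<lambda>n. \<sigma> (p n)) = \<zero>\<^bsub>S.E\<^esub> \<longleftrightarrow> pconst R h divides\<^bsub>R.E\<^esub> p"
      by (simp add: S.ore_zero fun_eq_iff ker mem_upD R.pconst_divides_iff)
  qed
qed

end

section \<open>The bracket induced on central elements\<close>

locale quantization = quotient_map +
  assumes h_nzd: "non_zero_divisor R h"
begin

lemma h_cancel:
  assumes "x \<in> carrier R" "y \<in> carrier R" "h \<otimes> x = h \<otimes> y"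
  shows "x = y"
proof -
  have "h \<otimes> (x \<ominus> y) = \<zero>"
    using assms by (simp add: R.minus_eq R.r_distr R.r_minus R.r_neg)
  then have "x \<ominus> y = \<zero>" using assms(1,2) h_nzd unfolding non_zero_divisor_def by blast
  then show ?thesis using assms(1,2) by simp
qed

lemma fraction_eq: "v \<in> carrier R \<Longrightarrow> fraction R h (h \<otimes> v) = v"
  unfolding fraction_def by (rule the_equality) (auto intro: h_cancel)

lemma commutator_divisible:
  assumes "r \<in> carrier R" "s \<in> carrier R" "\<sigma> r \<in> ring_center S"
  obtains v where "v \<in> carrier R" "r \<otimes> s \<ominus> s \<otimes> r = h \<otimes> v"
proof -
  have "\<sigma> (r \<otimes> s) = \<sigma> (s \<otimes> r)"
    using assms ring_center_commute[OF assms(3), of "\<sigma> s"] by simp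
  then have "h divides\<^bsub>R\<^esub> (r \<otimes> s \<ominus> s \<otimes> r)"
    using assms sigma_eq_iff[of "r \<otimes> s" "s \<otimes> r"] by simp
  then show ?thesis using that by (auto simp: factor_def)
qed

text \<open>Replacing \<open>r\<close> by \<open>r + h u\<close> changes the commutator by
  \<open>h (u s - s u)\<close>, and \<open>u s - s u\<close> reduces to 0 because
  \<open>\<sigma> s\<close> is central; the same holds for \<open>s\<close>. Hence all lifts give
  one value, and the bracket can be computed from any of them.\<close>

lemma bracket_eq:
  assumes r: "r \<in> carrier R" and s: "s \<in> carrier R" and v: "v \<in> carrier R"
    and x: "\<sigma> r \<in> ring_center S" and y: "\<sigma> s \<in> ring_center S"
    and e: "r \<otimes> s \<ominus> s \<otimes> r = h \<otimes> v"
  shows "induced_bracket R h \<sigma> (\<sigma> r) (\<sigma> s) = \<sigma> v"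
  unfolding induced_bracket_def
proof (rule the_equality)
  show "\<forall>r'\<in>carrier R. \<forall>s'\<in>carrier R. \<sigma> r' = \<sigma> r \<and> \<sigma> s' = \<sigma> s \<longrightarrow>
      \<sigma> v = \<sigma> (fraction R h (r' \<otimes> s' \<ominus> s' \<otimes> r'))"
  proof (intro ballI impI, elim conjE)
    fix r' s' assume r': "r' \<in> carrier R" "\<sigma> r' = \<sigma> r" and s': "s' \<in> carrier R" "\<sigma> s' = \<sigma> s"
    obtain u where u: "u \<in> carrier R" "r' \<ominus> r = h \<otimes> u"
      using r' r sigma_eq_iff[of r' r] by (auto simp: factor_def)
    obtain w where w: "w \<in> carrier R" "s' \<ominus> s = h \<otimes> w"
      using s' s sigma_eq_iff[of s' s] by (auto simp: factor_def)
    \<comment> \<open>The lifts are exchanged one at a time: \<open>s'\<close> against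
      \<open>s\<close> with \<open>r'\<close> kept, then \<open>r'\<close> against
      \<open>r\<close>.\<close>
    have "r' \<otimes> s' \<ominus> s' \<otimes> r' = (r' \<otimes> s \<ominus> s \<otimes> r') \<oplus> (r' \<otimes> (s' \<ominus> s) \<ominus> (s' \<ominus> s) \<otimes> r')"
      using r' s' s by algebra
    also have "r' \<otimes> s \<ominus> s \<otimes> r' = (r \<otimes> s \<ominus> s \<otimes> r) \<oplus> ((r' \<ominus> r) \<otimes> s \<ominus> s \<otimes> (r' \<ominus> r))"
      using r' r s by algebra
    also have "(r' \<ominus> r) \<otimes> s \<ominus> s \<otimes> (r' \<ominus> r) = h \<otimes> (u \<otimes> s \<ominus> s \<otimes> u)"
    proof -
      have "s \<otimes> (h \<otimes> u) = h \<otimes> (s \<otimes> u)"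
        using s u h_commute[OF s] by (simp add: R.m_assoc[symmetric])
      then show ?thesis using u s by (simp add: u(2) R.minus_eq R.r_distr R.r_minus R.m_assoc)
    qed
    also have "r' \<otimes> (s' \<ominus> s) \<ominus> (s' \<ominus> s) \<otimes> r' = h \<otimes> (r' \<otimes> w \<ominus> w \<otimes> r')"
    proof -
      have "r' \<otimes> (h \<otimes> w) = h \<otimes> (r' \<otimes> w)"
        using r' w h_commute[of r'] by (simp add: R.m_assoc[symmetric])
      then show ?thesis using w r' by (simp add: w(2) R.minus_eq R.r_distr R.r_minus R.m_assoc)
    qed
    finally have "r' \<otimes> s' \<ominus> s' \<otimes> r' = h \<otimes> (v \<oplus> (u \<otimes> s \<ominus> s \<otimes> u) \<oplus> (r' \<otimes> w \<ominus> w \<otimes> r'))"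
      using e u w r r' s v by (simp add: R.r_distr)
    then have "fraction R h (r' \<otimes> s' \<ominus> s' \<otimes> r') = v \<oplus> (u \<otimes> s \<ominus> s \<otimes> u) \<oplus> (r' \<otimes> w \<ominus> w \<otimes> r')"
      using u w r r' s v by (simp add: fraction_eq)
    moreover have "\<sigma> (u \<otimes> s \<ominus> s \<otimes> u) = \<zero>\<^bsub>S\<^esub>"
      using u s ring_center_commute[OF y, of "\<sigma> u"]
      by (simp add: sigma_minus S.minus_eq S.r_neg)
    moreover have "\<sigma> (r' \<otimes> w \<ominus> w \<otimes> r') = \<zero>\<^bsub>S\<^esub>"
      using r r' w ring_center_commute[OF x, of "\<sigma> w"]
      by (simp add: sigma_minus S.minus_eq S.r_neg)
    ultimately show "\<sigma> v = \<sigma> (fraction R h (r' \<otimes> s' \<ominus> s' \<otimes> r'))"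
      using u w r r' s v by simp
  qed
next
  fix c assume "\<forall>r'\<in>carrier R. \<forall>s'\<in>carrier R. \<sigma> r' = \<sigma> r \<and> \<sigma> s' = \<sigma> s \<longrightarrow>
      c = \<sigma> (fraction R h (r' \<otimes> s' \<ominus> s' \<otimes> r'))"
  then have "c = \<sigma> (fraction R h (h \<otimes> v))" using r s e by metis
  then show "c = \<sigma> v" using v by (simp add: fraction_eq)
qed

lemma bracket_lift:
  assumes "r \<in> carrier R" "s \<in> carrier R" "\<sigma> r \<in> ring_center S" "\<sigma> s \<in> ring_center S"
  obtains v where "v \<in> carrier R" "r \<otimes> s \<ominus> s \<otimes> r = h \<otimes> v"
    "induced_bracket R h \<sigma> (\<sigma> r) (\<sigma> s) = \<sigma> v"
  using assms by (metis commutator_divisible bracket_eq)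

text \<open>Each axiom comes from an identity for commutators in \<open>R\<close>, divided by
  \<open>h\<close> and reduced. The Jacobi identity is divided by \<open>h\<close> twice, and its
  inner bracket must be central again to be an admissible argument; closure of \<open>B\<close>
  under the bracket provides this.\<close>

theorem bracket_poisson:
  fixes \<iota> :: "'k::comm_ring_1 \<Rightarrow> 'a"
  assumes iota: "algebra_over \<iota> R"
    and B: "central_subalgebra (\<lambda>c. \<sigma> (\<iota> c)) S B"
    and br_closed: "\<And>x y. \<lbrakk>x \<in> B; y \<in> B\<rbrakk> \<Longrightarrow> induced_bracket R h \<sigma> x y \<in> B"
  shows "poisson_algebra (\<lambda>c. \<sigma> (\<iota> c)) (S\<lparr>carrier := B\<rparr>) (induced_bracket R h \<sigma>)"
proof -
  let ?br = "induced_bracket R h \<sigma>"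
  have sub: "subring B S" and kB: "\<sigma> (\<iota> c) \<in> B" and BZ: "x \<in> B \<Longrightarrow> x \<in> ring_center S" for c x
    using B by (auto simp: central_subalgebra_def)
  have BS: "x \<in> B \<Longrightarrow> x \<in> carrier S" for x using subringE(1)[OF sub] by auto
  have lft: "\<exists>r\<in>carrier R. \<sigma> r = x \<and> \<sigma> r \<in> ring_center S" if "x \<in> B" for x
    using lift[OF BS[OF that]] BZ[OF that] by metis
  have ring: "ring (S\<lparr>carrier := B\<rparr>)" by (rule S.subring_is_ring[OF sub])
  have comm: "x \<otimes>\<^bsub>S\<^esub> y = y \<otimes>\<^bsub>S\<^esub> x" if "x \<in> B" "y \<in> B" for x y
    using ring_center_commute[OF BZ BS] that by auto
  have cring: "cring (S\<lparr>carrier := B\<rparr>)"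
    by (intro cring.intro comm_monoid.intro comm_monoid_axioms.intro ring)
      (use ring in \<open>auto simp: comm ring_def\<close>)
  have ihom: "\<iota> \<in> ring_hom ring_of_type_algebra R" and icen: "\<iota> c \<in> ring_center R" for c
    using iota by (auto simp: algebra_over_def)
  have ic: "\<iota> c \<in> carrier R" for c using icen by (rule ring_center_closed)
  have "(\<lambda>c. \<sigma> (\<iota> c)) \<in> ring_hom ring_of_type_algebra (S\<lparr>carrier := B\<rparr>)"
    using ihom kB ic unfolding ring_hom_def by (auto simp: Pi_iff)
  then have alg: "algebra_over (\<lambda>c. \<sigma> (\<iota> c)) (S\<lparr>carrier := B\<rparr>)"
    unfolding algebra_over_def using ring by (auto simp: ring_center_def kB comm)
  have hx: "x \<otimes> (h \<otimes> y) = h \<otimes> (x \<otimes> y)" if "x \<in> carrier R" "y \<in> carrier R" for x y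
    using that h_commute[OF that(1)] by (simp add: R.m_assoc[symmetric])
  have addl: "?br (x \<oplus>\<^bsub>S\<^esub> y) z = ?br x z \<oplus>\<^bsub>S\<^esub> ?br y z"
    and addr: "?br z (x \<oplus>\<^bsub>S\<^esub> y) = ?br z x \<oplus>\<^bsub>S\<^esub> ?br z y"
    if xyz: "x \<in> B" "y \<in> B" "z \<in> B" for x y z
  proof -
    obtain r s u where r: "r \<in> carrier R" "\<sigma> r = x" "\<sigma> r \<in> ring_center S"
      and s: "s \<in> carrier R" "\<sigma> s = y" "\<sigma> s \<in> ring_center S"
      and u: "u \<in> carrier R" "\<sigma> u = z" "\<sigma> u \<in> ring_center S" using lft xyz by meson
    have rs: "\<sigma> (r \<oplus> s) = x \<oplus>\<^bsub>S\<^esub> y" using r s by simp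
    then have rsc: "\<sigma> (r \<oplus> s) \<in> ring_center S" using BZ subringE(7)[OF sub] xyz by simp
    obtain v where v: "v \<in> carrier R" "r \<otimes> u \<ominus> u \<otimes> r = h \<otimes> v" "?br x z = \<sigma> v"
      using bracket_lift[of r u] r u by metis
    obtain w where w: "w \<in> carrier R" "s \<otimes> u \<ominus> u \<otimes> s = h \<otimes> w" "?br y z = \<sigma> w"
      using bracket_lift[of s u] s u by metis
    have "(r \<oplus> s) \<otimes> u \<ominus> u \<otimes> (r \<oplus> s) = (r \<otimes> u \<ominus> u \<otimes> r) \<oplus> (s \<otimes> u \<ominus> u \<otimes> s)"
      using r s u by algebra
    also have "\<dots> = h \<otimes> (v \<oplus> w)" using v w by (simp add: R.r_distr)
    finally have "?br (\<sigma> (r \<oplus> s)) (\<sigma> u) = \<sigma> (v \<oplus> w)"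
      using r s u v w rsc by (intro bracket_eq) auto
    then show "?br (x \<oplus>\<^bsub>S\<^esub> y) z = ?br x z \<oplus>\<^bsub>S\<^esub> ?br y z" using rs u v w by simp
    obtain v where v: "v \<in> carrier R" "u \<otimes> r \<ominus> r \<otimes> u = h \<otimes> v" "?br z x = \<sigma> v"
      using bracket_lift[of u r] r u by metis
    obtain w where w: "w \<in> carrier R" "u \<otimes> s \<ominus> s \<otimes> u = h \<otimes> w" "?br z y = \<sigma> w"
      using bracket_lift[of u s] s u by metis
    have "u \<otimes> (r \<oplus> s) \<ominus> (r \<oplus> s) \<otimes> u = (u \<otimes> r \<ominus> r \<otimes> u) \<oplus> (u \<otimes> s \<ominus> s \<otimes> u)"
      using r s u by algebra
    also have "\<dots> = h \<otimes> (v \<oplus> w)" using v w by (simp add: R.r_distr)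
    finally have "?br (\<sigma> u) (\<sigma> (r \<oplus> s)) = \<sigma> (v \<oplus> w)"
      using r s u v w rsc by (intro bracket_eq) auto
    then show "?br z (x \<oplus>\<^bsub>S\<^esub> y) = ?br z x \<oplus>\<^bsub>S\<^esub> ?br z y" using rs u v w by simp
  qed
  have scal: "?br (\<sigma> (\<iota> c) \<otimes>\<^bsub>S\<^esub> x) y = \<sigma> (\<iota> c) \<otimes>\<^bsub>S\<^esub> ?br x y"
    and scar: "?br x (\<sigma> (\<iota> c) \<otimes>\<^bsub>S\<^esub> y) = \<sigma> (\<iota> c) \<otimes>\<^bsub>S\<^esub> ?br x y"
    if xy: "x \<in> B" "y \<in> B" for c x y
  proof -
    obtain r s where r: "r \<in> carrier R" "\<sigma> r = x" "\<sigma> r \<in> ring_center S"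
      and s: "s \<in> carrier R" "\<sigma> s = y" "\<sigma> s \<in> ring_center S" using lft xy by meson
    obtain v where v: "v \<in> carrier R" "r \<otimes> s \<ominus> s \<otimes> r = h \<otimes> v" "?br x y = \<sigma> v"
      using bracket_lift[of r s] r s by metis
    have c: "\<iota> c \<in> carrier R" by (rule ic)
    have cx: "z \<otimes> (\<iota> c \<otimes> w) = \<iota> c \<otimes> (z \<otimes> w)" if "z \<in> carrier R" "w \<in> carrier R" for z w
      using that c ring_center_commute[OF icen that(1)] by (simp add: R.m_assoc[symmetric])
    have cv: "\<iota> c \<otimes> (r \<otimes> s \<ominus> s \<otimes> r) = h \<otimes> (\<iota> c \<otimes> v)"
      unfolding v(2) using c v by (simp add: cx)
    have "(\<iota> c \<otimes> r) \<otimes> s \<ominus> s \<otimes> (\<iota> c \<otimes> r) = \<iota> c \<otimes> (r \<otimes> s \<ominus> s \<otimes> r)"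
      using r s c by (simp add: cx R.m_assoc R.minus_eq R.r_distr R.r_minus)
    also note cv
    finally have "?br (\<sigma> (\<iota> c \<otimes> r)) (\<sigma> s) = \<sigma> (\<iota> c \<otimes> v)"
      using r s v c kB subringE(6)[OF sub] BZ xy by (intro bracket_eq) auto
    then show "?br (\<sigma> (\<iota> c) \<otimes>\<^bsub>S\<^esub> x) y = \<sigma> (\<iota> c) \<otimes>\<^bsub>S\<^esub> ?br x y" using r s v c by simp
    have "r \<otimes> (\<iota> c \<otimes> s) \<ominus> (\<iota> c \<otimes> s) \<otimes> r = \<iota> c \<otimes> (r \<otimes> s \<ominus> s \<otimes> r)"
      using r s c by (simp add: cx R.m_assoc R.minus_eq R.r_distr R.r_minus)
    also note cv
    finally have "?br (\<sigma> r) (\<sigma> (\<iota> c \<otimes> s)) = \<sigma> (\<iota> c \<otimes> v)"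
      using r s v c kB subringE(6)[OF sub] BZ xy by (intro bracket_eq) auto
    then show "?br x (\<sigma> (\<iota> c) \<otimes>\<^bsub>S\<^esub> y) = \<sigma> (\<iota> c) \<otimes>\<^bsub>S\<^esub> ?br x y" using r s v c by simp
  qed
  have alt: "?br x x = \<zero>\<^bsub>S\<^esub>" if x: "x \<in> B" for x
  proof -
    obtain r where r: "r \<in> carrier R" "\<sigma> r = x" "\<sigma> r \<in> ring_center S" using lft x by meson
    have "?br (\<sigma> r) (\<sigma> r) = \<sigma> \<zero>" by (rule bracket_eq) (use r in auto)
    then show ?thesis using r by simp
  qed
  have leibniz: "?br x (y \<otimes>\<^bsub>S\<^esub> z) = ?br x y \<otimes>\<^bsub>S\<^esub> z \<oplus>\<^bsub>S\<^esub> y \<otimes>\<^bsub>S\<^esub> ?br x z"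
    if xyz: "x \<in> B" "y \<in> B" "z \<in> B" for x y z
  proof -
    obtain r s u where r: "r \<in> carrier R" "\<sigma> r = x" "\<sigma> r \<in> ring_center S"
      and s: "s \<in> carrier R" "\<sigma> s = y" "\<sigma> s \<in> ring_center S"
      and u: "u \<in> carrier R" "\<sigma> u = z" "\<sigma> u \<in> ring_center S" using lft xyz by meson
    obtain v where v: "v \<in> carrier R" "r \<otimes> s \<ominus> s \<otimes> r = h \<otimes> v" "?br x y = \<sigma> v"
      using bracket_lift[of r s] r s by metis
    obtain w where w: "w \<in> carrier R" "r \<otimes> u \<ominus> u \<otimes> r = h \<otimes> w" "?br x z = \<sigma> w"
      using bracket_lift[of r u] r u by metis
    have "r \<otimes> (s \<otimes> u) \<ominus> (s \<otimes> u) \<otimes> r = (r \<otimes> s \<ominus> s \<otimes> r) \<otimes> u \<oplus> s \<otimes> (r \<otimes> u \<ominus> u \<otimes> r)"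
      using r s u by algebra
    also have "\<dots> = h \<otimes> (v \<otimes> u \<oplus> s \<otimes> w)"
      unfolding v(2) w(2) using s u v w by (simp add: hx R.m_assoc R.r_distr)
    finally have "?br (\<sigma> r) (\<sigma> (s \<otimes> u)) = \<sigma> (v \<otimes> u \<oplus> s \<otimes> w)"
      using r s u v w subringE(6)[OF sub] BZ xyz by (intro bracket_eq) auto
    then show ?thesis using r s u v w by simp
  qed
  have jacobi: "?br x (?br y z) \<oplus>\<^bsub>S\<^esub> ?br y (?br z x) \<oplus>\<^bsub>S\<^esub> ?br z (?br x y) = \<zero>\<^bsub>S\<^esub>"
    if xyz: "x \<in> B" "y \<in> B" "z \<in> B" for x y z
  proof -
    \<comment> \<open>A nested bracket is a double commutator divided by \<open>h\<close> twice. The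
      quotient \<open>v\<close> of the inner commutator itself serves as the lift of the inner
      bracket.\<close>
    have double: "\<exists>w\<in>carrier R. ?br (\<sigma> r) (?br (\<sigma> s) (\<sigma> u)) = \<sigma> w \<and>
        r \<otimes> (s \<otimes> u \<ominus> u \<otimes> s) \<ominus> (s \<otimes> u \<ominus> u \<otimes> s) \<otimes> r = h \<otimes> (h \<otimes> w)"
      if rsu: "r \<in> carrier R" "s \<in> carrier R" "u \<in> carrier R" "\<sigma> r \<in> B" "\<sigma> s \<in> B" "\<sigma> u \<in> B" for r s u
    proof -
      obtain v where v: "v \<in> carrier R" "s \<otimes> u \<ominus> u \<otimes> s = h \<otimes> v" "?br (\<sigma> s) (\<sigma> u) = \<sigma> v"
        using bracket_lift[of s u] BZ[OF rsu(5)] BZ[OF rsu(6)] rsu(2,3) by metis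
      have "\<sigma> v \<in> B" using br_closed rsu v(3) by metis
      then obtain w where w: "w \<in> carrier R" "r \<otimes> v \<ominus> v \<otimes> r = h \<otimes> w" "?br (\<sigma> r) (\<sigma> v) = \<sigma> w"
        using bracket_lift[of r v] BZ rsu(1) BZ[OF rsu(4)] v(1) by metis
      have "r \<otimes> (h \<otimes> v) \<ominus> (h \<otimes> v) \<otimes> r = h \<otimes> (r \<otimes> v \<ominus> v \<otimes> r)"
        using rsu v by (simp add: hx R.m_assoc R.minus_eq R.r_distr R.r_minus)
      then show ?thesis using v w by auto
    qed
    obtain r s u where r: "r \<in> carrier R" "\<sigma> r = x" and s: "s \<in> carrier R" "\<sigma> s = y"
      and u: "u \<in> carrier R" "\<sigma> u = z" using lft xyz by meson
    obtain w1 where w1: "w1 \<in> carrier R" "?br x (?br y z) = \<sigma> w1"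
      "r \<otimes> (s \<otimes> u \<ominus> u \<otimes> s) \<ominus> (s \<otimes> u \<ominus> u \<otimes> s) \<otimes> r = h \<otimes> (h \<otimes> w1)"
      using double[of r s u] r s u xyz by auto
    obtain w2 where w2: "w2 \<in> carrier R" "?br y (?br z x) = \<sigma> w2"
      "s \<otimes> (u \<otimes> r \<ominus> r \<otimes> u) \<ominus> (u \<otimes> r \<ominus> r \<otimes> u) \<otimes> s = h \<otimes> (h \<otimes> w2)"
      using double[of s u r] r s u xyz by auto
    obtain w3 where w3: "w3 \<in> carrier R" "?br z (?br x y) = \<sigma> w3"
      "u \<otimes> (r \<otimes> s \<ominus> s \<otimes> r) \<ominus> (r \<otimes> s \<ominus> s \<otimes> r) \<otimes> u = h \<otimes> (h \<otimes> w3)"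
      using double[of u r s] r s u xyz by auto
    have "h \<otimes> (h \<otimes> (w1 \<oplus> w2 \<oplus> w3)) = h \<otimes> (h \<otimes> w1) \<oplus> h \<otimes> (h \<otimes> w2) \<oplus> h \<otimes> (h \<otimes> w3)"
      using w1(1) w2(1) w3(1) by (simp add: R.r_distr)
    \<comment> \<open>The Jacobi identity for commutators, valid in every associative ring.\<close>
    also have "\<dots> = \<zero>"
      unfolding w1(3)[symmetric] w2(3)[symmetric] w3(3)[symmetric] using r(1) s(1) u(1) by algebra
    finally have "h \<otimes> (h \<otimes> (w1 \<oplus> w2 \<oplus> w3)) = h \<otimes> (h \<otimes> \<zero>)" by simp
    then have "w1 \<oplus> w2 \<oplus> w3 = \<zero>" using w1(1) w2(1) w3(1) by (metis h_cancel h_closed R.m_closed R.a_closed R.zero_closed)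
    then have "\<sigma> w1 \<oplus>\<^bsub>S\<^esub> \<sigma> w2 \<oplus>\<^bsub>S\<^esub> \<sigma> w3 = \<zero>\<^bsub>S\<^esub>"
      using w1(1) w2(1) w3(1) by (metis H.hom_add H.hom_zero R.a_closed)
    then show ?thesis using w1 w2 w3 by simp
  qed
  show ?thesis
    unfolding poisson_algebra_def
    using alg cring br_closed addl addr scal scar alt jacobi leibniz by simp
qed

end

section \<open>Poisson algebras\<close>

locale poisson =
  fixes \<kappa> :: "'k::comm_ring_1 \<Rightarrow> 'a" and B :: "('a, 's) ring_scheme" (structure)
    and br :: "'a \<Rightarrow> 'a \<Rightarrow> 'a"
  assumes poisson_algebra: "poisson_algebra \<kappa> B br"

sublocale poisson \<subseteq> cring B
  using poisson_algebra by (simp add: poisson_algebra_def)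

context poisson
begin

lemma kappa_closed [simp]: "\<kappa> c \<in> carrier B"
  using poisson_algebra by (auto simp: poisson_algebra_def algebra_over_def ring_center_def)

lemma br_closed [simp]: "\<lbrakk>x \<in> carrier B; y \<in> carrier B\<rbrakk> \<Longrightarrow> br x y \<in> carrier B"
  and br_add_left: "\<lbrakk>x \<in> carrier B; y \<in> carrier B; z \<in> carrier B\<rbrakk> \<Longrightarrow> br (x \<oplus> y) z = br x z \<oplus> br y z"
  and br_add_right: "\<lbrakk>x \<in> carrier B; y \<in> carrier B; z \<in> carrier B\<rbrakk> \<Longrightarrow> br x (y \<oplus> z) = br x y \<oplus> br x z"
  and br_smult_right: "\<lbrakk>x \<in> carrier B; y \<in> carrier B\<rbrakk> \<Longrightarrow> br x (\<kappa> c \<otimes> y) = \<kappa> c \<otimes> br x y"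
  and br_alt: "x \<in> carrier B \<Longrightarrow> br x x = \<zero>"
  and jacobi: "\<lbrakk>x \<in> carrier B; y \<in> carrier B; z \<in> carrier B\<rbrakk> \<Longrightarrow>
    br x (br y z) \<oplus> br y (br z x) \<oplus> br z (br x y) = \<zero>"
  and leibniz: "\<lbrakk>x \<in> carrier B; y \<in> carrier B; z \<in> carrier B\<rbrakk> \<Longrightarrow>
    br x (y \<otimes> z) = br x y \<otimes> z \<oplus> y \<otimes> br x z"
  using poisson_algebra unfolding poisson_algebra_def by blast+

lemma br_minus_right:
  assumes "x \<in> carrier B" "y \<in> carrier B"
  shows "br x (\<ominus> y) = \<ominus> br x y"
proof -
  have z: "br x \<zero> = \<zero>"
    using br_add_right[of x \<zero> \<zero>] assms by (metis add.r_cancel_one' br_closed l_zero zero_closed)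
  have "br x (\<ominus> y) \<oplus> br x y = \<zero>"
    using br_add_right[of x "\<ominus> y" y] assms z by (simp add: l_neg)
  then show ?thesis using assms by (metis a_inv_closed br_closed minus_equality)
qed

text \<open>Polarization of \<open>br x x = \<zero>\<close> at the sum of \<open>x\<close> and
  \<open>y\<close>.\<close>

lemma br_antisym:
  assumes "x \<in> carrier B" "y \<in> carrier B"
  shows "br x y = \<ominus> br y x"
proof -
  have "br x y \<oplus> br y x = (br x x \<oplus> br x y) \<oplus> (br y x \<oplus> br y y)"
    using assms by (simp add: br_alt)
  also have "\<dots> = br (x \<oplus> y) (x \<oplus> y)"
    using assms by (simp add: br_add_left br_add_right a_ac del: br_alt)
  also have "\<dots> = \<zero>" using assms by (intro br_alt) simp
  finally have "br x y \<oplus> br y x = \<zero>" .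
  then show ?thesis using assms by (metis br_closed minus_equality)
qed

end

text \<open>Apart from closure, the axioms are identities, so by injectivity of \<phi> they may be
  checked after applying \<phi>. This will move the Poisson structure of \<open>C\<close> to the
  polynomial ring, where Poisson Ore extensions are defined.\<close>

lemma poisson_algebra_transport:
  assumes \<phi>: "\<phi> \<in> ring_iso S T" and S: "ring S" and T: "poisson_algebra \<kappa> T br"
    and \<kappa>': "\<And>c. \<kappa>' c \<in> carrier S" "\<And>c. \<phi> (\<kappa>' c) = \<kappa> c"
    and P: "\<And>x y. \<lbrakk>x \<in> carrier S; y \<in> carrier S\<rbrakk> \<Longrightarrow> P x y \<in> carrier S"
    and \<phi>P: "\<And>x y. \<lbrakk>x \<in> carrier S; y \<in> carrier S\<rbrakk> \<Longrightarrow> \<phi> (P x y) = br (\<phi> x) (\<phi> y)"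
  shows "poisson_algebra \<kappa>' S P"
proof -
  interpret S: ring S by (rule S)
  interpret T: poisson \<kappa> T br by (rule poisson.intro) (rule T)
  note E = ring_iso_memE[OF \<phi>]
  have inj: "x = y" if "x \<in> carrier S" "y \<in> carrier S" "\<phi> x = \<phi> y" for x y
    using E(5) that by (auto simp: bij_betw_def inj_on_def)
  have zero: "\<phi> \<zero>\<^bsub>S\<^esub> = \<zero>\<^bsub>T\<^esub>"
    using \<phi> S T.ring_axioms by (intro ring_hom_zero) (auto simp: ring_iso_def)
  have comm: "x \<otimes>\<^bsub>S\<^esub> y = y \<otimes>\<^bsub>S\<^esub> x" if "x \<in> carrier S" "y \<in> carrier S" for x y
    using that by (intro inj) (auto simp: E T.m_comm)
  have cring: "cring S"
    by (intro cring.intro comm_monoid.intro comm_monoid_axioms.intro S S.monoid_axioms comm)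
  have hom: "\<kappa>' \<in> ring_hom ring_of_type_algebra S"
  proof -
    have "\<kappa> \<in> ring_hom ring_of_type_algebra T"
      using T by (simp add: poisson_algebra_def algebra_over_def)
    note k = ring_hom_mult[OF this] ring_hom_add[OF this] ring_hom_one[OF this]
    show ?thesis
    proof (rule ring_hom_memI)
      show "\<kappa>' (x \<otimes>\<^bsub>ring_of_type_algebra\<^esub> y) = \<kappa>' x \<otimes>\<^bsub>S\<^esub> \<kappa>' y"
        if "x \<in> carrier ring_of_type_algebra" "y \<in> carrier ring_of_type_algebra" for x y
        using k(1)[OF that] by (intro inj) (simp_all add: \<kappa>' E)
      show "\<kappa>' (x \<oplus>\<^bsub>ring_of_type_algebra\<^esub> y) = \<kappa>' x \<oplus>\<^bsub>S\<^esub> \<kappa>' y"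
        if "x \<in> carrier ring_of_type_algebra" "y \<in> carrier ring_of_type_algebra" for x y
        using k(2)[OF that] by (intro inj) (simp_all add: \<kappa>' E)
      show "\<kappa>' \<one>\<^bsub>ring_of_type_algebra\<^esub> = \<one>\<^bsub>S\<^esub>"
        using k(3) by (intro inj) (simp_all add: \<kappa>' E)
    qed (rule \<kappa>')
  qed
  have alg: "algebra_over \<kappa>' S"
    using S hom \<kappa>' comm by (auto simp: algebra_over_def ring_center_def)
  have scal: "br (\<kappa> c \<otimes>\<^bsub>T\<^esub> x) y = \<kappa> c \<otimes>\<^bsub>T\<^esub> br x y"
    if "x \<in> carrier T" "y \<in> carrier T" for c x y
    using T that by (simp add: poisson_algebra_def)
  show ?thesis
    unfolding poisson_algebra_def
    by (intro conjI alg cring ballI allI; (intro inj)?)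
      (simp_all add: \<kappa>' E P \<phi>P zero scal T.br_add_left T.br_add_right T.br_smult_right T.br_alt
        T.jacobi, simp add: T.leibniz E)
qed

text \<open>The usual construction is reversed: a Poisson bracket on \<open>B[z]\<close> with the
  prescribed values on constants and on \<open>z\<close> is given, and the conditions on \<alpha>
  and \<beta> are to be derived. So these maps are only assumed to send \<open>B\<close> into
  itself.\<close>

locale poisson_ore_bracket = poisson \<kappa> B br + P: poisson "\<lambda>c. pconst B (\<kappa> c)" "UP B" P
  for \<kappa> :: "'k::comm_ring_1 \<Rightarrow> 'a" and B (structure) and br P +
  fixes \<alpha> \<beta> :: "'a \<Rightarrow> 'a"
  assumes alpha_closed [simp]: "a \<in> carrier B \<Longrightarrow> \<alpha> a \<in> carrier B"
    and beta_closed [simp]: "a \<in> carrier B \<Longrightarrow> \<beta> a \<in> carrier B"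
    and P_const: "\<lbrakk>a \<in> carrier B; b \<in> carrier B\<rbrakk> \<Longrightarrow>
      P (pconst B a) (pconst B b) = pconst B (br a b)"
    and P_var: "a \<in> carrier B \<Longrightarrow> P (pvar B) (pconst B a) =
      pconst B (\<alpha> a) \<otimes>\<^bsub>UP B\<^esub> pvar B \<oplus>\<^bsub>UP B\<^esub> pconst B (\<beta> a)"
begin

sublocale U: UP_cring B "UP B"
  by (simp add: UP_cring_def cring_axioms)

declare carrier_UP [simp del]

definition Z :: "nat \<Rightarrow> 'a" where "Z = pvar B"

text \<open>Degree at most one suffices: \<open>P Z (C a)\<close> has this form and
  \<open>P (C c)\<close> preserves it, so every identity for brackets of \<open>z\<close> with
  constants splits into two identities of coefficients.\<close>

definition lin :: "'a \<Rightarrow> 'a \<Rightarrow> nat \<Rightarrow> 'a"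
  where "lin a b = pconst B a \<otimes>\<^bsub>UP B\<^esub> Z \<oplus>\<^bsub>UP B\<^esub> pconst B b"

abbreviation C :: "'a \<Rightarrow> nat \<Rightarrow> 'a" where "C \<equiv> pconst B"

lemma C_closed [simp]: "a \<in> carrier B \<Longrightarrow> C a \<in> carrier (UP B)"
  and X_closed [simp]: "Z \<in> carrier (UP B)"
  by (simp_all add: Z_def)

lemma lin_closed [simp]: "\<lbrakk>a \<in> carrier B; b \<in> carrier B\<rbrakk> \<Longrightarrow> lin a b \<in> carrier (UP B)"
  using P.a_closed[of "C a \<otimes>\<^bsub>UP B\<^esub> Z" "C b"] P.m_closed[of "C a" "Z"]
  by (simp add: lin_def)

lemma C_mult: "\<lbrakk>a \<in> carrier B; b \<in> carrier B\<rbrakk> \<Longrightarrow> C (a \<otimes> b) = C a \<otimes>\<^bsub>UP B\<^esub> C b"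
  using U.monom_mult[of a b 0 0] by simp

lemma lin_inject:
  assumes "a \<in> carrier B" "b \<in> carrier B" "a' \<in> carrier B" "b' \<in> carrier B"
  shows "lin a b = lin a' b' \<longleftrightarrow> a = a' \<and> b = b'"
proof -
  have "lin x y = (\<lambda>n. if n = 1 then x else if n = 0 then y else \<zero>)"
    if "x \<in> carrier B" "y \<in> carrier B" for x y
  proof -
    have "C x \<otimes>\<^bsub>UP B\<^esub> Z = up_ring.monom (UP B) x 1"
      using U.monom_mult[of x \<one> 0 1] that by (simp add: Z_def)
    then show ?thesis
      using that by (simp add: lin_def UP_add_eq UP_monom_closed carrier_UP) (auto simp: UP_monom_eq)
  qed
  then show ?thesis using assms by (auto simp: fun_eq_iff split: if_splits)
qed

lemma lin_add:
  "\<lbrakk>a \<in> carrier B; b \<in> carrier B; a' \<in> carrier B; b' \<in> carrier B\<rbrakk> \<Longrightarrow>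
    lin a b \<oplus>\<^bsub>UP B\<^esub> lin a' b' = lin (a \<oplus> a') (b \<oplus> b')"
  unfolding lin_def using P.l_distr[of "C a" "C a'" "Z"]
    P.m_closed[of "C a" "Z"] P.m_closed[of "C a'" "Z"]
  by (simp add: P.a_ac)

lemma lin_minus:
  "\<lbrakk>a \<in> carrier B; b \<in> carrier B\<rbrakk> \<Longrightarrow> \<ominus>\<^bsub>UP B\<^esub> lin a b = lin (\<ominus> a) (\<ominus> b)"
  unfolding lin_def using P.l_minus[of "C a" "Z"] P.m_closed[of "C a" "Z"]
  by (simp add: P.minus_add)

lemma lin_smult:
  "\<lbrakk>a \<in> carrier B; b \<in> carrier B; c \<in> carrier B\<rbrakk> \<Longrightarrow> C c \<otimes>\<^bsub>UP B\<^esub> lin a b = lin (c \<otimes> a) (c \<otimes> b)"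
  unfolding lin_def using P.m_closed[of "C a" "Z"]
  by (simp add: P.r_distr C_mult P.m_assoc)

lemma P_X: "a \<in> carrier B \<Longrightarrow> P (Z) (C a) = lin (\<alpha> a) (\<beta> a)"
  using P_var[of a] by (simp add: lin_def Z_def)

text \<open>The Leibniz rule for \<open>a z\<close> together with \<open>{c, z} = - {z, c}\<close>,
  which produces the subtracted terms.\<close>

lemma P_C_lin:
  assumes "c \<in> carrier B" "a \<in> carrier B" "b \<in> carrier B"
  shows "P (C c) (lin a b) = lin (br c a \<ominus> a \<otimes> \<alpha> c) (br c b \<ominus> a \<otimes> \<beta> c)"
proof -
  have cX: "P (C c) (Z) = lin (\<ominus> \<alpha> c) (\<ominus> \<beta> c)"
    using P.br_antisym[of "C c" "Z"] assms(1) by (simp add: P_X lin_minus)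
  have m: "C a \<otimes>\<^bsub>UP B\<^esub> Z \<in> carrier (UP B)" using P.m_closed[of "C a" "Z"] assms by simp
  have z: "C x \<otimes>\<^bsub>UP B\<^esub> Z = lin x \<zero>" "C x = lin \<zero> x" if "x \<in> carrier B" for x
    using that P.m_closed[of "C x" "Z"] by (simp_all add: lin_def P.l_null)
  have "P (C c) (lin a b) = P (C c) (C a) \<otimes>\<^bsub>UP B\<^esub> Z \<oplus>\<^bsub>UP B\<^esub> C a \<otimes>\<^bsub>UP B\<^esub> P (C c) (Z)
      \<oplus>\<^bsub>UP B\<^esub> P (C c) (C b)"
    unfolding lin_def using assms m by (simp add: P.br_add_right P.leibniz)
  also have "\<dots> = lin (br c a) \<zero> \<oplus>\<^bsub>UP B\<^esub> lin (a \<otimes> \<ominus> \<alpha> c) (a \<otimes> \<ominus> \<beta> c) \<oplus>\<^bsub>UP B\<^esub> lin \<zero> (br c b)"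
    using assms by (simp add: P_const cX lin_smult z(1)) (simp add: z(2)[of "br c b"])
  also have "\<dots> = lin (br c a \<ominus> a \<otimes> \<alpha> c) (br c b \<ominus> a \<otimes> \<beta> c)"
    using assms by (simp add: lin_add minus_eq r_minus a_comm)
  finally show ?thesis .
qed

text \<open>Comparison of both coefficients in \<open>{z, a + b} = {z, a} + {z, b}\<close>. Scalar
  multiples and products are treated in the same way below.\<close>

lemma alpha_beta_add:
  assumes "a \<in> carrier B" "b \<in> carrier B"
  shows "\<alpha> (a \<oplus> b) = \<alpha> a \<oplus> \<alpha> b" "\<beta> (a \<oplus> b) = \<beta> a \<oplus> \<beta> b"
proof -
  have "P (Z) (C (a \<oplus> b)) = P (Z) (C a) \<oplus>\<^bsub>UP B\<^esub> P (Z) (C b)"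
    using assms by (simp add: P.br_add_right)
  then have "lin (\<alpha> (a \<oplus> b)) (\<beta> (a \<oplus> b)) = lin (\<alpha> a \<oplus> \<alpha> b) (\<beta> a \<oplus> \<beta> b)"
    using assms by (simp add: P_X lin_add del: U.monom_add)
  then show "\<alpha> (a \<oplus> b) = \<alpha> a \<oplus> \<alpha> b" "\<beta> (a \<oplus> b) = \<beta> a \<oplus> \<beta> b"
    using assms by (simp_all add: lin_inject)
qed

lemma alpha_beta_smult:
  assumes "a \<in> carrier B"
  shows "\<alpha> (\<kappa> c \<otimes> a) = \<kappa> c \<otimes> \<alpha> a" "\<beta> (\<kappa> c \<otimes> a) = \<kappa> c \<otimes> \<beta> a"
proof -
  have "P (Z) (C (\<kappa> c \<otimes> a)) = C (\<kappa> c) \<otimes>\<^bsub>UP B\<^esub> P (Z) (C a)"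
    using assms by (simp add: C_mult P.br_smult_right)
  then have "lin (\<alpha> (\<kappa> c \<otimes> a)) (\<beta> (\<kappa> c \<otimes> a)) = lin (\<kappa> c \<otimes> \<alpha> a) (\<kappa> c \<otimes> \<beta> a)"
    using assms by (simp add: P_X lin_smult)
  then show "\<alpha> (\<kappa> c \<otimes> a) = \<kappa> c \<otimes> \<alpha> a" "\<beta> (\<kappa> c \<otimes> a) = \<kappa> c \<otimes> \<beta> a"
    using assms by (simp_all add: lin_inject)
qed

lemma alpha_beta_mult:
  assumes "a \<in> carrier B" "b \<in> carrier B"
  shows "\<alpha> (a \<otimes> b) = \<alpha> a \<otimes> b \<oplus> a \<otimes> \<alpha> b" "\<beta> (a \<otimes> b) = \<beta> a \<otimes> b \<oplus> a \<otimes> \<beta> b"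
proof -
  have "P (Z) (C (a \<otimes> b))
      = P (Z) (C a) \<otimes>\<^bsub>UP B\<^esub> C b \<oplus>\<^bsub>UP B\<^esub> C a \<otimes>\<^bsub>UP B\<^esub> P (Z) (C b)"
    using assms by (simp add: C_mult P.leibniz)
  also have "\<dots> = C b \<otimes>\<^bsub>UP B\<^esub> lin (\<alpha> a) (\<beta> a) \<oplus>\<^bsub>UP B\<^esub> C a \<otimes>\<^bsub>UP B\<^esub> lin (\<alpha> b) (\<beta> b)"
    using assms by (simp add: P_X P.m_comm)
  also have "\<dots> = lin (\<alpha> a \<otimes> b \<oplus> a \<otimes> \<alpha> b) (\<beta> a \<otimes> b \<oplus> a \<otimes> \<beta> b)"
    using assms by (simp add: lin_smult lin_add m_comm)
  finally have "lin (\<alpha> (a \<otimes> b)) (\<beta> (a \<otimes> b)) = lin (\<alpha> a \<otimes> b \<oplus> a \<otimes> \<alpha> b) (\<beta> a \<otimes> b \<oplus> a \<otimes> \<beta> b)"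
    using assms by (simp add: P_X)
  then show "\<alpha> (a \<otimes> b) = \<alpha> a \<otimes> b \<oplus> a \<otimes> \<alpha> b" "\<beta> (a \<otimes> b) = \<beta> a \<otimes> b \<oplus> a \<otimes> \<beta> b"
    using assms by (simp_all add: lin_inject)
qed

text \<open>The two coefficients of the Jacobi identity for \<open>z\<close>, \<open>a\<close>, \<open>b\<close>.\<close>

lemma alpha_beta_bracket:
  assumes a: "a \<in> carrier B" and b: "b \<in> carrier B"
  shows "\<alpha> (br a b) = br (\<alpha> a) b \<oplus> br a (\<alpha> b)"
    and "\<beta> (br a b) \<ominus> br (\<beta> a) b \<ominus> br a (\<beta> b) = \<alpha> a \<otimes> \<beta> b \<ominus> \<beta> a \<otimes> \<alpha> b"
proof -
  have anti: "br b (\<alpha> a) = \<ominus> br (\<alpha> a) b" "br b (\<beta> a) = \<ominus> br (\<beta> a) b"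
    using assms by (metis br_antisym alpha_closed, metis br_antisym beta_closed)
  have bX: "P (C b) (Z) = lin (\<ominus> \<alpha> b) (\<ominus> \<beta> b)"
    using P.br_antisym[of "C b" "Z"] b by (simp add: P_X lin_minus)
  have "P (Z) (P (C a) (C b)) \<oplus>\<^bsub>UP B\<^esub> P (C a) (P (C b) (Z))
      \<oplus>\<^bsub>UP B\<^esub> P (C b) (P (Z) (C a)) = \<zero>\<^bsub>UP B\<^esub>"
    using assms by (intro P.jacobi) simp_all
  also have "\<zero>\<^bsub>UP B\<^esub> = lin \<zero> \<zero>"
    by (simp add: lin_def)
  finally have "lin (\<alpha> (br a b) \<oplus> (br a (\<ominus> \<alpha> b) \<ominus> \<ominus> \<alpha> b \<otimes> \<alpha> a) \<oplus> (br b (\<alpha> a) \<ominus> \<alpha> a \<otimes> \<alpha> b))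
      (\<beta> (br a b) \<oplus> (br a (\<ominus> \<beta> b) \<ominus> \<ominus> \<alpha> b \<otimes> \<beta> a) \<oplus> (br b (\<beta> a) \<ominus> \<alpha> a \<otimes> \<beta> b)) = lin \<zero> \<zero>"
    using assms by (simp add: P_const P_X bX P_C_lin lin_add)
  then have e: "\<alpha> (br a b) \<oplus> (br a (\<ominus> \<alpha> b) \<ominus> \<ominus> \<alpha> b \<otimes> \<alpha> a) \<oplus> (br b (\<alpha> a) \<ominus> \<alpha> a \<otimes> \<alpha> b) = \<zero>"
    "\<beta> (br a b) \<oplus> (br a (\<ominus> \<beta> b) \<ominus> \<ominus> \<alpha> b \<otimes> \<beta> a) \<oplus> (br b (\<beta> a) \<ominus> \<alpha> a \<otimes> \<beta> b) = \<zero>"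
    using assms by (simp_all add: lin_inject)
  define x y u v where "x = br a (\<alpha> b)" "y = br (\<alpha> a) b" "u = br a (\<beta> b)" "v = br (\<beta> a) b"
  have c: "x \<in> carrier B" "y \<in> carrier B" "u \<in> carrier B" "v \<in> carrier B"
    using assms by (simp_all add: x_y_u_v_def)
  have ab: "\<alpha> a \<in> carrier B" "\<alpha> b \<in> carrier B" "\<beta> a \<in> carrier B" "\<beta> b \<in> carrier B"
    "\<alpha> (br a b) \<in> carrier B" "\<beta> (br a b) \<in> carrier B" using assms by simp_all
  \<comment> \<open>By commutativity the products of \<open>\<alpha> a\<close> and
    \<open>\<alpha> b\<close> cancel in the first identity. In the second the mixed products of
    \<alpha> and \<beta> remain and give the right-hand side of the \<alpha>-derivation
    rule.\<close>
  have e1: "\<alpha> (br a b) \<oplus> (\<ominus> x \<ominus> \<ominus> \<alpha> b \<otimes> \<alpha> a) \<oplus> (\<ominus> y \<ominus> \<alpha> a \<otimes> \<alpha> b) = \<zero>"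
    and e2: "\<beta> (br a b) \<oplus> (\<ominus> u \<ominus> \<ominus> \<alpha> b \<otimes> \<beta> a) \<oplus> (\<ominus> v \<ominus> \<alpha> a \<otimes> \<beta> b) = \<zero>"
    using e assms by (simp_all add: anti br_minus_right x_y_u_v_def)
  have "\<alpha> (br a b) = (\<alpha> (br a b) \<oplus> (\<ominus> x \<ominus> \<ominus> \<alpha> b \<otimes> \<alpha> a) \<oplus> (\<ominus> y \<ominus> \<alpha> a \<otimes> \<alpha> b)) \<oplus> (y \<oplus> x)"
    using c ab by algebra
  then show "\<alpha> (br a b) = br (\<alpha> a) b \<oplus> br a (\<alpha> b)"
    unfolding e1 using c by (simp add: x_y_u_v_def)
  have "\<beta> (br a b) \<ominus> v \<ominus> u
      = (\<beta> (br a b) \<oplus> (\<ominus> u \<ominus> \<ominus> \<alpha> b \<otimes> \<beta> a) \<oplus> (\<ominus> v \<ominus> \<alpha> a \<otimes> \<beta> b)) \<oplus> (\<alpha> a \<otimes> \<beta> b \<ominus> \<beta> a \<otimes> \<alpha> b)"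
    using c ab by algebra
  then show "\<beta> (br a b) \<ominus> br (\<beta> a) b \<ominus> br a (\<beta> b) = \<alpha> a \<otimes> \<beta> b \<ominus> \<beta> a \<otimes> \<alpha> b"
    unfolding e2 using c ab by (simp add: x_y_u_v_def)
qed

theorem poisson_ore_extension: "poisson_ore_extension \<kappa> B br \<alpha> \<beta> P"
  unfolding poisson_ore_extension_def poisson_derivation_def alpha_derivation_def skew_derivation_def
  using poisson_algebra P.poisson_algebra
  by (intro conjI ballI allI;
      ((simp add: alpha_beta_add alpha_beta_smult alpha_beta_bracket P_const P_var del: One_nat_def; fail)
        | simp add: alpha_beta_mult))

end

section \<open>Scalars\<close>

text \<open>Negative exponents are reached by \<open>unshift\<close>, which descends from
  \<open>q x\<close> to \<open>x\<close>. It matches cancellation of \<open>q\<close> in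
  \<open>A\<close>, so the inverse of \<open>q\<close> does not have to be followed through \<tau>
  and \<delta>.\<close>

lemma laurent_induct [case_names const add shift unshift]:
  fixes x :: "'k::comm_ring_1 laurent"
  assumes const: "\<And>c. Q (laurent_const c)"
    and add: "\<And>x y. \<lbrakk>Q x; Q y\<rbrakk> \<Longrightarrow> Q (x + y)"
    and shift: "\<And>x. Q x \<Longrightarrow> Q (laurent_q * x)"
    and unshift: "\<And>x. Q (laurent_q * x) \<Longrightarrow> Q x"
  shows "Q x"
proof -
  have q: "laurent_q * Poly_Mapping.single n c = Poly_Mapping.single (n + 1) c" for n and c :: 'k
    by (simp add: laurent_q_def mult_single add.commute)
  have single: "Q (Poly_Mapping.single n c)" for n c
  proof (induction n rule: int_induct[where k = 0])
    case base
    show ?case using const[of c] by (simp add: laurent_const_def)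
  next
    case (step1 i)
    then show ?case using shift q[of i c] by metis
  next
    case (step2 i)
    then show ?case using unshift q[of "i - 1" c] by simp
  qed
  show ?thesis
  proof (induction x rule: update_induct)
    case const
    show ?case using single[of 0 0] by simp
  next
    case (update f a b)
    have "Poly_Mapping.update a b f = f + Poly_Mapping.single a b"
      using update(1)
      by (intro poly_mapping_eqI) (auto simp: lookup_update lookup_add lookup_single in_keys_iff when_def)
    then show ?case using add update(3) single by metis
  qed
qed

section \<open>The subalgebra generated by a central power of the variable\<close>

lemma (in ring) subring_finsum:
  assumes B: "subring B R" and g: "\<And>i. g i \<in> B"
  shows "finsum (R\<lparr>carrier := B\<rparr>) g {..N::nat} = finsum R g {..N}"
proof -
  interpret B: ring "R\<lparr>carrier := B\<rparr>" by (rule subring_is_ring[OF B])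
  have [simp]: "g i \<in> carrier R" for i using g subringE(1)[OF B] by auto
  have gB: "g \<in> I \<rightarrow> carrier (R\<lparr>carrier := B\<rparr>)" for I using g by simp
  show ?thesis
  proof (induction N)
    case 0
    show ?case by (subst B.finsum_0[OF gB]) simp
  next
    case (Suc N)
    show ?case using Suc by (subst B.finsum_Suc[OF gB]) (simp add: Pi_def)
  qed
qed

lemma (in ring) UP_mult_eq:
  "\<lbrakk>p \<in> up R; r \<in> up R\<rbrakk> \<Longrightarrow> p \<otimes>\<^bsub>UP R\<^esub> r = (\<lambda>n. \<Oplus>i\<in>{..n}. p i \<otimes> r (n - i))"
  by (simp add: UP_def)

context skew_ring
begin

lemma algebra_over_ore:
  assumes \<iota>: "algebra_over \<iota> A" and fix_iota: "\<And>c. \<tau> (\<iota> c) = \<iota> c" "\<And>c. \<delta> (\<iota> c) = \<zero>"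
  shows "algebra_over (\<lambda>c. pconst A (\<iota> c)) E"
proof -
  have hom: "\<iota> \<in> ring_hom ring_of_type_algebra A" and cen: "\<iota> c \<in> ring_center A" for c
    using \<iota> by (auto simp: algebra_over_def)
  have "(\<lambda>c. pconst A (\<iota> c)) \<in> ring_hom ring_of_type_algebra E"
    using ring_hom_trans[OF hom pconst_hom] by (simp add: comp_def)
  moreover have "pconst A (\<iota> c) \<in> ring_center E" for c
    using cen fix_iota by (rule pconst_center)
  ultimately show ?thesis using ore_ring by (auto simp: algebra_over_def)
qed

text \<open>Since \<open>c\<close> commutes with \<open>t\<close>, multiplication by it from either
  side acts on each coefficient separately.\<close>

lemma non_zero_divisor_pconst:
  assumes c: "non_zero_divisor A c" and "\<tau> c = c" "\<delta> c = \<zero>"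
  shows "non_zero_divisor E (pconst A c)"
proof -
  have cc: "c \<in> carrier A" using c by (simp add: non_zero_divisor_def)
  have "p = \<zero>\<^bsub>E\<^esub>" if p: "p \<in> up A" and e: "pconst A c \<otimes>\<^bsub>E\<^esub> p = \<zero>\<^bsub>E\<^esub>" for p
  proof -
    have "c \<otimes> p n = \<zero>" for n
      using fun_cong[OF e, of n] p cc by (simp add: ore_monom_mult ore_zero)
    then have "p n = \<zero>" for n
      using c mem_upD[OF p] unfolding non_zero_divisor_def by blast
    then show ?thesis by (simp add: ore_zero fun_eq_iff)
  qed
  moreover have "p = \<zero>\<^bsub>E\<^esub>" if p: "p \<in> up A" and e: "p \<otimes>\<^bsub>E\<^esub> pconst A c = \<zero>\<^bsub>E\<^esub>" for p
  proof -
    have "p n \<otimes> c = \<zero>" for n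
      using fun_cong[OF e, of n] p cc assms(2,3) by (simp add: ore_mult_monom ore_zero)
    then have "p n = \<zero>" for n
      using c mem_upD[OF p] unfolding non_zero_divisor_def by blast
    then show ?thesis by (simp add: ore_zero fun_eq_iff)
  qed
  ultimately show ?thesis using cc by (auto simp: non_zero_divisor_def UP_monom_closed)
qed

text \<open>\<open>T^i a\<close> has no coefficient beyond \<open>i\<close>, so at the top exponent
  the \<delta>-part drops out and each step applies \<tau> alone.\<close>

lemma T_pow_pconst_top:
  assumes "a \<in> carrier A"
  shows "(T ^^ i) (pconst A a) i = (\<tau> ^^ i) a"
proof (induction i)
  case 0
  show ?case using assms by (simp add: UP_monom_eq)
next
  case (Suc i)
  have "bound \<zero> 0 (pconst A a)" using assms by (auto simp: UP_monom_eq)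
  then have "bound \<zero> i ((T ^^ i) (pconst A a))" using T_pow_bound[of 0 "pconst A a" i] by simp
  then have "(T ^^ i) (pconst A a) (Suc i) = \<zero>" by (rule bound.bound) simp
  moreover have "(\<tau> ^^ i) a \<in> carrier A" using assms by (induction i) auto
  ultimately show ?case using Suc by (simp add: T_Suc)
qed

text \<open>Nothing is shifted into exponent 0, so each step applies \<delta> alone. These two outer
  coefficients of \<open>t^i a\<close> are the source of the formulas for \<alpha> and
  \<beta>.\<close>

lemma T_pow_pconst_0:
  assumes "a \<in> carrier A"
  shows "(T ^^ i) (pconst A a) 0 = (\<delta> ^^ i) a"
proof (induction i)
  case 0
  show ?case using assms by (simp add: UP_monom_eq)
next
  case (Suc i)
  have "(\<delta> ^^ i) a \<in> carrier A" using assms by (induction i) auto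
  then show ?case using Suc by (simp add: T_0)
qed

end

section \<open>The central subalgebra \<open>B[t^m]\<close> as a polynomial ring\<close>

locale central_power = skew_quotient R S h \<sigma> \<tau> \<delta> \<tau>' \<delta>'
  for R (structure) and S (structure) and h \<sigma> \<tau> \<delta> \<tau>' \<delta>' +
  fixes \<iota> :: "'k::comm_ring_1 \<Rightarrow> 'a" and B :: "'c set" and m :: nat
  assumes iota: "algebra_over \<iota> R"
    and tau_iota: "\<tau> (\<iota> c) = \<iota> c"
    and delta_iota: "\<delta> (\<iota> c) = \<zero>"
    and h_nzd: "non_zero_divisor R h"
    and B: "central_subalgebra (\<lambda>c. \<sigma> (\<iota> c)) S B"
    and m_pos: "0 < m"
    and C_poisson: "central_poisson_subalgebra (\<lambda>c. pconst S (\<sigma> (\<iota> c))) (ore_ext S \<tau>' \<delta>')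
      (induced_bracket (ore_ext R \<tau> \<delta>) (pconst R h) (\<lambda>p n. \<sigma> (p n)))
      (generate_ring (ore_ext S \<tau>' \<delta>')
        (pconst S ` B \<union> {pvar S [^]\<^bsub>ore_ext S \<tau>' \<delta>'\<^esub> m}))"
begin

sublocale quantization R S h \<sigma>
  by unfold_locales (rule h_nzd)

sublocale RE: ring R.E by (rule R.ore_ring)

sublocale SE: ring S.E by (rule S.ore_ring)

sublocale Q: quotient_map R.E S.E "pconst R h" "\<lambda>p n. \<sigma> (p n)"
  by (rule ore_quotient)

sublocale Q: quantization R.E S.E "pconst R h" "\<lambda>p n. \<sigma> (p n)"
  by unfold_locales (rule R.non_zero_divisor_pconst[OF h_nzd tau_h delta_h])

abbreviation BB where "BB \<equiv> S\<lparr>carrier := B\<rparr>"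

abbreviation C where "C \<equiv> generate_ring S.E (pconst S ` B \<union> {pvar S [^]\<^bsub>S.E\<^esub> m})"

abbreviation brB where "brB \<equiv> induced_bracket R h \<sigma>"

abbreviation brC where "brC \<equiv> induced_bracket R.E (pconst R h) (\<lambda>p n. \<sigma> (p n))"

lemma B_subring: "subring B S" and B_center: "b \<in> B \<Longrightarrow> b \<in> ring_center S"
  and kappa_B: "\<sigma> (\<iota> c) \<in> B"
  using B by (auto simp: central_subalgebra_def)

lemma B_closed: "b \<in> B \<Longrightarrow> b \<in> carrier S"
  using subringE(1)[OF B_subring] by auto

lemma zero_B: "\<zero>\<^bsub>S\<^esub> \<in> B" by (rule subringE(2)[OF B_subring])

lemma C_subring: "subring C S.E" and C_center: "p \<in> C \<Longrightarrow> p \<in> ring_center S.E"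
  and brC_closed: "\<lbrakk>p \<in> C; r \<in> C\<rbrakk> \<Longrightarrow> brC p r \<in> C"
  using C_poisson by (auto simp: central_poisson_subalgebra_def central_subalgebra_def)

lemma pconst_C: "b \<in> B \<Longrightarrow> pconst S b \<in> C"
  by (rule generate_ring.incl) simp

lemma var_pow_C: "up_ring.monom (UP S) \<one>\<^bsub>S\<^esub> m \<in> C"
  using generate_ring.incl[of "pvar S [^]\<^bsub>S.E\<^esub> m" "pconst S ` B \<union> {pvar S [^]\<^bsub>S.E\<^esub> m}" S.E]
  by (simp add: S.ore_var_pow del: One_nat_def)

text \<open>The elements of \<open>B\<close> commute with the variable, which forces both maps to be trivial on \<open>B\<close>.\<close>

lemma
  assumes b: "b \<in> B"
  shows tau_B: "\<tau>' b = b" and delta_B: "\<delta>' b = \<zero>\<^bsub>S\<^esub>"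
proof -
  have bS: "b \<in> carrier S" using b by (rule B_closed)
  let ?v = "up_ring.monom (UP S) \<one>\<^bsub>S\<^esub> 1"
  have v: "?v \<in> up S" by (rule S.UP_monom_closed) simp
  have "?v \<otimes>\<^bsub>S.E\<^esub> pconst S b = pconst S b \<otimes>\<^bsub>S.E\<^esub> ?v"
    using ring_center_commute[OF C_center[OF pconst_C[OF b]]] v by simp
  then have "S.T (pconst S b) n = b \<otimes>\<^bsub>S\<^esub> ?v n" for n
    using S.ore_pow_var_mult[of "pconst S b" 1] S.ore_monom_mult[OF bS v, of 0] bS
    by (simp add: S.UP_monom_closed)
  \<comment> \<open>The coefficients of \<open>t b\<close> at exponents 0 and 1 are
    \<open>\<delta>' b\<close> and \<open>\<tau>' b\<close>; those of \<open>b t\<close> are 0 and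
    \<open>b\<close>.\<close>
  from this[of 0] this[of 1] show "\<tau>' b = b" "\<delta>' b = \<zero>\<^bsub>S\<^esub>"
    using bS by (simp_all add: S.UP_monom_eq ore_shift_def)
qed

lemma T_pow_B:
  assumes r: "\<And>n. r n \<in> B"
  shows "(S.T ^^ i) r = (\<lambda>n. if i \<le> n then r (n - i) else \<zero>\<^bsub>S\<^esub>)"
proof (induction i)
  case 0
  show ?case by simp
next
  case (Suc i)
  have "S.T (\<lambda>n. if i \<le> n then r (n - i) else \<zero>\<^bsub>S\<^esub>) n
      = (if Suc i \<le> n then r (n - Suc i) else \<zero>\<^bsub>S\<^esub>)" for n
    using r B_closed[OF r]
    by (cases n) (auto simp: ore_shift_def tau_B delta_B zero_B)
  moreover have "(S.T ^^ Suc i) r = S.T (\<lambda>n. if i \<le> n then r (n - i) else \<zero>\<^bsub>S\<^esub>)"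
    by (simp add: Suc)
  ultimately show ?case by (simp add: fun_eq_iff)
qed

text \<open>The twist acts only on coefficients of the right factor, where \<open>\<tau>'\<close>
  and \<open>\<delta>'\<close> are trivial. So the ordinary Cauchy product results, even if the
  coefficients of \<open>p\<close> lie outside \<open>B\<close>.\<close>

lemma mult_B:
  assumes p: "p \<in> up S" and r: "r \<in> up S" "\<And>n. r n \<in> B"
  shows "(p \<otimes>\<^bsub>S.E\<^esub> r) n = (\<Oplus>\<^bsub>S\<^esub>i\<in>{..n}. p i \<otimes>\<^bsub>S\<^esub> r (n - i))"
proof -
  have [simp]: "p i \<in> carrier S" "r i \<in> carrier S" for i using p r by auto
  obtain N where "bound \<zero>\<^bsub>S\<^esub> N p" using p by auto
  \<comment> \<open>The range is enlarged until it contains \<open>{..n}\<close> and then cut down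
    to it; terms with \<open>i > n\<close> vanish because \<open>T^i r\<close> starts at exponent
    \<open>i\<close>.\<close>
  then have b: "bound \<zero>\<^bsub>S\<^esub> (max N n) p" by (auto simp: bound_def)
  have "(p \<otimes>\<^bsub>S.E\<^esub> r) n = (\<Oplus>\<^bsub>S\<^esub>i\<in>{..max N n}. p i \<otimes>\<^bsub>S\<^esub> (if i \<le> n then r (n - i) else \<zero>\<^bsub>S\<^esub>))"
    by (simp add: S.ore_mult[OF p r(1) b] S.L_def T_pow_B[OF r(2)])
  also have "\<dots> = (\<Oplus>\<^bsub>S\<^esub>i\<in>{..n}. p i \<otimes>\<^bsub>S\<^esub> (if i \<le> n then r (n - i) else \<zero>\<^bsub>S\<^esub>))"
    by (rule S.finsum_atMost_extend) auto
  also have "\<dots> = (\<Oplus>\<^bsub>S\<^esub>i\<in>{..n}. p i \<otimes>\<^bsub>S\<^esub> r (n - i))"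
    by (rule S.finsum_cong') auto
  finally show ?thesis .
qed

text \<open>The substitution of \<open>t^m\<close> for the variable of \<open>B[z]\<close>, on
  coefficient sequences.\<close>

definition spread :: "(nat \<Rightarrow> 'c) \<Rightarrow> nat \<Rightarrow> 'c"
  where "spread f n = (if m dvd n then f (n div m) else \<zero>\<^bsub>S\<^esub>)"

lemma spread_mult_index [simp]: "spread f (m * k) = f k" "spread f 0 = f 0" "spread f m = f 1"
  using m_pos by (simp_all add: spread_def)

sublocale BB: ring BB by (rule S.subring_is_ring[OF B_subring])

lemma up_BB:
  assumes f: "f \<in> up BB"
  shows "f n \<in> B" and "f \<in> up S"
proof -
  show *: "f n \<in> B" for n using mem_upD[OF f] by simp
  obtain N where "bound \<zero>\<^bsub>BB\<^esub> N f" using BB.bound_upD[OF f] by auto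
  then show "f \<in> up S" by (intro mem_upI exI[of _ N] B_closed *) simp
qed

lemma spread_B: "f \<in> up BB \<Longrightarrow> spread f n \<in> B"
  by (simp add: spread_def up_BB zero_B)

lemma spread_up:
  assumes f: "f \<in> up BB"
  shows "spread f \<in> up S"
proof -
  obtain N where N: "bound \<zero>\<^bsub>S\<^esub> N f" using up_BB(2)[OF f] by auto
  have "bound \<zero>\<^bsub>S\<^esub> (m * N) (spread f)"
  proof
    fix n assume "m * N < n"
    then show "spread f n = \<zero>\<^bsub>S\<^esub>" using N by (auto simp: spread_def elim!: dvdE dest: bound.bound)
  qed
  then show ?thesis by (intro mem_upI exI[of _ "m * N"] B_closed spread_B f) simp
qed

lemma BB_monom:
  "b \<in> B \<Longrightarrow> up_ring.monom (UP BB) b k = up_ring.monom (UP S) b k"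
  using BB.UP_monom_eq[of b k] S.UP_monom_eq[of b k] by (simp add: B_closed fun_eq_iff)

lemma spread_monom:
  "b \<in> B \<Longrightarrow> spread (up_ring.monom (UP BB) b k) = up_ring.monom (UP S) b (m * k)"
  using m_pos by (auto simp: BB_monom S.UP_monom_eq B_closed spread_def fun_eq_iff)

lemma finsum_multiples:
  assumes g: "\<And>i. g i \<in> carrier S" "\<And>i. \<not> m dvd i \<Longrightarrow> g i = \<zero>\<^bsub>S\<^esub>"
  shows "(\<Oplus>\<^bsub>S\<^esub>i\<in>{..m * k}. g i) = (\<Oplus>\<^bsub>S\<^esub>j\<in>{..k}. g (m * j))"
proof -
  have "(\<Oplus>\<^bsub>S\<^esub>i\<in>{..m * k}. g i) = (\<Oplus>\<^bsub>S\<^esub>i\<in>(\<lambda>j. m * j) ` {..k}. g i)"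
  proof (rule S.add.finprod_mono_neutral_cong_right)
    fix i assume "i \<in> {..m * k} - (\<lambda>j. m * j) ` {..k}"
    then have "\<not> m dvd i" using m_pos by (auto elim!: dvdE)
    then show "g i = \<zero>\<^bsub>S\<^esub>" by (rule g(2))
  qed (use g(1) in auto)
  also have "\<dots> = (\<Oplus>\<^bsub>S\<^esub>j\<in>{..k}. g (m * j))"
    using m_pos g(1) by (intro S.finsum_reindex) (auto simp: inj_on_def)
  finally show ?thesis .
qed

text \<open>Over \<open>B\<close> both products are Cauchy products, and for polynomials in
  \<open>t^m\<close> only pairs of exponents divisible by \<open>m\<close> contribute.\<close>

lemma spread_hom: "spread \<in> ring_hom (UP BB) S.E"
proof (rule ring_hom_memI)
  fix f g assume "f \<in> carrier (UP BB)" "g \<in> carrier (UP BB)"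
  then have f: "f \<in> up BB" and g: "g \<in> up BB" by simp_all
  have fS: "f i \<in> carrier S" "g i \<in> carrier S" "spread f i \<in> carrier S" "spread g i \<in> carrier S" for i
    by (simp_all add: B_closed up_BB f g spread_B)
  show "spread f \<in> carrier S.E" using f by (simp add: spread_up)
  show "spread (f \<oplus>\<^bsub>UP BB\<^esub> g) = spread f \<oplus>\<^bsub>S.E\<^esub> spread g"
    using f g by (auto simp: BB.UP_add_eq S.ore_add spread_up spread_def)
  show "spread (f \<otimes>\<^bsub>UP BB\<^esub> g) = spread f \<otimes>\<^bsub>S.E\<^esub> spread g"
  proof
    fix n
    let ?F = "\<lambda>i. spread f i \<otimes>\<^bsub>S\<^esub> spread g (n - i)"
    have r: "(spread f \<otimes>\<^bsub>S.E\<^esub> spread g) n = (\<Oplus>\<^bsub>S\<^esub>i\<in>{..n}. ?F i)"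
      by (intro mult_B spread_up spread_B f g)
    have Fz: "?F i = \<zero>\<^bsub>S\<^esub>" if "\<not> m dvd i \<or> \<not> m dvd n - i" for i
      using that fS by (auto simp: spread_def)
    show "spread (f \<otimes>\<^bsub>UP BB\<^esub> g) n = (spread f \<otimes>\<^bsub>S.E\<^esub> spread g) n"
    proof (cases "m dvd n")
      case True
      then obtain k where n: "n = m * k" by blast
      have "(f \<otimes>\<^bsub>UP BB\<^esub> g) k = (\<Oplus>\<^bsub>S\<^esub>i\<in>{..k}. f i \<otimes>\<^bsub>S\<^esub> g (k - i))"
        using f g subringE(6)[OF B_subring]
        by (simp add: BB.UP_mult_eq) (intro S.subring_finsum B_subring, simp add: up_BB)
      also have "\<dots> = (\<Oplus>\<^bsub>S\<^esub>j\<in>{..k}. ?F (m * j))"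
        unfolding n right_diff_distrib'[symmetric] by simp
      also have "\<dots> = (\<Oplus>\<^bsub>S\<^esub>i\<in>{..m * k}. ?F i)"
        by (rule finsum_multiples[symmetric]) (use fS Fz in auto)
      finally show ?thesis using r by (simp add: n)
    next
      case False
      \<comment> \<open>If \<open>m\<close> divided both \<open>i\<close> and \<open>n - i\<close>,
        it would divide \<open>n\<close>.\<close>
      then have "\<not> m dvd i \<or> \<not> m dvd n - i" if "i \<le> n" for i
        using that by (metis dvd_diffD)
      then have "(\<Oplus>\<^bsub>S\<^esub>i\<in>{..n}. ?F i) = (\<Oplus>\<^bsub>S\<^esub>i\<in>{..n}. \<zero>\<^bsub>S\<^esub>)"
        by (intro S.finsum_cong') (auto simp: Fz)
      then show ?thesis unfolding r using False by (simp add: spread_def)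
    qed
  qed
next
  have "\<one>\<^bsub>UP BB\<^esub> = up_ring.monom (UP BB) \<one>\<^bsub>S\<^esub> 0"
    using BB.UP_monom_eq[of "\<one>\<^bsub>S\<^esub>" 0] subringE(3)[OF B_subring] by (simp add: UP_def fun_eq_iff)
  then show "spread \<one>\<^bsub>UP BB\<^esub> = \<one>\<^bsub>S.E\<^esub>"
    using subringE(3)[OF B_subring] by (simp add: spread_monom S.ore_one)
qed

lemma spread_in_C: "f \<in> up BB \<Longrightarrow> spread f \<in> C"
proof (induction f rule: BB.up_induct)
  case (monom b k)
  then have b: "b \<in> B" by simp
  have pow: "up_ring.monom (UP S) \<one>\<^bsub>S\<^esub> (m * k) \<in> C"
  proof (induction k)
    case 0
    show ?case using subringE(3)[OF C_subring] by (simp add: S.ore_one)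
  next
    case (Suc k)
    have "up_ring.monom (UP S) \<one>\<^bsub>S\<^esub> m \<otimes>\<^bsub>S.E\<^esub> up_ring.monom (UP S) \<one>\<^bsub>S\<^esub> (m * k)
        = up_ring.monom (UP S) \<one>\<^bsub>S\<^esub> (m * Suc k)"
      by (simp add: S.ore_pow_var_mult S.UP_monom_closed S.T_pow_const_seq add.commute)
    then show ?case using subringE(6)[OF C_subring var_pow_C Suc] by simp
  qed
  have "pconst S b \<otimes>\<^bsub>S.E\<^esub> up_ring.monom (UP S) \<one>\<^bsub>S\<^esub> (m * k) = up_ring.monom (UP S) b (m * k)"
    using B_closed[OF b] by (simp add: S.ore_monom_mult S.UP_monom_closed) (auto simp: S.UP_monom_eq)
  then show ?case
    using subringE(6)[OF C_subring pconst_C[OF b] pow] b by (simp add: spread_monom)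
next
  case (add f g)
  have "spread (\<lambda>i. f i \<oplus>\<^bsub>BB\<^esub> g i) = spread f \<oplus>\<^bsub>S.E\<^esub> spread g"
    using add ring_hom_add[OF spread_hom, of f g] by (simp add: BB.UP_add_eq)
  then show ?case using subringE(7)[OF C_subring add(3,4)] by simp
qed

text \<open>\<open>C\<close> is the least subring containing the generators, and the image of
  \<open>spread\<close> is such a subring; the other inclusion is
  \<open>spread_in_C\<close>.\<close>

lemma spread_image: "spread ` up BB = C"
proof
  show "spread ` up BB \<subseteq> C" using spread_in_C by auto
  interpret U: ring "UP BB" by (rule BB.UP_is_ring)
  interpret sp: ring_hom_ring "UP BB" S.E spread
    by (rule ring_hom_ringI2) (use U.ring_axioms SE.ring_axioms spread_hom in auto)
  have one: "\<one>\<^bsub>S\<^esub> \<in> B" by (rule subringE(3)[OF B_subring])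
  have "subring (spread ` up BB) S.E"
    using sp.img_is_subring[OF U.carrier_is_subring] by simp
  moreover have "pconst S b \<in> spread ` up BB" if "b \<in> B" for b
    using spread_monom[OF that, of 0] BB.UP_monom_closed[of b 0] that
    by (intro image_eqI[of _ _ "pconst BB b"]) simp_all
  moreover have "pvar S [^]\<^bsub>S.E\<^esub> m \<in> spread ` up BB"
    using spread_monom[OF one, of 1] BB.UP_monom_closed[of "\<one>\<^bsub>S\<^esub>" 1] one
    by (intro image_eqI[of _ _ "pvar BB"]) (simp_all add: S.ore_var_pow del: One_nat_def)
  ultimately show "C \<subseteq> spread ` up BB"
    by (intro SE.generate_ring_min_subring1)
      (auto simp: S.UP_monom_closed B_closed S.ore_var_pow simp del: One_nat_def)
qed

lemma spread_iso: "spread \<in> ring_iso (UP BB) (S.E\<lparr>carrier := C\<rparr>)"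
proof -
  have "inj_on spread (up BB)"
  proof (rule inj_onI)
    fix f g assume "spread f = spread g"
    then have "spread f (m * k) = spread g (m * k)" for k by simp
    then show "f = g" by (simp add: fun_eq_iff)
  qed
  then have "bij_betw spread (up BB) C" using spread_image by (simp add: bij_betw_def)
  then show ?thesis
    using spread_hom spread_in_C by (auto simp: ring_iso_def ring_hom_def)
qed

text \<open>The criterion that stands in for the q-binomial computation: elements of
  \<open>C\<close> are polynomials in \<open>t^m\<close> over \<open>B\<close>, hence have no
  coefficient strictly between exponents 0 and \<open>m\<close>.\<close>

lemma C_coeff:
  assumes "p \<in> C"
  shows "p n \<in> B" and "\<not> m dvd n \<Longrightarrow> p n = \<zero>\<^bsub>S\<^esub>"
proof -
  obtain f where "f \<in> up BB" "p = spread f" using assms spread_image by auto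
  then show "p n \<in> B" "\<not> m dvd n \<Longrightarrow> p n = \<zero>\<^bsub>S\<^esub>" by (simp_all add: spread_B, simp add: spread_def)
qed

section \<open>Brackets of constants and of \<open>z\<close>\<close>

lemma sigma_monom: "a \<in> carrier R \<Longrightarrow>
    (\<lambda>n. \<sigma> (up_ring.monom (UP R) a k n)) = up_ring.monom (UP S) (\<sigma> a) k"
  by (auto simp: R.UP_monom_eq S.UP_monom_eq)

text \<open>Constants lift to constants, so the commutator and its quotient by \<open>h\<close> are
  computed inside \<open>R\<close>.\<close>

lemma brC_const:
  assumes b: "b \<in> B" "b' \<in> B"
  shows "brC (pconst S b) (pconst S b') = pconst S (brB b b')"
proof -
  obtain r where r: "r \<in> carrier R" "\<sigma> r = b" using lift B_closed b by metis
  obtain s where s: "s \<in> carrier R" "\<sigma> s = b'" using lift B_closed b by metis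
  obtain v where v: "v \<in> carrier R" "r \<otimes> s \<ominus> s \<otimes> r = h \<otimes> v" "brB b b' = \<sigma> v"
    using bracket_lift[of r s] r s b B_center by metis
  note pc = R.pconst_hom
  have "pconst R r \<otimes>\<^bsub>R.E\<^esub> pconst R s \<ominus>\<^bsub>R.E\<^esub> pconst R s \<otimes>\<^bsub>R.E\<^esub> pconst R r
      = pconst R (r \<otimes> s) \<ominus>\<^bsub>R.E\<^esub> pconst R (s \<otimes> r)"
    using r s by (simp add: ring_hom_mult[OF pc])
  also have "\<dots> = pconst R (r \<otimes> s \<ominus> s \<otimes> r)"
    using r s by (simp add: R.ore_minus R.UP_monom_closed) (auto simp: R.UP_monom_eq R.minus_eq)
  also have "\<dots> = pconst R h \<otimes>\<^bsub>R.E\<^esub> pconst R v"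
    using v by (simp add: ring_hom_mult[OF pc])
  finally have "brC (\<lambda>n. \<sigma> (pconst R r n)) (\<lambda>n. \<sigma> (pconst R s n)) = (\<lambda>n. \<sigma> (pconst R v n))"
    using r s v b C_center[OF pconst_C]
    by (intro Q.bracket_eq) (simp_all add: R.UP_monom_closed sigma_monom)
  then show ?thesis using r s v by (simp add: sigma_monom)
qed

text \<open>Closure is inherited from \<open>C\<close>: the bracket of two constants lies in
  \<open>C\<close> and is itself constant, so its coefficient lies in \<open>B\<close> by
  \<open>C_coeff\<close>.\<close>

lemma brB_closed: "\<lbrakk>b \<in> B; b' \<in> B\<rbrakk> \<Longrightarrow> brB b b' \<in> B"
proof -
  assume b: "b \<in> B" "b' \<in> B"
  obtain r where r: "r \<in> carrier R" "\<sigma> r = b" using lift B_closed b by metis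
  obtain s where s: "s \<in> carrier R" "\<sigma> s = b'" using lift B_closed b by metis
  obtain v where v: "v \<in> carrier R" "brB b b' = \<sigma> v"
    using bracket_lift[of r s] r s b B_center by metis
  have "pconst S (brB b b') \<in> C"
    using brC_closed[OF pconst_C pconst_C] b by (simp add: brC_const[symmetric])
  from C_coeff(1)[OF this, of 0] show "brB b b' \<in> B" using v by (simp add: S.UP_monom_eq)
qed

lemma poisson_BB: "poisson_algebra (\<lambda>c. \<sigma> (\<iota> c)) BB brB"
  using iota B brB_closed by (rule bracket_poisson)

lemma poisson_CC: "poisson_algebra (\<lambda>c. pconst S (\<sigma> (\<iota> c))) (S.E\<lparr>carrier := C\<rparr>) brC"
proof -
  have \<iota>E: "algebra_over (\<lambda>c. pconst R (\<iota> c)) R.E"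
    using iota tau_iota delta_iota by (rule R.algebra_over_ore)
  have "\<iota> c \<in> carrier R" for c
    using iota by (auto simp: algebra_over_def ring_center_def)
  then have e: "(\<lambda>n. \<sigma> (pconst R (\<iota> c) n)) = pconst S (\<sigma> (\<iota> c))" for c by (simp add: sigma_monom)
  show ?thesis
    using Q.bracket_poisson[OF \<iota>E, of C] C_poisson
    by (simp add: e central_poisson_subalgebra_def)
qed

definition z where "z = (\<lambda>n. \<sigma> ((pvar R [^]\<^bsub>R.E\<^esub> m) n))"

lemma z_eq: "z = up_ring.monom (UP S) \<one>\<^bsub>S\<^esub> m"
  using sigma_monom[of \<one> m] by (simp add: z_def R.ore_var_pow del: One_nat_def)

text \<open>\<alpha> and \<beta> are read off from the bracket, not from a lift \<open>a\<close>.
  They are thus well defined from the start, and the fraction formulas can be proved for every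
  lift.\<close>

definition \<alpha> where "\<alpha> b = brC z (pconst S b) m"

definition \<beta> where "\<beta> b = brC z (pconst S b) 0"

lemma bracket_z_C: "b \<in> B \<Longrightarrow> brC z (pconst S b) \<in> C"
  unfolding z_eq by (intro brC_closed var_pow_C pconst_C)

lemma alpha_beta_closed: "b \<in> B \<Longrightarrow> \<alpha> b \<in> B" "b \<in> B \<Longrightarrow> \<beta> b \<in> B"
  unfolding \<alpha>_def \<beta>_def by (rule C_coeff(1)[OF bracket_z_C], assumption)+

text \<open>\<open>{z, b}\<close> has degree at most \<open>m\<close>, and its intermediate coefficients vanish since it lies in \<open>C\<close>.\<close>

lemma bracket_z:
  assumes b: "b \<in> B" and a: "a \<in> carrier R" "\<sigma> a = b"
  obtains u v where "u \<in> carrier R" "(\<tau> ^^ m) a \<ominus> a = h \<otimes> u" "\<alpha> b = \<sigma> u"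
    "v \<in> carrier R" "(\<delta> ^^ m) a = h \<otimes> v" "\<beta> b = \<sigma> v"
    "brC z (pconst S b) = pconst S (\<alpha> b) \<otimes>\<^bsub>S.E\<^esub> z \<oplus>\<^bsub>S.E\<^esub> pconst S (\<beta> b)"
proof -
  let ?t = "up_ring.monom (UP R) \<one> m"
  have tR: "?t \<in> up R" and aR: "pconst R a \<in> up R" by (simp_all add: R.UP_monom_closed a)
  have st: "(\<lambda>n. \<sigma> (?t n)) = z" using sigma_monom[of \<one> m] by (simp add: z_eq)
  have sa: "(\<lambda>n. \<sigma> (pconst R a n)) = pconst S b" using a by (simp add: sigma_monom)
  obtain V where V: "V \<in> up R"
    "?t \<otimes>\<^bsub>R.E\<^esub> pconst R a \<ominus>\<^bsub>R.E\<^esub> pconst R a \<otimes>\<^bsub>R.E\<^esub> ?t = pconst R h \<otimes>\<^bsub>R.E\<^esub> V"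
    "brC z (pconst S b) = (\<lambda>n. \<sigma> (V n))"
  proof -
    have "z \<in> ring_center S.E" "pconst S b \<in> ring_center S.E"
      using C_center var_pow_C pconst_C[OF b] by (simp_all add: z_eq)
    then show thesis
      using Q.bracket_lift[of ?t "pconst R a"] tR aR that unfolding st sa by auto
  qed
  have Vc: "V n \<in> carrier R" for n using V(1) by auto
  have T: "(R.T ^^ m) (pconst R a) n \<in> carrier R" for n
    using aR by (simp add: R.T_pow_coeff_closed R.up_funcset)
  \<comment> \<open>Both products are known coefficientwise: \<open>t^m a\<close> is
    \<open>T^m\<close> applied to the constant \<open>a\<close>, and \<open>a t^m\<close> is a
    monomial.\<close>
  have com: "(R.T ^^ m) (pconst R a) n \<ominus> (if n = m then a else \<zero>) = h \<otimes> V n" for n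
  proof -
    have "pconst R a \<otimes>\<^bsub>R.E\<^esub> ?t = (\<lambda>n. if n = m then a else \<zero>)"
      using a tR by (simp add: R.ore_monom_mult) (auto simp: R.UP_monom_eq)
    moreover have "(\<lambda>n. if n = m then a else \<zero>) \<in> up R"
      using R.UP_monom_closed[of a m] R.UP_monom_eq[of a m] a by simp
    moreover have "?t \<otimes>\<^bsub>R.E\<^esub> pconst R a = (R.T ^^ m) (pconst R a)"
      using aR by (rule R.ore_pow_var_mult)
    moreover have "(pconst R h \<otimes>\<^bsub>R.E\<^esub> V) n = h \<otimes> V n"
      using V(1) by (simp add: R.ore_monom_mult)
    ultimately show ?thesis
      using fun_cong[OF V(2), of n] R.T_pow_up[OF aR, of m] by (simp only: R.ore_minus)
  qed
  have Vm: "(\<tau> ^^ m) a \<ominus> a = h \<otimes> V m"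
    using com[of m] a by (simp add: R.T_pow_pconst_top)
  \<comment> \<open>As \<open>0 < m\<close>, the monomial \<open>a t^m\<close> does not contribute
    at exponent 0.\<close>
  have V0: "(\<delta> ^^ m) a = h \<otimes> V 0"
    using com[of 0] T[of 0] a m_pos by (simp add: R.T_pow_pconst_0 R.minus_eq)
  have al: "\<alpha> b = \<sigma> (V m)" and be: "\<beta> b = \<sigma> (V 0)" by (simp_all add: \<alpha>_def \<beta>_def V(3))
  have sV: "(\<lambda>n. \<sigma> (V n)) \<in> C"
    unfolding V(3)[symmetric] by (rule bracket_z_C[OF b])
  \<comment> \<open>Beyond \<open>m\<close> the commutator vanishes already before reduction, by its
    degree, and \<open>h\<close> can be cancelled. Between 0 and \<open>m\<close> only the reduced
    coefficient is known to vanish, by membership in \<open>C\<close>.\<close>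
  have other: "\<sigma> (V n) = \<zero>\<^bsub>S\<^esub>" if "n \<noteq> 0" "n \<noteq> m" for n
  proof (cases "n < m")
    case True
    then have "\<not> m dvd n" using that by (auto dest: dvd_imp_le)
    then show ?thesis using C_coeff(2)[OF sV] by simp
  next
    case False
    have "bound \<zero> 0 (pconst R a)" using a by (auto simp: R.UP_monom_eq)
    then have "(R.T ^^ m) (pconst R a) n = \<zero>"
      using False that by (intro bound.bound[OF R.T_pow_bound]) auto
    then have "(R.T ^^ m) (pconst R a) n \<ominus> (if n = m then a else \<zero>) = h \<otimes> \<zero>"
      using that by (simp add: R.minus_eq)
    then have "h \<otimes> V n = h \<otimes> \<zero>" by (simp only: com)
    then have "V n = \<zero>" by (rule h_cancel[OF Vc R.zero_closed])
    then show ?thesis by simp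
  qed
  have ab: "\<alpha> b \<in> carrier S" "\<beta> b \<in> carrier S" using alpha_beta_closed[OF b] B_closed by auto
  have zS: "z \<in> up S" by (simp add: z_eq S.UP_monom_closed)
  have "pconst S (\<alpha> b) \<otimes>\<^bsub>S.E\<^esub> z = up_ring.monom (UP S) (\<alpha> b) m"
    using ab zS by (simp add: S.ore_monom_mult) (auto simp: z_eq S.UP_monom_eq)
  then have "pconst S (\<alpha> b) \<otimes>\<^bsub>S.E\<^esub> z \<oplus>\<^bsub>S.E\<^esub> pconst S (\<beta> b) = (\<lambda>n. \<sigma> (V n))"
    using ab m_pos
    by (simp add: S.ore_add S.UP_monom_closed) (auto simp: S.UP_monom_eq fun_eq_iff other al be)
  then show thesis using that[OF Vc Vm al Vc V0 be] V(3) by simp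
qed

text \<open>The bracket of \<open>C\<close> pulled back along \<open>spread\<close>, a bijection
  onto \<open>C\<close>; for polynomials over \<open>B\<close> the argument of
  \<open>inv_into\<close> lies in its image.\<close>

definition P where "P f g = inv_into (up BB) spread (brC (spread f) (spread g))"

lemma P_closed: "\<lbrakk>f \<in> up BB; g \<in> up BB\<rbrakk> \<Longrightarrow> P f g \<in> up BB"
  and spread_P: "\<lbrakk>f \<in> up BB; g \<in> up BB\<rbrakk> \<Longrightarrow> spread (P f g) = brC (spread f) (spread g)"
proof -
  assume "f \<in> up BB" "g \<in> up BB"
  then have "brC (spread f) (spread g) \<in> spread ` up BB"
    unfolding spread_image by (intro brC_closed spread_in_C)
  then show "P f g \<in> up BB" "spread (P f g) = brC (spread f) (spread g)"
    unfolding P_def by (rule inv_into_into, rule f_inv_into_f)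
qed

lemma spread_inj: "\<lbrakk>f \<in> up BB; g \<in> up BB; spread f = spread g\<rbrakk> \<Longrightarrow> f = g"
  using ring_iso_memE(5)[OF spread_iso] by (auto simp: bij_betw_def inj_on_def)

lemma spread_pconst: "b \<in> B \<Longrightarrow> spread (pconst BB b) = pconst S b"
  by (simp add: spread_monom)

lemma one_B: "\<one>\<^bsub>S\<^esub> \<in> B"
  by (rule subringE(3)[OF B_subring])

lemma spread_pvar: "spread (pvar BB) = z"
  using spread_monom[OF one_B, of 1] by (simp add: z_eq del: One_nat_def)

lemma pconst_BB_closed: "b \<in> B \<Longrightarrow> pconst BB b \<in> up BB"
  by (rule BB.UP_monom_closed) simp

lemma pvar_BB_closed: "pvar BB \<in> up BB"
  by (rule BB.UP_monom_closed) (simp add: one_B)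

text \<open>After transport to \<open>B[z]\<close> only the bracket of constants and of
  \<open>z\<close> with constants must be identified. Since \<open>spread\<close> is injective,
  these values are compared in \<open>C\<close>, where they have been computed.\<close>

theorem poisson_ore: "poisson_ore_extension (\<lambda>c. \<sigma> (\<iota> c)) BB brB \<alpha> \<beta> P"
proof -
  interpret U: ring "UP BB" by (rule BB.UP_is_ring)
  have "poisson_algebra (\<lambda>c. pconst BB (\<sigma> (\<iota> c))) (UP BB) P"
    using spread_iso U.ring_axioms poisson_CC
    by (rule poisson_algebra_transport)
      (simp_all add: pconst_BB_closed kappa_B spread_pconst P_closed spread_P)
  then interpret PB: poisson_ore_bracket "\<lambda>c. \<sigma> (\<iota> c)" BB brB P \<alpha> \<beta>
  proof (intro poisson_ore_bracket.intro poisson.intro poisson_BB poisson_ore_bracket_axioms.intro)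
    fix b assume "b \<in> carrier BB"
    then have b: "b \<in> B" by simp
    then show "\<alpha> b \<in> carrier BB" "\<beta> b \<in> carrier BB" by (simp_all add: alpha_beta_closed)
    note cl = pconst_BB_closed pvar_BB_closed alpha_beta_closed b
    obtain a where a: "a \<in> carrier R" "\<sigma> a = b" using lift B_closed b by metis
    have m: "pconst BB (\<alpha> b) \<otimes>\<^bsub>UP BB\<^esub> pvar BB \<in> carrier (UP BB)"
      using cl by (intro U.m_closed) simp_all
    show "P (pvar BB) (pconst BB b)
        = pconst BB (\<alpha> b) \<otimes>\<^bsub>UP BB\<^esub> pvar BB \<oplus>\<^bsub>UP BB\<^esub> pconst BB (\<beta> b)"
    proof (rule spread_inj)
      have "spread (P (pvar BB) (pconst BB b)) = brC z (pconst S b)"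
        using spread_P[OF pvar_BB_closed pconst_BB_closed[OF b]] b
        by (simp only: spread_pvar spread_pconst)
      also have "\<dots> = pconst S (\<alpha> b) \<otimes>\<^bsub>S.E\<^esub> z \<oplus>\<^bsub>S.E\<^esub> pconst S (\<beta> b)"
        by (rule bracket_z[OF b a])
      also have "\<dots> = spread (pconst BB (\<alpha> b) \<otimes>\<^bsub>UP BB\<^esub> pvar BB \<oplus>\<^bsub>UP BB\<^esub> pconst BB (\<beta> b))"
      proof -
        have c: "pconst BB (\<alpha> b) \<in> carrier (UP BB)" "pvar BB \<in> carrier (UP BB)"
          "pconst BB (\<beta> b) \<in> carrier (UP BB)"
          using cl by simp_all
        show ?thesis
          unfolding ring_hom_add[OF spread_hom m c(3)] ring_hom_mult[OF spread_hom c(1,2)]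
            spread_pvar spread_pconst[OF alpha_beta_closed(1)[OF b]]
            spread_pconst[OF alpha_beta_closed(2)[OF b]] ..
      qed
      finally show "spread (P (pvar BB) (pconst BB b))
        = spread (pconst BB (\<alpha> b) \<otimes>\<^bsub>UP BB\<^esub> pvar BB \<oplus>\<^bsub>UP BB\<^esub> pconst BB (\<beta> b))" .
      show "P (pvar BB) (pconst BB b) \<in> up BB" using cl by (intro P_closed)
      show "pconst BB (\<alpha> b) \<otimes>\<^bsub>UP BB\<^esub> pvar BB \<oplus>\<^bsub>UP BB\<^esub> pconst BB (\<beta> b) \<in> up BB"
        using U.a_closed[OF m, of "pconst BB (\<beta> b)"] cl by simp
    qed
  next
    fix b b' assume "b \<in> carrier BB" "b' \<in> carrier BB"
    then have b: "b \<in> B" "b' \<in> B" by simp_all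
    show "P (pconst BB b) (pconst BB b') = pconst BB (brB b b')"
    proof (rule spread_inj)
      show "spread (P (pconst BB b) (pconst BB b')) = spread (pconst BB (brB b b'))"
        by (simp only: spread_P pconst_BB_closed b spread_pconst brB_closed brC_const)
    qed (intro P_closed pconst_BB_closed brB_closed b)+
  qed
  show ?thesis by (rule PB.poisson_ore_extension)
qed

theorem central_power_poisson_ore:
  "\<exists>\<alpha> \<beta> P \<phi>.
    poisson_ore_extension (\<lambda>c. \<sigma> (\<iota> c)) BB brB \<alpha> \<beta> P \<and>
    poisson_algebra (\<lambda>c. pconst S (\<sigma> (\<iota> c))) (S.E\<lparr>carrier := C\<rparr>) brC \<and>
    \<phi> \<in> ring_iso (UP BB) (S.E\<lparr>carrier := C\<rparr>) \<and>
    (\<forall>b\<in>B. \<phi> (pconst BB b) = pconst S b) \<and>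
    \<phi> (pvar BB) = z \<and>
    (\<forall>f\<in>carrier (UP BB). \<forall>g\<in>carrier (UP BB). \<phi> (P f g) = brC (\<phi> f) (\<phi> g)) \<and>
    (\<forall>b\<in>B. \<forall>b'\<in>B. brC (pconst S b) (pconst S b') = pconst S (brB b b')) \<and>
    (\<forall>b\<in>B. brC z (pconst S b) = pconst S (\<alpha> b) \<otimes>\<^bsub>S.E\<^esub> z \<oplus>\<^bsub>S.E\<^esub> pconst S (\<beta> b)) \<and>
    (\<forall>b\<in>B. \<forall>a\<in>carrier R. \<sigma> a = b \<longrightarrow>
      h divides\<^bsub>R\<^esub> ((\<tau> ^^ m) a \<ominus> a) \<and> \<alpha> b = \<sigma> (fraction R h ((\<tau> ^^ m) a \<ominus> a)) \<and>
      h divides\<^bsub>R\<^esub> (\<delta> ^^ m) a \<and> \<beta> b = \<sigma> (fraction R h ((\<delta> ^^ m) a)))"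
proof (rule exI[of _ \<alpha>], rule exI[of _ \<beta>], rule exI[of _ P], rule exI[of _ spread],
    intro conjI ballI impI)
  show "brC z (pconst S b) = pconst S (\<alpha> b) \<otimes>\<^bsub>S.E\<^esub> z \<oplus>\<^bsub>S.E\<^esub> pconst S (\<beta> b)" if b: "b \<in> B" for b
  proof -
    obtain a where a: "a \<in> carrier R" "\<sigma> a = b" using lift B_closed b by metis
    show ?thesis by (rule bracket_z[OF b a])
  qed
  fix b a assume b: "b \<in> B" "a \<in> carrier R" "\<sigma> a = b"
  obtain u v where uv: "u \<in> carrier R" "(\<tau> ^^ m) a \<ominus> a = h \<otimes> u" "\<alpha> b = \<sigma> u"
    "v \<in> carrier R" "(\<delta> ^^ m) a = h \<otimes> v" "\<beta> b = \<sigma> v"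
    by (rule bracket_z[OF b])
  then show "h divides\<^bsub>R\<^esub> ((\<tau> ^^ m) a \<ominus> a)" "h divides\<^bsub>R\<^esub> (\<delta> ^^ m) a"
    unfolding factor_def by blast+
  show "\<alpha> b = \<sigma> (fraction R h ((\<tau> ^^ m) a \<ominus> a))" "\<beta> b = \<sigma> (fraction R h ((\<delta> ^^ m) a))"
    using uv by (simp_all add: fraction_eq)
qed (rule poisson_ore poisson_CC spread_iso spread_pconst spread_pvar brC_const spread_P; simp)+

end

section \<open>Specialization\<close>

lemma algebra_over_center: "algebra_over \<eta> A \<Longrightarrow> \<eta> x \<in> ring_center A"
  unfolding algebra_over_def by blast

lemma ring_of_type_algebra_simps:
  "carrier ring_of_type_algebra = UNIV"
  "x \<otimes>\<^bsub>ring_of_type_algebra\<^esub> y = x * y"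
  "x \<oplus>\<^bsub>ring_of_type_algebra\<^esub> y = x + y"
  "\<one>\<^bsub>ring_of_type_algebra\<^esub> = 1"
  by (simp_all add: ring_of_type_algebra_def)

lemma q_skew_extension_skew_ring:
  assumes "ring A" "q_skew_extension \<kappa> A q \<tau> \<delta>"
  shows "skew_ring A \<tau> \<delta>"
  using assms
  by (auto simp: skew_ring_def skew_ring_axioms_def q_skew_extension_def algebra_aut_def
      ring_iso_def skew_derivation_def)

text \<open>\<open>\<tau>\<close> and \<open>\<delta>\<close> are only assumed linear over \<open>\<k>\<close>; since \<open>q\<close> is fixed and can be cancelled,
  they are linear over \<open>\<k>[q\<^sup>\<plusminus>\<^sup>1]\<close>.\<close>

lemma q_skew_extension_scalars:
  fixes A (structure)
  assumes \<eta>: "algebra_over \<eta> A" and skew: "q_skew_extension (scalars \<eta>) A (\<eta> laurent_q) \<tau> \<delta>"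
  shows "\<tau> (\<eta> x) = \<eta> x \<and> \<delta> (\<eta> x) = \<zero>"
proof -
  have "ring A" using \<eta> by (simp add: algebra_over_def)
  then interpret skew_ring A \<tau> \<delta> using skew by (rule q_skew_extension_skew_ring)
  have hom: "\<eta> \<in> ring_hom ring_of_type_algebra A" using \<eta> by (simp add: algebra_over_def)
  have [simp]: "\<eta> y \<in> carrier A" for y
    using \<eta> by (intro ring_center_closed algebra_over_center)
  have mult: "\<eta> (x * y) = \<eta> x \<otimes> \<eta> y" and plus: "\<eta> (x + y) = \<eta> x \<oplus> \<eta> y" for x y
    using ring_hom_mult[OF hom, of x y] ring_hom_add[OF hom, of x y]
    by (simp_all only: ring_of_type_algebra_simps UNIV_I)
  let ?q = "\<eta> laurent_q"
  have q: "\<tau> ?q = ?q" "\<delta> ?q = \<zero>" and nzd: "non_zero_divisor A ?q"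
    using skew unfolding q_skew_extension_def by blast+
  have cancel: "y = \<zero>" if "y \<in> carrier A" "?q \<otimes> y = \<zero>" for y
    using nzd that unfolding non_zero_divisor_def by blast
  have tau_q: "\<tau> (?q \<otimes> y) = ?q \<otimes> \<tau> y" and delta_q: "\<delta> (?q \<otimes> y) = ?q \<otimes> \<delta> y"
    if "y \<in> carrier A" for y
    using that by (simp_all add: tau_mult delta_mult q)
  show ?thesis
  proof (induction x rule: laurent_induct)
    case (const c)
    \<comment> \<open>Linearity concerns products with scalars, so the scalar is written as a
      multiple of 1, and \<open>\<delta> \<one> = \<zero>\<close>.\<close>
    have "\<delta> (scalars \<eta> c \<otimes> \<one>) = scalars \<eta> c \<otimes> \<delta> \<one>"
      using skew unfolding q_skew_extension_def skew_derivation_def by blast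
    moreover have "\<tau> (scalars \<eta> c) = scalars \<eta> c"
      using skew unfolding q_skew_extension_def algebra_aut_def by blast
    ultimately show ?case by simp
  next
    case (add x y)
    then show ?case by (simp add: plus tau_add delta_add)
  next
    case (shift x)
    then show ?case by (simp add: mult tau_q delta_q)
  next
    case (unshift x)
    then have "?q \<otimes> \<tau> (\<eta> x) = ?q \<otimes> \<eta> x" and d: "?q \<otimes> \<delta> (\<eta> x) = \<zero>"
      by (simp_all add: mult tau_q delta_q)
    then have "?q \<otimes> (\<tau> (\<eta> x) \<ominus> \<eta> x) = \<zero>"
      by (simp add: minus_eq r_distr r_minus r_neg)
    then have "\<tau> (\<eta> x) \<ominus> \<eta> x = \<zero>" by (rule cancel[rotated]) simp
    then show ?case using cancel[OF _ d] by simp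
  qed
qed

text \<open>\<open>f\<close> maps multiples of \<open>h\<close> to multiples of \<open>h\<close>, so
  \<open>\<sigma> (f y)\<close> is constant on a coset and \<open>the_elem\<close> returns that
  value. Both \<tau> and \<delta> qualify: \<open>\<tau> h = h\<close> and
  \<open>\<delta> h = \<zero>\<close> give \<delta>(h x) = h \<delta>(x).\<close>

lemma (in quotient_map) induced_map:
  assumes f: "f \<in> carrier R \<rightarrow> carrier R"
    and f_add: "\<And>x y. \<lbrakk>x \<in> carrier R; y \<in> carrier R\<rbrakk> \<Longrightarrow> f (x \<oplus> y) = f x \<oplus> f y"
    and f_h: "\<And>x. x \<in> carrier R \<Longrightarrow> f (h \<otimes> x) = h \<otimes> f x"
    and x: "x \<in> carrier R"
  shows "the_elem ((\<lambda>a. \<sigma> (f a)) ` (Idl {h} +> x)) = \<sigma> (f x)"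
proof -
  have "\<sigma> (f y) = \<sigma> (f x)" if y: "y \<in> carrier R" "\<sigma> y = \<sigma> x" for y
  proof -
    obtain u where u: "u \<in> carrier R" "y \<ominus> x = h \<otimes> u"
      using x y sigma_eq_iff[of y x] by (auto simp: factor_def)
    have "y = (y \<ominus> x) \<oplus> x" using x y(1) by algebra
    then have "f y = h \<otimes> f u \<oplus> f x" using x u f_add[of "h \<otimes> u" x] by (simp add: f_h)
    moreover have "f u \<in> carrier R" "f x \<in> carrier R" using f u x by auto
    ultimately show ?thesis by simp
  qed
  then have "(\<lambda>a. \<sigma> (f a)) ` (Idl {h} +> x) = {\<sigma> (f x)}"
    unfolding coset_eq[OF x] using x by (intro equalityI image_subsetI) blast+
  then show ?thesis by simp
qed

lemma (in quotient_map) skew_quotientI: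
  assumes "skew_ring R \<tau> \<delta>" and h: "\<tau> h = h" "\<delta> h = \<zero>"
    and tau: "\<And>x. x \<in> carrier R \<Longrightarrow> \<tau>' (\<sigma> x) = \<sigma> (\<tau> x)"
    and delta: "\<And>x. x \<in> carrier R \<Longrightarrow> \<delta>' (\<sigma> x) = \<sigma> (\<delta> x)"
  shows "skew_quotient R S h \<sigma> \<tau> \<delta> \<tau>' \<delta>'"
proof -
  interpret T: skew_ring R \<tau> \<delta> by fact
  have "skew_ring S \<tau>' \<delta>'"
  proof
    show "\<tau>' \<in> ring_hom S S"
    proof (rule ring_hom_memI)
      fix x y assume "x \<in> carrier S" "y \<in> carrier S"
      then obtain r s where rs: "r \<in> carrier R" "x = \<sigma> r" "s \<in> carrier R" "y = \<sigma> s"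
        using lift by metis
      show "\<tau>' x \<in> carrier S" using rs by (simp add: tau)
      show "\<tau>' (x \<otimes>\<^bsub>S\<^esub> y) = \<tau>' x \<otimes>\<^bsub>S\<^esub> \<tau>' y"
        using rs tau[of "r \<otimes> s"] by (simp add: tau T.tau_mult)
      show "\<tau>' (x \<oplus>\<^bsub>S\<^esub> y) = \<tau>' x \<oplus>\<^bsub>S\<^esub> \<tau>' y"
        using rs tau[of "r \<oplus> s"] by (simp add: tau T.tau_add)
    next
      show "\<tau>' \<one>\<^bsub>S\<^esub> = \<one>\<^bsub>S\<^esub>" using tau[of \<one>] by simp
    qed
    fix x y assume "x \<in> carrier S" "y \<in> carrier S"
    then obtain r s where rs: "r \<in> carrier R" "x = \<sigma> r" "s \<in> carrier R" "y = \<sigma> s"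
      using lift by metis
    show "\<delta>' x \<in> carrier S" using rs by (simp add: delta)
    show "\<delta>' (x \<oplus>\<^bsub>S\<^esub> y) = \<delta>' x \<oplus>\<^bsub>S\<^esub> \<delta>' y"
      using rs delta[of "r \<oplus> s"] by (simp add: delta T.delta_add)
    show "\<delta>' (x \<otimes>\<^bsub>S\<^esub> y) = \<delta>' x \<otimes>\<^bsub>S\<^esub> y \<oplus>\<^bsub>S\<^esub> \<tau>' x \<otimes>\<^bsub>S\<^esub> \<delta>' y"
      using rs delta[of "r \<otimes> s"] by (simp add: tau delta T.delta_mult)
  qed
  then show ?thesis
    using assms by (intro skew_quotient.intro quotient_map_axioms skew_quotient_axioms.intro) auto
qed

text \<open>Injectivity passes to the quotient only because the inverse of \<tau> also preserves the
  multiples of \<open>h\<close>: if \<tau>(r) - \<tau>(s) = h w, surjectivity gives w = \<tau>(u),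
  and \<tau>(h u + s) = \<tau>(r) yields r = h u + s.\<close>

lemma (in skew_quotient) bij_tau':
  assumes "bij_betw \<tau> (carrier R) (carrier R)"
  shows "bij_betw \<tau>' (carrier S) (carrier S)"
  unfolding bij_betw_def
proof
  show "inj_on \<tau>' (carrier S)"
  proof (rule inj_onI)
    fix x y assume xy: "x \<in> carrier S" "y \<in> carrier S" "\<tau>' x = \<tau>' y"
    obtain r s where rs: "r \<in> carrier R" "x = \<sigma> r" "s \<in> carrier R" "y = \<sigma> s"
      using lift xy by metis
    have "\<sigma> (\<tau> r) = \<sigma> (\<tau> s)" using xy(3) rs by (simp add: sigma_tau)
    then obtain w where w: "w \<in> carrier R" "\<tau> r \<ominus> \<tau> s = h \<otimes> w"
      using rs sigma_eq_iff[of "\<tau> r" "\<tau> s"] by (auto simp: factor_def)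
    obtain u where u: "u \<in> carrier R" "w = \<tau> u"
      using assms w(1) unfolding bij_betw_def by (metis imageE)
    have "\<tau> (h \<otimes> u \<oplus> s) = h \<otimes> w \<oplus> \<tau> s"
      using u rs(3) by (simp add: R.tau_add R.tau_mult tau_h)
    also have "\<dots> = (\<tau> r \<ominus> \<tau> s) \<oplus> \<tau> s" by (simp only: w(2))
    also have "\<dots> = \<tau> r"
      using R.tau_closed[OF rs(1)] R.tau_closed[OF rs(3)] by algebra
    finally have "\<tau> (h \<otimes> u \<oplus> s) = \<tau> r" .
    then have "h \<otimes> u \<oplus> s = r"
      using assms u(1) rs unfolding bij_betw_def inj_on_def by (metis R.a_closed R.m_closed h_closed)
    then have "\<sigma> (h \<otimes> u \<oplus> s) = x" using rs by simp
    then show "x = y" using u rs by simp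
  qed
  show "\<tau>' ` carrier S = carrier S"
  proof
    show "carrier S \<subseteq> \<tau>' ` carrier S"
    proof
      fix y assume "y \<in> carrier S"
      then obtain s where s: "s \<in> carrier R" "\<sigma> s = y" by (rule lift)
      obtain u where u: "u \<in> carrier R" "s = \<tau> u"
        using assms s(1) unfolding bij_betw_def by (metis imageE)
      have "y = \<tau>' (\<sigma> u)" using u s sigma_tau[of u] by simp
      then show "y \<in> \<tau>' ` carrier S" using u by simp
    qed
  qed auto
qed

section \<open>Specialization of a q-skew extension at \<open>q = \<epsilon>\<close>\<close>

context
  fixes A :: "('a, 's) ring_scheme" (structure) and \<eta> :: "'k::comm_ring_1 laurent \<Rightarrow> 'a"
    and \<tau> \<delta> :: "'a \<Rightarrow> 'a" and \<epsilon> :: 'k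
  assumes \<eta>: "algebra_over \<eta> A"
    and skew: "q_skew_extension (scalars \<eta>) A (\<eta> laurent_q) \<tau> \<delta>"
begin

lemma skew_quotient_spec:
  "skew_quotient A (spec_ring \<eta> A \<epsilon>) (q_minus \<eta> \<epsilon>) (spec_proj \<eta> A \<epsilon>) \<tau> \<delta>
    (spec_map \<eta> A \<epsilon> \<tau>) (spec_map \<eta> A \<epsilon> \<delta>)"
proof -
  have "ring A" using \<eta> by (simp add: algebra_over_def)
  then interpret skew_ring A \<tau> \<delta> using skew by (rule q_skew_extension_skew_ring)
  have fixed: "\<tau> (q_minus \<eta> \<epsilon>) = q_minus \<eta> \<epsilon>" "\<delta> (q_minus \<eta> \<epsilon>) = \<zero>"
    using q_skew_extension_scalars[OF \<eta> skew] by (simp_all add: q_minus_def)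
  have cen: "q_minus \<eta> \<epsilon> \<in> ring_center A"
    using \<eta> unfolding q_minus_def by (rule algebra_over_center)
  have h: "q_minus \<eta> \<epsilon> \<in> carrier A" using cen by (rule ring_center_closed)
  have proj: "spec_proj \<eta> A \<epsilon> = (+>) (Idl {q_minus \<eta> \<epsilon>})" by (simp add: spec_proj_def fun_eq_iff)
  interpret quotient_map A "spec_ring \<eta> A \<epsilon>" "q_minus \<eta> \<epsilon>" "spec_proj \<eta> A \<epsilon>"
    unfolding spec_ring_def proj using cen by (rule quotient_map_proj)
  show ?thesis
  proof (rule skew_quotientI)
    fix x assume x: "x \<in> carrier A"
    show "spec_map \<eta> A \<epsilon> \<tau> (spec_proj \<eta> A \<epsilon> x) = spec_proj \<eta> A \<epsilon> (\<tau> x)"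
      unfolding spec_map_def spec_proj_def[of _ _ _ x]
      by (rule induced_map) (auto simp: x h tau_add tau_mult fixed)
    show "spec_map \<eta> A \<epsilon> \<delta> (spec_proj \<eta> A \<epsilon> x) = spec_proj \<eta> A \<epsilon> (\<delta> x)"
      unfolding spec_map_def spec_proj_def[of _ _ _ x]
      by (rule induced_map) (auto simp: x h delta_add delta_mult fixed)
  qed (rule skew_ring_axioms fixed)+
qed

lemma scalars_closed: "\<eta> x \<in> carrier A"
  using \<eta> by (intro ring_center_closed algebra_over_center)

text \<open>Together with \<open>skew_derivation_spec\<close> this ensures that
  \<open>spec_ore\<close> is an Ore extension in the required sense, with maps linear over the
  scalars.\<close>

lemma algebra_aut_spec:
  "spec_map \<eta> A \<epsilon> \<tau> \<in> algebra_aut (\<lambda>c. spec_proj \<eta> A \<epsilon> (scalars \<eta> c)) (spec_ring \<eta> A \<epsilon>)"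
proof -
  interpret skew_quotient A "spec_ring \<eta> A \<epsilon>" "q_minus \<eta> \<epsilon>" "spec_proj \<eta> A \<epsilon>" \<tau> \<delta>
    "spec_map \<eta> A \<epsilon> \<tau>" "spec_map \<eta> A \<epsilon> \<delta>"
    by (rule skew_quotient_spec)
  have "bij_betw \<tau> (carrier A) (carrier A)"
    using skew unfolding q_skew_extension_def algebra_aut_def ring_iso_def by blast
  then have "bij_betw (spec_map \<eta> A \<epsilon> \<tau>) (carrier (spec_ring \<eta> A \<epsilon>)) (carrier (spec_ring \<eta> A \<epsilon>))"
    by (rule bij_tau')
  then show ?thesis
    using S.tau_hom q_skew_extension_scalars[OF \<eta> skew]
    by (simp add: algebra_aut_def ring_iso_def sigma_tau[symmetric] scalars_closed)
qed

lemma skew_derivation_spec: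
  "skew_derivation (\<lambda>c. spec_proj \<eta> A \<epsilon> (scalars \<eta> c)) (spec_ring \<eta> A \<epsilon>)
    (spec_map \<eta> A \<epsilon> \<tau>) (spec_map \<eta> A \<epsilon> \<delta>)"
proof -
  interpret skew_quotient A "spec_ring \<eta> A \<epsilon>" "q_minus \<eta> \<epsilon>" "spec_proj \<eta> A \<epsilon>" \<tau> \<delta>
    "spec_map \<eta> A \<epsilon> \<tau>" "spec_map \<eta> A \<epsilon> \<delta>"
    by (rule skew_quotient_spec)
  show ?thesis
    using q_skew_extension_scalars[OF \<eta> skew]
    by (auto simp: skew_derivation_def S.delta_add S.delta_mult sigma_tau[symmetric]
        sigma_delta[symmetric] scalars_closed)
qed

text \<open>In the Ore extension the element q - \<epsilon> is the constant polynomial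
  \<open>pconst A (q_minus \<eta> \<epsilon>)\<close>, so \<open>ore_quotient\<close> and the
  isomorphism theorem apply.\<close>

lemma ore_ext_spec:
  "\<exists>\<phi>. \<phi> \<in> ring_iso (spec_ring (\<lambda>x. pconst A (\<eta> x)) (ore_ext A \<tau> \<delta>) \<epsilon>) (spec_ore \<eta> A \<tau> \<delta> \<epsilon>) \<and>
    (\<forall>p\<in>carrier (ore_ext A \<tau> \<delta>).
      \<phi> (spec_proj (\<lambda>x. pconst A (\<eta> x)) (ore_ext A \<tau> \<delta>) \<epsilon> p) = ore_proj \<eta> A \<epsilon> p)"
  using quotient_map.quotient_iso[OF skew_quotient.ore_quotient[OF skew_quotient_spec]]
  unfolding spec_ring_def[of "\<lambda>x. pconst A (\<eta> x)"] spec_proj_def[of "\<lambda>x. pconst A (\<eta> x)"]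
    ore_proj_def spec_ore_def q_minus_def[of "\<lambda>x. pconst A (\<eta> x)"] q_minus_def[of \<eta>, symmetric]
  by blast

lemma central_power_spec:
  assumes "non_zero_divisor A (q_minus \<eta> \<epsilon>)"
    and "central_subalgebra (\<lambda>c. spec_proj \<eta> A \<epsilon> (scalars \<eta> c)) (spec_ring \<eta> A \<epsilon>) B"
    and "0 < m"
    and "central_poisson_subalgebra (\<lambda>c. pconst (spec_ring \<eta> A \<epsilon>) (spec_proj \<eta> A \<epsilon> (scalars \<eta> c)))
      (spec_ore \<eta> A \<tau> \<delta> \<epsilon>)
      (induced_bracket (ore_ext A \<tau> \<delta>) (pconst A (q_minus \<eta> \<epsilon>)) (ore_proj \<eta> A \<epsilon>))
      (generate_ring (spec_ore \<eta> A \<tau> \<delta> \<epsilon>) (pconst (spec_ring \<eta> A \<epsilon>) ` B \<union>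
        {pvar (spec_ring \<eta> A \<epsilon>) [^]\<^bsub>spec_ore \<eta> A \<tau> \<delta> \<epsilon>\<^esub> m}))"
  shows "central_power A (spec_ring \<eta> A \<epsilon>) (q_minus \<eta> \<epsilon>) (spec_proj \<eta> A \<epsilon>) \<tau> \<delta>
    (spec_map \<eta> A \<epsilon> \<tau>) (spec_map \<eta> A \<epsilon> \<delta>) (scalars \<eta>) B m"
proof (intro central_power.intro skew_quotient_spec central_power_axioms.intro)
  have hom: "\<eta> \<in> ring_hom ring_of_type_algebra A" using \<eta> by (simp add: algebra_over_def)
  \<comment> \<open>The scalars are restricted along the inclusion of constants into Laurent
    polynomials.\<close>
  have "(laurent_const :: 'k \<Rightarrow> _) \<in> ring_hom ring_of_type_algebra ring_of_type_algebra"
    by (rule ring_hom_memI)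
      (simp_all add: ring_of_type_algebra_simps laurent_const_def mult_single single_add)
  from ring_hom_trans[OF this hom] show "algebra_over (scalars \<eta>) A"
    using \<eta> by (auto simp: algebra_over_def comp_def)
  have proj: "ore_proj \<eta> A \<epsilon> = (\<lambda>p n. spec_proj \<eta> A \<epsilon> (p n))"
    by (simp add: ore_proj_def fun_eq_iff)
  show "central_poisson_subalgebra (\<lambda>c. pconst (spec_ring \<eta> A \<epsilon>) (spec_proj \<eta> A \<epsilon> (scalars \<eta> c)))
      (ore_ext (spec_ring \<eta> A \<epsilon>) (spec_map \<eta> A \<epsilon> \<tau>) (spec_map \<eta> A \<epsilon> \<delta>))
      (induced_bracket (ore_ext A \<tau> \<delta>) (pconst A (q_minus \<eta> \<epsilon>)) (\<lambda>p n. spec_proj \<eta> A \<epsilon> (p n)))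
      (generate_ring (ore_ext (spec_ring \<eta> A \<epsilon>) (spec_map \<eta> A \<epsilon> \<tau>) (spec_map \<eta> A \<epsilon> \<delta>))
        (pconst (spec_ring \<eta> A \<epsilon>) ` B \<union> {pvar (spec_ring \<eta> A \<epsilon>)
          [^]\<^bsub>ore_ext (spec_ring \<eta> A \<epsilon>) (spec_map \<eta> A \<epsilon> \<tau>) (spec_map \<eta> A \<epsilon> \<delta>)\<^esub> m}))"
    using assms(4) unfolding spec_ore_def proj .
qed (use assms q_skew_extension_scalars[OF \<eta> skew] in auto)

end

theorem proposition3p5:
  fixes A :: "('a, 's) ring_scheme"
    and \<eta> :: "'k::{alg_closed_field, field_char_0} laurent \<Rightarrow> 'a"
    and \<tau> \<delta> :: "'a \<Rightarrow> 'a"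
  assumes "algebra_over \<eta> A"
    and "q_skew_extension (scalars \<eta>) A (\<eta> laurent_q) \<tau> \<delta>"
  shows
    "(let R = ore_ext A \<tau> \<delta>; \<eta>R = (\<lambda>x. pconst A (\<eta> x)) in
       algebra_over \<eta>R R \<and>
       (\<forall>\<epsilon>. \<epsilon> \<noteq> 0 \<longrightarrow>
         (let A\<epsilon> = spec_ring \<eta> A \<epsilon>; \<kappa>\<epsilon> = (\<lambda>c. spec_proj \<eta> A \<epsilon> (scalars \<eta> c));
              \<tau>\<epsilon> = spec_map \<eta> A \<epsilon> \<tau>; \<delta>\<epsilon> = spec_map \<eta> A \<epsilon> \<delta>
          in
            \<tau>\<epsilon> \<in> algebra_aut \<kappa>\<epsilon> A\<epsilon> \<and> skew_derivation \<kappa>\<epsilon> A\<epsilon> \<tau>\<epsilon> \<delta>\<epsilon> \<and>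
            (\<exists>\<phi>. \<phi> \<in> ring_iso (spec_ring \<eta>R R \<epsilon>) (spec_ore \<eta> A \<tau> \<delta> \<epsilon>) \<and>
              (\<forall>p\<in>carrier R. \<phi> (spec_proj \<eta>R R \<epsilon> p) = ore_proj \<eta> A \<epsilon> p)))))
     \<and>
     (\<forall>\<epsilon> B C m.
       (let R = ore_ext A \<tau> \<delta>;
            h = q_minus \<eta> \<epsilon>;
            A\<epsilon> = spec_ring \<eta> A \<epsilon>;
            R\<epsilon> = spec_ore \<eta> A \<tau> \<delta> \<epsilon>;
            \<sigma>A = spec_proj \<eta> A \<epsilon>;
            \<sigma> = ore_proj \<eta> A \<epsilon>;
            \<kappa>A = (\<lambda>c. \<sigma>A (scalars \<eta> c));
            \<kappa>R = (\<lambda>c. pconst A\<epsilon> (\<kappa>A c));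
            brB = induced_bracket A h \<sigma>A;
            brC = induced_bracket R (pconst A h) \<sigma>;
            z = \<sigma> (pvar A [^]\<^bsub>R\<^esub> m);
            BB = A\<epsilon>\<lparr>carrier := B\<rparr>;
            CC = R\<epsilon>\<lparr>carrier := C\<rparr>
        in
          \<epsilon> \<noteq> 0 \<longrightarrow>
          non_zero_divisor A h \<longrightarrow>
          central_subalgebra \<kappa>A A\<epsilon> B \<longrightarrow>
          period_on (spec_map \<eta> A \<epsilon> \<tau>) B m \<longrightarrow>
          C = generate_ring R\<epsilon> (pconst A\<epsilon> ` B \<union> {pvar A\<epsilon> [^]\<^bsub>R\<epsilon>\<^esub> m}) \<longrightarrow>
          central_poisson_subalgebra \<kappa>R R\<epsilon> brC C \<longrightarrow>
          (\<exists>\<alpha> \<beta> P \<phi>.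
            poisson_ore_extension \<kappa>A BB brB \<alpha> \<beta> P \<and>
            poisson_algebra \<kappa>R CC brC \<and>
            \<phi> \<in> ring_iso (UP BB) CC \<and>
            (\<forall>b\<in>B. \<phi> (pconst BB b) = pconst A\<epsilon> b) \<and>
            \<phi> (pvar BB) = z \<and>
            (\<forall>f\<in>carrier (UP BB). \<forall>g\<in>carrier (UP BB). \<phi> (P f g) = brC (\<phi> f) (\<phi> g)) \<and>
            (\<forall>b\<in>B. \<forall>b'\<in>B. brC (pconst A\<epsilon> b) (pconst A\<epsilon> b') = pconst A\<epsilon> (brB b b')) \<and>
            (\<forall>b\<in>B. brC z (pconst A\<epsilon> b) =
              pconst A\<epsilon> (\<alpha> b) \<otimes>\<^bsub>R\<epsilon>\<^esub> z \<oplus>\<^bsub>R\<epsilon>\<^esub> pconst A\<epsilon> (\<beta> b)) \<and>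
            (\<forall>b\<in>B. \<forall>a\<in>carrier A. \<sigma>A a = b \<longrightarrow>
              h divides\<^bsub>A\<^esub> ((\<tau> ^^ m) a \<ominus>\<^bsub>A\<^esub> a) \<and>
              \<alpha> b = \<sigma>A (fraction A h ((\<tau> ^^ m) a \<ominus>\<^bsub>A\<^esub> a)) \<and>
              h divides\<^bsub>A\<^esub> (\<delta> ^^ m) a \<and>
              \<beta> b = \<sigma>A (fraction A h ((\<delta> ^^ m) a))))))"
proof -
  have "ring A" using assms(1) by (simp add: algebra_over_def)
  then interpret skew_ring A \<tau> \<delta> using assms(2) by (rule q_skew_extension_skew_ring)
  show ?thesis
    unfolding Let_def
  proof (intro conjI allI impI, goal_cases)
    case 1
    show ?case
      using assms(1) q_skew_extension_scalars[OF assms] by (intro algebra_over_ore) auto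
  next
    case 2
    show ?case using assms by (rule algebra_aut_spec)
  next
    case 3
    show ?case using assms by (rule skew_derivation_spec)
  next
    case 4
    show ?case using assms by (rule ore_ext_spec)
  next
    case prems: (5 \<epsilon> B C m)
    have m: "0 < m" using prems(4) by (simp add: period_on_def)
    have proj: "ore_proj \<eta> A \<epsilon> = (\<lambda>p n. spec_proj \<eta> A \<epsilon> (p n))"
      by (simp add: ore_proj_def fun_eq_iff)
    interpret CP: central_power A "spec_ring \<eta> A \<epsilon>" "q_minus \<eta> \<epsilon>" "spec_proj \<eta> A \<epsilon>" \<tau> \<delta>
      "spec_map \<eta> A \<epsilon> \<tau>" "spec_map \<eta> A \<epsilon> \<delta>" "scalars \<eta>" B m
      using assms prems(2,3) m prems(6)[unfolded prems(5)] by (rule central_power_spec)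
    show ?case
      unfolding prems(5) proj spec_ore_def
      by (rule CP.central_power_poisson_ore[unfolded CP.z_def])
  qed
qed

end
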